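(* Let $p\in[1,\infty)$. For each $n\in\mathbb N$ let $\mathbf X_n=(X_1^{(n)},\dots,X_n^{(n)})$ be a random vector that is either uniformly distributed over $\mathbb B_p^n$, or distributed according to the cone probability measure $\mu_p$ on $\mathbb S_p^{n-1}$, or distributed according to the surface probability measure $\sigma_p$ on $\mathbb S_p^{n-1}$. Let $m_p:=\frac1p\big(\psi(\frac1p)+\log p\big)$. Then the function $H(x):=\psi(x)-\log(x)$ is an increasing bijection from $(0,\infty)$ onto $(-\infty,0)$, and, setting for $\theta\in(0,1)$ $$G_p(\theta):=H^{-1}\big(p\log(\theta)\big),$$ $$\mathcal J_p(\theta):=[pG_p(\theta)-1]\log(\theta)+G_p(\theta)\big[\log\big(G_p(\theta)\big)-1\big]-\log\Gamma\big(G_p(\theta)\big)+\frac1p+\frac1p\log(p)+\log\Gamma\Big(\frac1p\Big),$$ one has $$\lim_{n\to\infty}\frac1n\log\mathbb P\bigg[\Big(\prod_{i=1}^n|X_i^{(n)}|\Big)^{1/n}\ge\theta\cdot\Big(\frac1n\sum_{i=1}^n|X_i^{(n)}|^p\Big)^{1/p}\bigg]=-\mathcal J_p(\theta),\qquad\theta\in[e^{m_p},1),$$ and $$\lim_{n\to\infty}\frac1n\log\mathbb P\bigg[\Big(\prod_{i=1}^n|X_i^{(n)}|\Big)^{1/n}\le\theta\cdot\Big(\frac1n\sum_{i=1}^n|X_i^{(n)}|^p\Big)^{1/p}\bigg]=-\mathcal J_p(\theta),\qquad\theta\in(0,e^{m_p}].$$ Moreover, $\mathcal J_p$ is non-negative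 on $(0,1)$, $\mathcal J_p(e^{m_p})=0$, and $\lim_{\theta\downarrow0}\mathcal J_p(\theta)=\lim_{\theta\uparrow1}\mathcal J_p(\theta)=+\infty$.
   Context: For $p\in[1,\infty)$ and $x=(x_1,\dots,x_n)\in\mathbb R^n$ let $\|x\|_p=(\sum_{i=1}^n|x_i|^p)^{1/p}$, $\mathbb B_p^n=\{x\in\mathbb R^n:\|x\|_p\le1\}$ and $\mathbb S_p^{n-1}=\{x\in\mathbb R^n:\|x\|_p=1\}$. The uniform distribution on $\mathbb B_p^n$ is normalized Lebesgue measure. The cone probability measure $\mu_p$ on $\mathbb S_p^{n-1}$ is defined for Borel $A\subseteq\mathbb S_p^{n-1}$ by $\mu_p(A)=|\{rx:x\in A,\ r\in[0,1]\}|/|\mathbb B_p^n|$, where $|\cdot|$ is $n$-dimensional Lebesgue measure. The surface probability measure $\sigma_p$ on $\mathbb S_p^{n-1}$ is the $(n-1)$-dimensional Hausdorff measure on $\mathbb S_p^{n-1}$, normalized to be a probability measure. $\Gamma$ is the gamma function and $\psi(x)=\Gamma'(x)/\Gamma(x)$, $x>0$, is the digamma function. *)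

theory Defs
  imports "HOL-Probability.Probability"
begin

text \<open>
  Since the dimension n varies within a single statement, \<open>\<real>\<^sup>n\<close> is represented by the extensional
  functions on \<open>{..<n}\<close>: coordinate \<open>x\<^sub>i\<close> of the mathematics is \<open>x (i - 1)\<close> here.
\<close>

definition leb :: "nat \<Rightarrow> (nat \<Rightarrow> real) measure" where
  "leb n = (\<Pi>\<^sub>M i\<in>{..<n}. lborel)"

definition lp_norm :: "real \<Rightarrow> nat \<Rightarrow> (nat \<Rightarrow> real) \<Rightarrow> real" where
  "lp_norm p n x = (\<Sum>i<n. \<bar>x i\<bar> powr p) powr (1 / p)"

definition lp_ball :: "real \<Rightarrow> nat \<Rightarrow> (nat \<Rightarrow> real) set" where
  "lp_ball p n = {x \<in> space (leb n). lp_norm p n x \<le> 1}"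

definition lp_sphere :: "real \<Rightarrow> nat \<Rightarrow> (nat \<Rightarrow> real) set" where
  "lp_sphere p n = {x \<in> space (leb n). lp_norm p n x = 1}"

definition cone_over :: "nat \<Rightarrow> (nat \<Rightarrow> real) set \<Rightarrow> (nat \<Rightarrow> real) set" where
  "cone_over n A = {(\<lambda>i\<in>{..<n}. r * x i) |r x. x \<in> A \<and> 0 \<le> r \<and> r \<le> 1}"

definition cone_prob :: "real \<Rightarrow> nat \<Rightarrow> (nat \<Rightarrow> real) set \<Rightarrow> ennreal" where
  "cone_prob p n A = emeasure (leb n) (cone_over n A) / emeasure (leb n) (lp_ball p n)"

text \<open>
  The k-dimensional Hausdorff (outer) measure with respect to a distance function d, without the
  normalising constant that makes it agree with Lebesgue measure (it cancels in \<open>surface_prob\<close>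
  below).  The case distinction on the empty set matters only for \<open>k = 0\<close>, where it
  makes the result the counting measure.
\<close>

definition diam_on :: "('a \<Rightarrow> 'a \<Rightarrow> real) \<Rightarrow> 'a set \<Rightarrow> ennreal" where
  "diam_on d U = (SUP x\<in>U. SUP y\<in>U. ennreal (d x y))"

definition hausdorff_content :: "('a \<Rightarrow> 'a \<Rightarrow> real) \<Rightarrow> nat \<Rightarrow> real \<Rightarrow> 'a set \<Rightarrow> ennreal" where
  "hausdorff_content d k \<delta> A =
     (INF U \<in> {U :: nat \<Rightarrow> 'a set. A \<subseteq> (\<Union>i. U i) \<and> (\<forall>i. diam_on d (U i) \<le> ennreal \<delta>)}.
        \<Sum>i. if U i = {} then 0 else diam_on d (U i) ^ k)"

definition hausdorff_measure :: "('a \<Rightarrow> 'a \<Rightarrow> real) \<Rightarrow> nat \<Rightarrow> 'a set \<Rightarrow> ennreal" where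
  "hausdorff_measure d k A = (SUP \<delta>\<in>{0<..}. hausdorff_content d k \<delta> A)"

definition eucl_dist :: "nat \<Rightarrow> (nat \<Rightarrow> real) \<Rightarrow> (nat \<Rightarrow> real) \<Rightarrow> real" where
  "eucl_dist n x y = L2_set (\<lambda>i. x i - y i) {..<n}"

definition surface_prob :: "real \<Rightarrow> nat \<Rightarrow> (nat \<Rightarrow> real) set \<Rightarrow> ennreal" where
  "surface_prob p n A =
     hausdorff_measure (eucl_dist n) (n - 1) A /
     hausdorff_measure (eucl_dist n) (n - 1) (lp_sphere p n)"

definition uniform_on_ball ::
  "'a measure \<Rightarrow> real \<Rightarrow> nat \<Rightarrow> ('a \<Rightarrow> nat \<Rightarrow> real) \<Rightarrow> bool" where
  "uniform_on_ball M p n X \<longleftrightarrow> X \<in> measurable M (leb n) \<and>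
     distr M (leb n) X = uniform_measure (leb n) (lp_ball p n)"

text \<open>
  The laws on the sphere are regarded as laws on \<open>\<real>\<^sup>n\<close> concentrated on the sphere.
\<close>

definition cone_distributed ::
  "'a measure \<Rightarrow> real \<Rightarrow> nat \<Rightarrow> ('a \<Rightarrow> nat \<Rightarrow> real) \<Rightarrow> bool" where
  "cone_distributed M p n X \<longleftrightarrow> X \<in> measurable M (leb n) \<and>
     (\<forall>A\<in>sets (leb n). emeasure (distr M (leb n) X) A = cone_prob p n (A \<inter> lp_sphere p n))"

definition surface_distributed ::
  "'a measure \<Rightarrow> real \<Rightarrow> nat \<Rightarrow> ('a \<Rightarrow> nat \<Rightarrow> real) \<Rightarrow> bool" where
  "surface_distributed M p n X \<longleftrightarrow> X \<in> measurable M (leb n) \<and>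
     (\<forall>A\<in>sets (leb n). emeasure (distr M (leb n) X) A = surface_prob p n (A \<inter> lp_sphere p n))"

definition geom_mean :: "nat \<Rightarrow> (nat \<Rightarrow> real) \<Rightarrow> real" where
  "geom_mean n x = (\<Prod>i<n. \<bar>x i\<bar>) powr (1 / real n)"

definition power_mean :: "real \<Rightarrow> nat \<Rightarrow> (nat \<Rightarrow> real) \<Rightarrow> real" where
  "power_mean p n x = ((\<Sum>i<n. \<bar>x i\<bar> powr p) / real n) powr (1 / p)"

text \<open>
  Logarithm with \<open>log 0 = -\<infinity>\<close> (the library has \<open>ln 0 = 0\<close> on the reals); it is only applied to
  probabilities.
\<close>

definition eln :: "real \<Rightarrow> ereal" where
  "eln x = (if x \<le> 0 then - \<infinity> else ereal (ln x))"

definition H_fun :: "real \<Rightarrow> real" where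
  "H_fun x = Digamma x - ln x"

definition m_exp :: "real \<Rightarrow> real" where
  "m_exp p = (1 / p) * (Digamma (1 / p) + ln p)"

definition G_fun :: "real \<Rightarrow> real \<Rightarrow> real" where
  "G_fun p \<theta> = the_inv_into {0<..} H_fun (p * ln \<theta>)"

definition J_rate :: "real \<Rightarrow> real \<Rightarrow> real" where
  "J_rate p \<theta> = (p * G_fun p \<theta> - 1) * ln \<theta> + G_fun p \<theta> * (ln (G_fun p \<theta>) - 1) - ln (Gamma (G_fun p \<theta>))
           + 1 / p + (1 / p) * ln p + ln (Gamma (1 / p))"

end

theory Submission
  imports Defs "HOL-Real_Asymp.Real_Asymp"
begin

text \<open>
  The quotient \<open>Z\<close> of the two means is invariant under scaling, so it has the same law under the uniform and
  under the cone measure. Integrating \<open>\<bar>x\<^sub>1 \<cdots> x\<^sub>n\<bar>\<^sup>a exp (- \<Sum>\<bar>x\<^sub>i\<bar>\<^sup>p)\<close> once as a product and once radially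
  gives all moments of \<open>Z\<close> explicitly in terms of the gamma function. Hence \<open>log E Z\<^sup>n\<^sup>a / n\<close> converges to a
  function of \<open>g = (a + 1) / p\<close> with derivative \<open>H(g)\<close>, and the Gaertner-Ellis argument (Markov's inequality and
  exponential tilting) yields its Legendre transform as the rate.

  For the surface measure it suffices that its density with respect to the cone measure lies between two
  constants whose quotient is polynomial in \<open>n\<close>. The sphere is cut into small pieces, each nearly flat. The
  gnomonic projection along the normal of a piece is nearly a similarity onto a subset of \<open>\<real>\<^sup>n\<^sup>-\<^sup>1\<close>, where
  Hausdorff measure is a multiple of Lebesgue measure, and the volume of the cone over the piece is read off
  from the same projection.
\<close>

section \<open>The digamma function and the rate function\<close>

text \<open>A factor polynomial in \<open>n\<close> is invisible after taking \<open>ln\<close> and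
  dividing by \<open>n\<close>. This leaves a relative error of order 1 / n per dimension for the
  surface measure, and the constants \<open>1 / (4 * n)\<close>, 64 n^3 and 64 n^5 are budgets for
  it. The obstacle is that the p-norm need not be differentiable where a coordinate vanishes; the
  pieces are therefore cut along the coordinate hyperplanes. Turning the normal of a piece into a
  coordinate axis requires invariance of Lebesgue measure under reflections, and this too comes from
  Hausdorff measure, which isometries preserve by definition.

  On the analytic side everything rests on - 1 / x <= H(x) <= - 1 / (2 x) and on the monotonicity of
  H: the bounds give the range of H and, integrated, Stirling's formula up to a logarithm. The
  condition a > - 1 for the moments means g > 0, so the tilts reach the whole range of H and thereby
  every \<theta> in (0, 1). Since ln \<theta> lies on the boundary of the event, the tilt aims
  slightly beyond it and continuity of the rate closes the gap; this includes \<theta> = exp (m_p),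
  where the optimal exponent is 0.\<close>

lemma ln_Gamma_mean_value:
  fixes x :: real
  assumes "0 < x"
  shows "Digamma x \<le> ln x" "ln x \<le> Digamma x + 1 / x"
proof -
  \<comment> \<open>By the functional equation \<open>ln_Gamma\<close> grows by exactly
    \<open>ln x\<close> over [x, x + 1], so \<open>Digamma\<close> takes the value
    \<open>ln x\<close> inside; monotonicity compares it with the two ends.\<close>
  have "\<exists>z>x. z < x + 1 \<and> ln_Gamma (x + 1) - ln_Gamma x = (x + 1 - x) * Digamma z"
    using assms by (intro MVT2) (auto intro!: derivative_eq_intros)
  then obtain z where z: "x < z" "z < x + 1" "ln_Gamma (x + 1) - ln_Gamma x = Digamma z"
    by auto
  have "ln_Gamma (x + 1) - ln_Gamma x = ln x"
  proof -
    have "Gamma (x + 1) = x * Gamma x"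
      using assms by (intro Gamma_plus1) (auto elim!: nonpos_Ints_cases)
    then show ?thesis using assms Gamma_real_pos[OF assms] by (simp add: ln_Gamma_real_pos ln_mult_pos)
  qed
  then have *: "Digamma z = ln x" using z by simp
  have "Digamma x \<le> Digamma z" "Digamma z \<le> Digamma (x + 1)"
    using assms z by (auto intro: Digamma_real_mono)
  with * assms show "Digamma x \<le> ln x" "ln x \<le> Digamma x + 1 / x"
    using Digamma_plus1[of x] by auto
qed

lemma H_fun_ge: "0 < x \<Longrightarrow> - 1 / x \<le> H_fun x"
  using ln_Gamma_mean_value(2)[of x] by (simp add: H_fun_def)

lemma H_fun_plus1: "0 < x \<Longrightarrow> H_fun (x + 1) = H_fun x + 1 / x - (ln (x + 1) - ln x)"
  by (simp add: H_fun_def Digamma_plus1)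

text \<open>Unit steps are what the functional equation of \<open>Digamma\<close> controls; the
  behaviour at infinity then bounds the value at \<open>x\<close>.\<close>

lemma tendsto_shift_upper_bound:
  fixes K :: "real \<Rightarrow> real"
  assumes step: "\<And>y. x \<le> y \<Longrightarrow> K y \<le> K (y + 1)"
    and lim: "(\<lambda>n. K (x + real n)) \<longlonglongrightarrow> L"
  shows "K x \<le> L"
proof -
  have "incseq (\<lambda>n. K (x + real n))"
    by (intro incseq_SucI) (use step[of "x + real _"] in \<open>simp add: add_ac\<close>)
  from incseq_le[OF this lim, of 0] show ?thesis by simp
qed

lemma tendsto_inverse_shift: "(\<lambda>n. c / (x + real n)) \<longlonglongrightarrow> (0::real)"
proof -
  have "filterlim (\<lambda>n. x + real n) at_top sequentially"
    by (intro filterlim_tendsto_add_at_top[OF tendsto_const] filterlim_real_sequentially)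
  then show ?thesis
    by (intro tendsto_divide_0[OF tendsto_const] filterlim_at_top_imp_at_infinity)
qed

lemma H_fun_tendsto_shift:
  assumes "0 < x" shows "(\<lambda>n. H_fun (x + real n)) \<longlonglongrightarrow> 0"
proof (rule tendsto_sandwich)
  show "\<forall>\<^sub>F n in sequentially. (- 1) / (x + real n) \<le> H_fun (x + real n)"
    using H_fun_ge[of "x + real _"] assms by (auto intro!: always_eventually)
  show "\<forall>\<^sub>F n in sequentially. H_fun (x + real n) \<le> 0"
    using ln_Gamma_mean_value(1)[of "x + real _"] assms
    by (auto intro!: always_eventually simp: H_fun_def)
qed (use tendsto_inverse_shift[of "- 1" x] in auto)

text \<open>The trapezoidal rule for \<open>1/t\<close> on \<open>[y, y + 1]\<close> makes \<open>H(y) + 1/(2y)\<close> increase along unit steps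
  to its limit 0.\<close>
lemma H_fun_le:
  assumes "0 < x" shows "H_fun x \<le> - 1 / (2 * x)"
proof -
  define K where "K = (\<lambda>y. H_fun y + 1 / (2 * y))"
  have "K x \<le> 0"
  proof (rule tendsto_shift_upper_bound[where K = K])
    fix y assume "x \<le> y"
    then have y: "y > 0" using assms by simp
    have "ln (y + 1) - ln y \<le> 1 / (2 * y) + 1 / (2 * (y + 1))"
      using ln_inverse_approx_le[of y 1] y by (simp add: inverse_eq_divide add_divide_distrib mult.commute)
    moreover have "1 / y = 1 / (2 * y) + 1 / (2 * y)" using y by (simp add: field_simps)
    ultimately show "K y \<le> K (y + 1)"
      unfolding K_def H_fun_plus1[OF y] by linarith
  next
    show "(\<lambda>n. K (x + real n)) \<longlonglongrightarrow> 0"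
      unfolding K_def using tendsto_add[OF H_fun_tendsto_shift[OF assms] tendsto_inverse_shift[of "1/2" x]]
      by simp
  qed
  then show ?thesis by (simp add: K_def)
qed

lemma H_fun_neg: "0 < x \<Longrightarrow> H_fun x < 0"
  using H_fun_le[of x] by (auto intro: le_less_trans)

text \<open>The compared quantity is the increment of \<open>H_fun\<close> over a unit step, see
  \<open>H_fun_plus1\<close>; its strict decrease is the source of the strict monotonicity of
  \<open>H_fun\<close>.\<close>

lemma inverse_minus_ln_less:
  assumes "0 < x" "x < y"
  shows "1 / y - (ln (y + 1) - ln y) < 1 / x - (ln (x + 1) - ln (x::real))"
proof (rule DERIV_neg_imp_decreasing[OF assms(2)])
  fix t :: real assume "x \<le> t" "t \<le> y"
  then have t: "t > 0" using assms by simp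
  have "((\<lambda>t. 1 / t - (ln (t + 1) - ln t)) has_real_derivative (- 1 / (t * t) - (1 / (t + 1) - 1 / t))) (at t)"
    using t by (auto intro!: derivative_eq_intros simp: divide_inverse)
  moreover have "- 1 / (t * t) - (1 / (t + 1) - 1 / t) < 0"
    using t by (auto simp: divide_simps)
  ultimately show "\<exists>d. ((\<lambda>t. 1 / t - (ln (t + 1) - ln t)) has_real_derivative d) (at t) \<and> d < 0"
    by blast
qed

text \<open>\<open>H(y + n) - H(x + n)\<close> strictly decreases to 0 in \<open>n\<close>.\<close>
lemma H_fun_less:
  assumes "0 < x" "x < y" shows "H_fun x < H_fun y"
proof -
  define K where "K = (\<lambda>t. H_fun t - H_fun (t + (y - x)))"
  have step: "K t < K (t + 1)" if "x \<le> t" for t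
    using inverse_minus_ln_less[of t "t + (y - x)"] assms that
      H_fun_plus1[of t] H_fun_plus1[of "t + (y - x)"]
    by (simp add: K_def add_ac)
  \<comment> \<open>Starting at \<open>x + 1\<close> rather than at \<open>x\<close> keeps one
    strict step in reserve, so the final inequality is strict.\<close>
  have "K (x + 1) \<le> 0"
  proof (rule tendsto_shift_upper_bound[where K = K])
    show "K t \<le> K (t + 1)" if "x + 1 \<le> t" for t using step[of t] that by simp
    show "(\<lambda>n. K (x + 1 + real n)) \<longlonglongrightarrow> 0"
      using tendsto_diff[OF H_fun_tendsto_shift[of "x + 1"] H_fun_tendsto_shift[of "y + 1"]] assms
      by (simp add: K_def algebra_simps)
  qed
  with step[of x] show ?thesis by (simp add: K_def)
qed

lemma H_fun_le_mono: "0 < x \<Longrightarrow> x \<le> y \<Longrightarrow> H_fun x \<le> H_fun y"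
  using H_fun_less[of x y] by (cases "x = y") auto

lemma strict_mono_on_H_fun: "strict_mono_on {0<..} H_fun"
  by (auto intro!: strict_mono_onI H_fun_less)

lemma isCont_H_fun: "0 < x \<Longrightarrow> isCont H_fun x"
  unfolding H_fun_def[abs_def]
  by (intro continuous_intros) (auto elim!: nonpos_Ints_cases)

lemma bij_betw_H_fun: "bij_betw H_fun {0<..} {..<0}"
proof (rule bij_betw_imageI)
  show "inj_on H_fun {0<..}"
    using strict_mono_on_H_fun by (rule strict_mono_on_imp_inj_on)
  have "y \<in> H_fun ` {0<..}" if "y < 0" for y :: real
  proof -
    \<comment> \<open>The bounds \<open>- 1 / x \<le> H_fun x\<close> and
      \<open>H_fun x \<le> - 1 / (2 * x)\<close> trap a preimage of \<open>y\<close> between these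
      two points.\<close>
    have "H_fun (- 1 / (2 * y)) \<le> y" "y \<le> H_fun (- 1 / y)"
      using that H_fun_le[of "- 1 / (2 * y)"] H_fun_ge[of "- 1 / y"] by (auto simp: divide_simps)
    moreover have "- 1 / (2 * y) \<le> - 1 / y" using that by (simp add: divide_simps)
    moreover have pos: "0 < - 1 / (2 * y)" using that by (simp add: divide_simps)
    moreover have "isCont H_fun x" if "- 1 / (2 * y) \<le> x" for x
      using isCont_H_fun[of x] pos that by linarith
    ultimately obtain x where "- 1 / (2 * y) \<le> x" "H_fun x = y"
      using IVT[of H_fun "- 1 / (2 * y)" y "- 1 / y"] by blast
    with pos have "0 < x" by linarith
    with \<open>H_fun x = y\<close> show ?thesis by auto
  qed
  then show "H_fun ` {0<..} = {..<0}" using H_fun_neg by auto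
qed

text \<open>The error of the approximation \<open>x * ln x - x\<close> to log Gamma, and at the same
  time an antiderivative of \<open>H_fun\<close>.\<close>

definition stirling_error :: "real \<Rightarrow> real" where
  "stirling_error x = ln (Gamma x) - x * ln x + x"

lemma DERIV_stirling_error:
  assumes "0 < x" shows "(stirling_error has_real_derivative H_fun x) (at x)"
proof -
  have "((\<lambda>x. ln_Gamma x - x * ln x + x) has_real_derivative H_fun x) (at x)"
    using assms by (auto intro!: derivative_eq_intros simp: H_fun_def)
  moreover have "\<forall>\<^sub>F y in nhds x. stirling_error y = ln_Gamma y - y * ln y + y"
    using eventually_nhds_in_open[of "{0<..}" x] assms
    by (auto elim!: eventually_mono simp: stirling_error_def ln_Gamma_real_pos)
  ultimately show ?thesis by (subst DERIV_cong_ev[OF refl _ refl]) auto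
qed

text \<open>Integration of the two bounds on \<open>H_fun\<close> from 1 upwards. The logarithmic
  size makes the error vanish after division by the dimension.\<close>

lemma stirling_error_le:
  assumes "1 \<le> x"
  shows "stirling_error x \<le> stirling_error 1 - ln x / 2" "stirling_error 1 - ln x \<le> stirling_error x"
proof -
  have "stirling_error x + ln x / 2 \<le> stirling_error 1 + ln 1 / 2"
  proof (rule DERIV_nonpos_imp_nonincreasing[OF assms])
    fix t :: real assume "1 \<le> t" "t \<le> x"
    then show "\<exists>y. ((\<lambda>a. stirling_error a + ln a / 2) has_real_derivative y) (at t) \<and> y \<le> 0"
      using H_fun_le[of t]
      by (intro exI[of _ "H_fun t + 1 / (2 * t)"])
         (auto intro!: derivative_eq_intros DERIV_stirling_error)
  qed
  then show "stirling_error x \<le> stirling_error 1 - ln x / 2" by simp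
  have "stirling_error 1 + ln 1 \<le> stirling_error x + ln x"
  proof (rule DERIV_nonneg_imp_nondecreasing[OF assms])
    fix t :: real assume "1 \<le> t" "t \<le> x"
    then show "\<exists>y. ((\<lambda>a. stirling_error a + ln a) has_real_derivative y) (at t) \<and> 0 \<le> y"
      using H_fun_ge[of t]
      by (intro exI[of _ "H_fun t + 1 / t"])
         (auto intro!: derivative_eq_intros DERIV_stirling_error)
  qed
  then show "stirling_error 1 - ln x \<le> stirling_error x" by simp
qed

text \<open>The divergent part \<open>x * ln n\<close> is subtracted here; such terms cancel in
  \<open>tendsto_scaled_log_moment\<close>.\<close>

lemma tendsto_ln_Gamma_scaled:
  assumes "0 < x"
  shows "(\<lambda>n. ln (Gamma (real n * x)) / real n - x * ln (real n)) \<longlonglongrightarrow> x * ln x - x"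
proof -
  have lin: "filterlim (\<lambda>n. real n * x) at_top sequentially"
    by (rule filterlim_at_top_mult_tendsto_pos[OF tendsto_const assms filterlim_real_sequentially])
  have "(\<lambda>n. stirling_error (real n * x) / real n) \<longlonglongrightarrow> 0"
  proof (rule tendsto_sandwich)
    have ev: "\<forall>\<^sub>F n in sequentially. 1 \<le> real n * x \<and> 0 < n"
      using filterlim_at_top[THEN iffD1, OF lin, rule_format, of 1] eventually_gt_at_top[of "0::nat"]
      by eventually_elim auto
    show "\<forall>\<^sub>F n in sequentially. (stirling_error 1 - ln (real n * x)) / real n \<le> stirling_error (real n * x) / real n"
      using ev by eventually_elim (use stirling_error_le(2) in \<open>auto intro!: divide_right_mono\<close>)
    show "\<forall>\<^sub>F n in sequentially. stirling_error (real n * x) / real n \<le> stirling_error 1 / real n"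
      using ev
    proof eventually_elim
      case (elim n)
      then have "stirling_error (real n * x) \<le> stirling_error 1"
        using stirling_error_le(1)[of "real n * x"] ln_ge_zero[of "real n * x"] by linarith
      then show ?case by (intro divide_right_mono) auto
    qed
    show "(\<lambda>n. (stirling_error 1 - ln (real n * x)) / real n) \<longlonglongrightarrow> 0"
      using assms by real_asymp
    show "(\<lambda>n. stirling_error 1 / real n) \<longlonglongrightarrow> 0" by real_asymp
  qed
  then have "(\<lambda>n. stirling_error (real n * x) / real n + (x * ln x - x)) \<longlonglongrightarrow> 0 + (x * ln x - x)"
    by (intro tendsto_intros)
  moreover have "\<forall>\<^sub>F n in sequentially. stirling_error (real n * x) / real n + (x * ln x - x)
      = ln (Gamma (real n * x)) / real n - x * ln (real n)"
    using eventually_gt_at_top[of "0::nat"]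
    by eventually_elim (use assms in \<open>auto simp: stirling_error_def ln_mult field_simps\<close>)
  ultimately show ?thesis by (simp cong: filterlim_cong add: tendsto_cong)
qed

text \<open>The limiting log-moment of \<open>Z\<close> in the variable g = (a + 1) / p. The
  subtracted constant belongs to a = 0, so the function vanishes at \<open>1 / p\<close>.\<close>

definition log_moment :: "real \<Rightarrow> real \<Rightarrow> real" where
  "log_moment p g = stirling_error g - stirling_error (1 / p)"

lemma G_fun:
  assumes "1 \<le> p" "0 < \<theta>" "\<theta> < 1"
  shows "0 < G_fun p \<theta>" "H_fun (G_fun p \<theta>) = p * ln \<theta>"
proof -
  have "p * ln \<theta> < 0" using assms by (simp add: mult_pos_neg)
  then have *: "p * ln \<theta> \<in> H_fun ` {0<..}" using bij_betw_H_fun by (auto simp: bij_betw_def)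
  from the_inv_into_into[OF _ this subset_refl] f_the_inv_into_f[OF _ this] bij_betw_H_fun
  show "0 < G_fun p \<theta>" "H_fun (G_fun p \<theta>) = p * ln \<theta>"
    by (auto simp: G_fun_def bij_betw_def)
qed

lemma G_fun_eqI:
  assumes "0 < g" "H_fun g = p * ln \<theta>" shows "G_fun p \<theta> = g"
  using the_inv_into_f_f[of H_fun "{0<..}" g] bij_betw_H_fun assms
  by (auto simp: G_fun_def bij_betw_def)

lemma H_fun_inverse: "1 \<le> p \<Longrightarrow> H_fun (1 / p) = p * m_exp p"
  by (simp add: H_fun_def m_exp_def ln_div)

lemma exp_m_exp: "1 \<le> p \<Longrightarrow> exp (m_exp p) < 1"
  using H_fun_neg[of "1 / p"] H_fun_inverse[of p] by (auto simp: mult_less_0_iff)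

text \<open>With a = p g - 1 this is the Legendre form a ln \<theta> - \<Lambda>(a), evaluated at
  the stationary g.\<close>

lemma J_rate_eq:
  assumes "1 \<le> p"
  shows "J_rate p \<theta> = (p * G_fun p \<theta> - 1) * ln \<theta> - log_moment p (G_fun p \<theta>)"
  using assms by (simp add: J_rate_def log_moment_def stirling_error_def ln_div algebra_simps)

text \<open>\<open>J_rate\<close> is the Legendre transform of \<open>log_moment\<close>: its derivative \<open>H\<close> is increasing, so
  \<open>G_fun p \<theta>\<close> is the maximiser.\<close>
lemma J_rate_ge:
  assumes "1 \<le> p" "0 < \<theta>" "\<theta> < 1" "0 < g"
  shows "(p * g - 1) * ln \<theta> - log_moment p g \<le> J_rate p \<theta>"
proof -
  define \<phi> where "\<phi> = (\<lambda>g. (p * g - 1) * ln \<theta> - log_moment p g)"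
  define G where "G = G_fun p \<theta>"
  have G: "0 < G" "H_fun G = p * ln \<theta>" using G_fun[OF assms(1-3)] by (auto simp: G_def)
  have deriv: "(\<phi> has_real_derivative (H_fun G - H_fun t)) (at t)" if "0 < t" for t
    unfolding \<phi>_def log_moment_def using that G(2)
    by (auto intro!: derivative_eq_intros DERIV_stirling_error)
  have "\<phi> g \<le> \<phi> G"
  proof (cases "g \<le> G")
    case True
    show ?thesis
    proof (rule DERIV_nonneg_imp_nondecreasing[OF True])
      fix t assume "g \<le> t" "t \<le> G"
      then show "\<exists>y. (\<phi> has_real_derivative y) (at t) \<and> 0 \<le> y"
        using deriv[of t] H_fun_le_mono[of t G] assms(4) by (intro exI conjI) auto
    qed
  next
    case False
    then have "G \<le> g" by simp
    then show ?thesis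
    proof (rule DERIV_nonpos_imp_nonincreasing)
      fix t assume "G \<le> t" "t \<le> g"
      then show "\<exists>y. (\<phi> has_real_derivative y) (at t) \<and> y \<le> 0"
        using deriv[of t] H_fun_le_mono[of G t] G by (intro exI conjI) auto
    qed
  qed
  then show ?thesis using assms(1) by (simp add: J_rate_eq \<phi>_def G_def)
qed

text \<open>The choice g = 1 / p means exponent zero: both the linear term and
  \<open>log_moment\<close> vanish there.\<close>

lemma J_rate_nonneg: "1 \<le> p \<Longrightarrow> 0 < \<theta> \<Longrightarrow> \<theta> < 1 \<Longrightarrow> 0 \<le> J_rate p \<theta>"
  using J_rate_ge[of p \<theta> "1 / p"] by (simp add: log_moment_def)

lemma G_fun_exp_m_exp: "1 \<le> p \<Longrightarrow> G_fun p (exp (m_exp p)) = 1 / p"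
  by (rule G_fun_eqI) (auto simp: H_fun_inverse)

lemma J_rate_exp_m_exp: "1 \<le> p \<Longrightarrow> J_rate p (exp (m_exp p)) = 0"
  by (simp add: J_rate_eq G_fun_exp_m_exp log_moment_def)

lemma J_rate_at_0:
  assumes "1 \<le> p" shows "filterlim (J_rate p) at_top (at_right 0)"
proof (rule filterlim_at_top_mono)
  \<comment> \<open>Half the neutral value \<open>1 / p\<close>, so that the coefficient p g - 1 of
    \<open>ln \<theta>\<close> is - 1 / 2 and the lower bound blows up at 0.\<close>
  define c where "c = log_moment p (1 / (2 * p))"
  show "filterlim (\<lambda>\<theta>. - ln \<theta> / 2 - c) at_top (at_right 0)" by real_asymp
  show "\<forall>\<^sub>F \<theta> in at_right 0. - ln \<theta> / 2 - c \<le> J_rate p \<theta>"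
    using eventually_at_right_real[of 0 "1::real"]
  proof (rule eventually_mono)
    fix \<theta> :: real assume "\<theta> \<in> {0<..<1}"
    then show "- ln \<theta> / 2 - c \<le> J_rate p \<theta>"
      using J_rate_ge[of p \<theta> "1 / (2 * p)"] assms by (simp add: c_def)
  qed simp
qed

lemma J_rate_at_1:
  assumes "1 \<le> p" shows "filterlim (J_rate p) at_top (at_left 1)"
  unfolding filterlim_at_top
proof
  fix Z :: real
  \<comment> \<open>Large enough that the bound \<open>stirling_error 1 - ln g' / 2\<close> pushes
    \<open>log_moment\<close> below \<open>- (\<bar>Z\<bar> + 1)\<close>; near \<theta> = 1 the
    linear term costs less than 1.\<close>
  define g' where "g' = exp (2 * \<bar>stirling_error 1 - stirling_error (1 / p)\<bar> + 2 * (\<bar>Z\<bar> + 1))"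
  have g': "1 \<le> g'" by (simp add: g'_def)
  have "log_moment p g' \<le> - (\<bar>Z\<bar> + 1)"
    using stirling_error_le(1)[OF g'] by (simp add: log_moment_def) (simp add: g'_def; argo)
  then have Z: "Z + 1 \<le> - log_moment p g'" by linarith
  have "((\<lambda>\<theta>. (p * g' - 1) * ln \<theta>) \<longlongrightarrow> (p * g' - 1) * ln 1) (at_left 1)"
    by (intro tendsto_intros) auto
  then have "\<forall>\<^sub>F \<theta> in at_left 1. - 1 < (p * g' - 1) * ln \<theta>"
    by (rule order_tendstoD) simp
  moreover have "\<forall>\<^sub>F \<theta> in at_left 1. \<theta> \<in> {0<..<1::real}"
    by (rule eventually_at_left_real) simp
  ultimately show "\<forall>\<^sub>F \<theta> in at_left 1. Z \<le> J_rate p \<theta>"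
  proof eventually_elim
    case (elim \<theta>)
    with J_rate_ge[of p \<theta> g'] assms Z g' show ?case by simp
  qed
qed

section \<open>Exponential tilting\<close>

text \<open>\<open>exp (n * a * Y)\<close> is split by the position of \<open>Y\<close>: in the
  window it is at most its extreme value there, and on either side a shift of the exponent by
  \<open>b\<close> dominates it, as in Chernoff's bound.\<close>

lemma (in prob_space) tilted_lower_bound:
  fixes Y :: "'a \<Rightarrow> real"
  assumes Y[measurable]: "Y \<in> borel_measurable M"
    and "0 < b" 
    and I: "integrable M (\<lambda>x. exp (n * a * Y x))" "integrable M (\<lambda>x. exp (n * (a + b) * Y x))"
      "integrable M (\<lambda>x. exp (n * (a - b) * Y x))"
    and n: "0 \<le> n"
  shows "expectation (\<lambda>x. exp (n * a * Y x)) 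
    - exp (- n * b * (y + \<delta>)) * expectation (\<lambda>x. exp (n * (a + b) * Y x))
    - exp (n * b * (y - \<delta>)) * expectation (\<lambda>x. exp (n * (a - b) * Y x))
    \<le> exp (n * (a * y + \<bar>a\<bar> * \<delta>)) * \<P>(x in M. \<bar>Y x - y\<bar> < \<delta>)"
proof -
  let ?A = "{x \<in> space M. \<bar>Y x - y\<bar> < \<delta>}"
  have pw: "exp (n * a * Y x) \<le> exp (n * (a * y + \<bar>a\<bar> * \<delta>)) * indicator ?A x 
      + exp (- n * b * (y + \<delta>)) * exp (n * (a + b) * Y x) 
      + exp (n * b * (y - \<delta>)) * exp (n * (a - b) * Y x)" (is "?e \<le> ?u + ?v + ?w")
    if "x \<in> space M" for x
  proof -
    have nn: "0 \<le> ?u" "0 \<le> ?v" "0 \<le> ?w" by auto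
    consider "\<bar>Y x - y\<bar> < \<delta>" | "y + \<delta> \<le> Y x" | "Y x \<le> y - \<delta>" by linarith
    then show ?thesis
    proof cases
      case 1
      then have "a * (Y x - y) \<le> \<bar>a\<bar> * \<delta>"
        by (metis abs_ge_self abs_ge_zero abs_mult less_imp_le mult_left_mono order_trans)
      then have "n * a * Y x \<le> n * (a * y + \<bar>a\<bar> * \<delta>)"
        using mult_left_mono[OF _ n, of "a * Y x" "a * y + \<bar>a\<bar> * \<delta>"] by (simp add: algebra_simps)
      then have "?e \<le> ?u" using 1 that by simp
      then show ?thesis using nn by linarith
    next
      case 2
      then have "0 \<le> n * b * (Y x - (y + \<delta>))" using n assms(2) by simp
      then have "?e \<le> ?v" unfolding exp_add[symmetric] by (simp add: algebra_simps)
      then show ?thesis using nn by linarith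
    next
      case 3
      then have "0 \<le> n * b * (y - \<delta> - Y x)" using n assms(2) by simp
      then have "?e \<le> ?w" unfolding exp_add[symmetric] by (simp add: algebra_simps)
      then show ?thesis using nn by linarith
    qed
  qed
  have ind: "integrable M (indicator ?A :: 'a \<Rightarrow> real)"
    by (intro integrable_real_indicator) (auto simp: emeasure_eq_measure)
  have "expectation (\<lambda>x. exp (n * a * Y x)) \<le> expectation (\<lambda>x. exp (n * (a * y + \<bar>a\<bar> * \<delta>)) * indicator ?A x 
      + exp (- n * b * (y + \<delta>)) * exp (n * (a + b) * Y x) 
      + exp (n * b * (y - \<delta>)) * exp (n * (a - b) * Y x))"
    by (intro integral_mono I pw Bochner_Integration.integrable_add integrable_mult_right ind)
  also have "\<dots> = exp (n * (a * y + \<bar>a\<bar> * \<delta>)) * \<P>(x in M. \<bar>Y x - y\<bar> < \<delta>)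
      + exp (- n * b * (y + \<delta>)) * expectation (\<lambda>x. exp (n * (a + b) * Y x))
      + exp (n * b * (y - \<delta>)) * expectation (\<lambda>x. exp (n * (a - b) * Y x))"
    using I ind by simp
  finally show ?thesis by simp
qed

text \<open>Exponential tilting: under the density \<open>exp (n a Y) / E exp (n a Y)\<close> the variable \<open>Y\<close> concentrates at
  \<open>\<Lambda>'(a)\<close>.\<close>
lemma gaertner_ellis_lower_bound:
  fixes M :: "nat \<Rightarrow> 'a measure" and Y :: "nat \<Rightarrow> 'a \<Rightarrow> real" and \<Lambda> :: "real \<Rightarrow> real"
  assumes M: "\<And>n. 1 \<le> n \<Longrightarrow> prob_space (M n)"
    and Y: "\<And>n. 1 \<le> n \<Longrightarrow> Y n \<in> borel_measurable (M n)"
    and I: "open I" "a \<in> I"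
    and mom: "\<And>n s. 1 \<le> n \<Longrightarrow> s \<in> I \<Longrightarrow>
        has_bochner_integral (M n) (\<lambda>x. exp (real n * s * Y n x)) (exp (real n * \<Lambda>n n s))"
    and lim: "\<And>s. s \<in> I \<Longrightarrow> (\<lambda>n. \<Lambda>n n s) \<longlonglongrightarrow> \<Lambda> s"
    and deriv: "(\<Lambda> has_real_derivative y) (at a)"
    and \<delta>: "0 < \<delta>" and \<epsilon>: "0 < \<epsilon>"
  shows "\<forall>\<^sub>F n in sequentially.
    exp (real n * (\<Lambda> a - a * y - \<bar>a\<bar> * \<delta> - \<epsilon>)) \<le> \<P>(x in M n. \<bar>Y n x - y\<bar> < \<delta>)"
proof -
  \<comment> \<open>A tail bound with shift \<open>b\<close> gains \<open>b * \<delta>\<close> in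
    the exponent; by differentiability the first-order remainder costs less than half of that once
    \<open>b\<close> is small.\<close>
  have small: "\<forall>\<^sub>F b in at_right 0. a + b \<in> I \<and> a - b \<in> I \<and>
      \<Lambda> (a + b) - \<Lambda> a - b * y < b * \<delta> / 2 \<and> \<Lambda> (a - b) - \<Lambda> a + b * y < b * \<delta> / 2"
  proof (intro eventually_conj)
    have *: "((\<lambda>h. (\<Lambda> (a + h) - \<Lambda> a) / h) \<longlongrightarrow> y) (at 0)"
      using deriv by (simp add: DERIV_def)
    have t1: "((\<lambda>h. (\<Lambda> (a + h) - \<Lambda> a) / h) \<longlongrightarrow> y) (at_right 0)"
      using * by (rule filterlim_mono) (auto simp: at_within_le_at)
    have t2: "((\<lambda>h. (\<Lambda> (a + h) - \<Lambda> a) / h) \<longlongrightarrow> y) (at_left 0)"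
      using * by (rule filterlim_mono) (auto simp: at_within_le_at)
    have "((\<lambda>h. (\<Lambda> (a - h) - \<Lambda> a) / (- h)) \<longlongrightarrow> y) (at_right 0)"
      using t2 by (simp add: filterlim_at_left_to_right)
    then have t3: "((\<lambda>h. (\<Lambda> a - \<Lambda> (a - h)) / h) \<longlongrightarrow> y) (at_right 0)"
      by (simp add: minus_divide_left)
    have pos: "\<forall>\<^sub>F h in at_right 0. 0 < (h::real)" by (simp add: eventually_at_right_less)
    have "\<forall>\<^sub>F h in at_right 0. (\<Lambda> (a + h) - \<Lambda> a) / h < y + \<delta> / 2"
      using order_tendstoD(2)[OF t1] \<delta> by simp
    with pos show "\<forall>\<^sub>F h in at_right 0. \<Lambda> (a + h) - \<Lambda> a - h * y < h * \<delta> / 2"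
      by eventually_elim (simp add: field_simps)
    have "\<forall>\<^sub>F h in at_right 0. y - \<delta> / 2 < (\<Lambda> a - \<Lambda> (a - h)) / h"
      using order_tendstoD(1)[OF t3] \<delta> by simp
    with pos show "\<forall>\<^sub>F h in at_right 0. \<Lambda> (a - h) - \<Lambda> a + h * y < h * \<delta> / 2"
      by eventually_elim (simp add: field_simps)
    have "\<forall>\<^sub>F x in nhds a. x \<in> I" using I by (rule eventually_nhds_in_open)
    moreover have "((\<lambda>h. a + h) \<longlongrightarrow> a + 0) (at_right 0)" "((\<lambda>h. a - h) \<longlongrightarrow> a - 0) (at_right 0)"
      by (intro tendsto_intros)+
    ultimately show "\<forall>\<^sub>F h in at_right 0. a + h \<in> I" "\<forall>\<^sub>F h in at_right 0. a - h \<in> I"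
      by (auto simp: filterlim_iff)
  qed
  moreover have "\<forall>\<^sub>F b in at_right 0. 0 < (b::real)" by (simp add: eventually_at_right_less)
  ultimately have "\<forall>\<^sub>F b in at_right 0. 0 < b \<and> a + b \<in> I \<and> a - b \<in> I \<and>
      \<Lambda> (a + b) - \<Lambda> a - b * y < b * \<delta> / 2 \<and> \<Lambda> (a - b) - \<Lambda> a + b * y < b * \<delta> / 2"
    by eventually_elim auto
  then obtain b where b: "0 < b" "a + b \<in> I" "a - b \<in> I"
      "\<Lambda> (a + b) - \<Lambda> a - b * y < b * \<delta> / 2" "\<Lambda> (a - b) - \<Lambda> a + b * y < b * \<delta> / 2"
    using eventually_happens'[OF trivial_limit_at_right_real] by blast
  \<comment> \<open>The net decay rate of both tails: the gain \<open>b * \<delta>\<close> minus the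
    cost \<open>b * \<delta> / 2\<close>.\<close>
  define c where "c = b * \<delta> / 2"
  have c: "0 < c" using b \<delta> by (simp add: c_def)
  have "(\<lambda>n. \<Lambda>n n (a + b) - \<Lambda>n n a - b * y) \<longlonglongrightarrow> \<Lambda> (a + b) - \<Lambda> a - b * y"
    "(\<lambda>n. \<Lambda>n n (a - b) - \<Lambda>n n a + b * y) \<longlonglongrightarrow> \<Lambda> (a - b) - \<Lambda> a + b * y"
    "(\<lambda>n. \<Lambda>n n a) \<longlonglongrightarrow> \<Lambda> a"
    using b I by (intro tendsto_intros lim; simp)+
  note lims = this
  have ev: "\<forall>\<^sub>F n in sequentially. \<Lambda>n n (a + b) - \<Lambda>n n a - b * y < c"
    "\<forall>\<^sub>F n in sequentially. \<Lambda>n n (a - b) - \<Lambda>n n a + b * y < c"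
    "\<forall>\<^sub>F n in sequentially. \<Lambda> a - \<epsilon> / 2 < \<Lambda>n n a"
    using order_tendstoD(2)[OF lims(1) b(4)] order_tendstoD(2)[OF lims(2) b(5)]
      order_tendstoD(1)[OF lims(3), of "\<Lambda> a - \<epsilon> / 2"] \<epsilon>
    by (simp_all only: c_def)
  have "(\<lambda>n. exp (- c * real n)) \<longlonglongrightarrow> 0"
  proof -
    have "(\<lambda>n. exp (- c) ^ n) \<longlonglongrightarrow> 0" using c by (intro LIMSEQ_power_zero) auto
    then show ?thesis by (simp add: mult.commute flip: exp_of_nat_mult)
  qed
  \<comment> \<open>Two tails of at most a quarter each leave half of the tilted mass for the
    window.\<close>
  then have ev2: "\<forall>\<^sub>F n in sequentially. exp (- c * real n) < 1 / 4" by (rule order_tendstoD) simp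
  have "filterlim (\<lambda>n. \<epsilon> / 2 * real n) at_top sequentially"
    by (rule filterlim_tendsto_pos_mult_at_top[OF tendsto_const _ filterlim_real_sequentially]) (use \<epsilon> in simp)
  \<comment> \<open>One half of \<open>\<epsilon>\<close> pays for the lost factor 1 / 2, the other
    for the convergence of \<open>\<Lambda>n n a\<close>.\<close>
  then have ev3: "\<forall>\<^sub>F n in sequentially. ln 2 \<le> \<epsilon> / 2 * real n"
    by (simp add: filterlim_at_top)
  show ?thesis
    using ev ev2 ev3 eventually_ge_at_top[of 1]
  proof eventually_elim
    case (elim n)
    interpret prob_space "M n" by (rule M) fact
    let ?L = "exp (real n * \<Lambda>n n a)"
    have E: "expectation (\<lambda>x. exp (real n * s * Y n x)) = exp (real n * \<Lambda>n n s)"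
      "integrable (M n) (\<lambda>x. exp (real n * s * Y n x))" if "s \<in> I" for s
      using mom[OF elim(6) that] by (auto simp: has_bochner_integral_iff)
    have q: "exp (- c * real n) * ?L \<le> 1 / 4 * ?L" using elim(4) by (intro mult_right_mono) auto
    have "exp (- real n * b * (y + \<delta>)) * exp (real n * \<Lambda>n n (a + b)) \<le> exp (- c * real n) * ?L"
    proof -
      have "real n * (\<Lambda>n n (a + b) - \<Lambda>n n a - b * y) \<le> real n * c"
        using elim(1) by (intro mult_left_mono) auto
      then show ?thesis unfolding exp_add[symmetric] by (simp add: algebra_simps c_def)
    qed
    moreover have "exp (real n * b * (y - \<delta>)) * exp (real n * \<Lambda>n n (a - b)) \<le> exp (- c * real n) * ?L"
    proof -
      have "real n * (\<Lambda>n n (a - b) - \<Lambda>n n a + b * y) \<le> real n * c"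
        using elim(2) by (intro mult_left_mono) auto
      then show ?thesis unfolding exp_add[symmetric] by (simp add: algebra_simps c_def)
    qed
    moreover have "?L - exp (- real n * b * (y + \<delta>)) * exp (real n * \<Lambda>n n (a + b))
        - exp (real n * b * (y - \<delta>)) * exp (real n * \<Lambda>n n (a - b))
        \<le> exp (real n * (a * y + \<bar>a\<bar> * \<delta>)) * \<P>(x in M n. \<bar>Y n x - y\<bar> < \<delta>)"
      using tilted_lower_bound[OF Y b(1), where a = a and n = "real n" and y = y and \<delta> = \<delta>] b I elim(6)
      by (simp add: E)
    ultimately have "?L / 2 \<le> exp (real n * (a * y + \<bar>a\<bar> * \<delta>)) * \<P>(x in M n. \<bar>Y n x - y\<bar> < \<delta>)"
      using q by linarith
    then have "?L / 2 * exp (- (real n * (a * y + \<bar>a\<bar> * \<delta>)))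
        \<le> exp (real n * (a * y + \<bar>a\<bar> * \<delta>)) * \<P>(x in M n. \<bar>Y n x - y\<bar> < \<delta>) * exp (- (real n * (a * y + \<bar>a\<bar> * \<delta>)))"
      by (intro mult_right_mono) auto
    also have "\<dots> = \<P>(x in M n. \<bar>Y n x - y\<bar> < \<delta>)"
      by (simp add: exp_minus)
    finally have *: "?L / 2 * exp (- (real n * (a * y + \<bar>a\<bar> * \<delta>))) \<le> \<P>(x in M n. \<bar>Y n x - y\<bar> < \<delta>)" .
    have "real n * (\<Lambda> a - \<epsilon> / 2) \<le> real n * \<Lambda>n n a"
      using elim(3) by (intro mult_left_mono) auto
    then have "exp (real n * (\<Lambda> a - a * y - \<bar>a\<bar> * \<delta> - \<epsilon>))
        \<le> exp (real n * \<Lambda>n n a - ln 2 - real n * (a * y + \<bar>a\<bar> * \<delta>))"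
      using elim(5) by (simp add: algebra_simps)
    also have "\<dots> = ?L / 2 * exp (- (real n * (a * y + \<bar>a\<bar> * \<delta>)))"
      by (simp add: exp_diff) (simp add: exp_minus divide_inverse)
    finally show ?case using * by simp
  qed
qed

section \<open>Radial integration with respect to Lebesgue measure\<close>

interpretation lborel_prod: product_sigma_finite "\<lambda>_::nat. lborel :: real measure"
  by standard

interpretation leb_sigma_finite: sigma_finite_measure "leb n" for n
  unfolding leb_def by (rule lborel_prod.sigma_finite) simp

lemma space_leb: "space (leb n) = {..<n} \<rightarrow>\<^sub>E UNIV"
  by (simp add: leb_def space_PiM)

lemma measurable_leb_component [measurable]: "i < n \<Longrightarrow> (\<lambda>x. x i) \<in> borel_measurable (leb n)"
  unfolding leb_def by (metis lessThan_iff measurable_component_singleton measurable_lborel1)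

lemma measurable_leb_sum [measurable]:
  "(\<And>i. i < n \<Longrightarrow> f i \<in> borel_measurable M) \<Longrightarrow> (\<lambda>x. \<Sum>i<n. f i x :: real) \<in> borel_measurable M"
  by (intro borel_measurable_sum) auto

lemma measurable_leb_prod [measurable]:
  "(\<And>i. i < n \<Longrightarrow> f i \<in> borel_measurable M) \<Longrightarrow> (\<lambda>x. \<Prod>i<n. f i x :: real) \<in> borel_measurable M"
  by (intro borel_measurable_prod) auto

lemma measurable_leb_I:
  assumes "\<And>i. i < n \<Longrightarrow> (\<lambda>x. f x i) \<in> borel_measurable M"
  shows "(\<lambda>x. \<lambda>i\<in>{..<n}. f x i) \<in> measurable M (leb n)"
  unfolding leb_def using assms by (intro measurable_restrict) (auto simp: measurable_lborel1)

lemma leb_Suc: "leb (Suc n) = Pi\<^sub>M (insert n {..<n}) (\<lambda>_. lborel)"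
  by (simp add: leb_def lessThan_Suc)

definition dilate :: "nat \<Rightarrow> real \<Rightarrow> (nat \<Rightarrow> real) \<Rightarrow> nat \<Rightarrow> real" where
  "dilate n t x = (\<lambda>i\<in>{..<n}. t * x i)"

lemma measurable_dilate [measurable]: "dilate n t \<in> measurable (leb n) (leb n)"
  unfolding dilate_def[abs_def] by (intro measurable_leb_I) auto

lemma nn_integral_leb_Suc:
  assumes "f \<in> borel_measurable (leb (Suc n))"
  shows "(\<integral>\<^sup>+x. f x \<partial>leb (Suc n)) = (\<integral>\<^sup>+y. (\<integral>\<^sup>+x. f (x(n := y)) \<partial>leb n) \<partial>lborel)"
  using lborel_prod.product_nn_integral_insert_rev[of "{..<n}" n f] assms
  by (simp add: leb_Suc) (simp add: leb_def)

lemma measurable_leb_Suc_upd: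
  "(\<lambda>(y, x). x(n := y)) \<in> measurable (lborel \<Otimes>\<^sub>M leb n) (leb (Suc n))"
proof -
  have "(\<lambda>(x, y). x(n := y)) \<in> measurable (leb n \<Otimes>\<^sub>M lborel) (leb (Suc n))"
    unfolding leb_Suc by (simp add: leb_def measurable_add_dim)
  from measurable_compose[OF measurable_pair_swap' this] show ?thesis by (simp add: case_prod_beta')
qed

text \<open>Induction on the dimension: Fubini splits off the last coordinate, to which the
  one-dimensional affine substitution applies.\<close>

lemma nn_integral_leb_dilate:
  assumes "0 < t" "f \<in> borel_measurable (leb n)"
  shows "(\<integral>\<^sup>+x. f x \<partial>leb n) = ennreal (t ^ n) * (\<integral>\<^sup>+x. f (dilate n t x) \<partial>leb n)"
  using assms(2)
proof (induction n arbitrary: f)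
  case 0
  have "dilate 0 t x = x" if "x \<in> space (leb 0)" for x
    using that by (auto simp: space_leb dilate_def)
  then show ?case by (simp cong: nn_integral_cong)
next
  case (Suc n)
  note Suc.prems[measurable]
  have upd[measurable]: "(\<lambda>x. x(n := y)) \<in> measurable (leb n) (leb (Suc n))" for y
    using measurable_compose[OF measurable_Pair1'[of y lborel "leb n"] measurable_leb_Suc_upd] by simp
  define g where "g = (\<lambda>y. \<integral>\<^sup>+x. f ((dilate n t x)(n := y)) \<partial>leb n)"
  have g[measurable]: "g \<in> borel_measurable lborel"
    unfolding g_def
  proof (rule leb_sigma_finite.borel_measurable_nn_integral)
    have "(\<lambda>(y, x). (y, dilate n t x)) \<in> measurable (lborel \<Otimes>\<^sub>M leb n) (lborel \<Otimes>\<^sub>M leb n)"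
      by measurable
    from measurable_compose[OF measurable_compose[OF this measurable_leb_Suc_upd] Suc.prems]
    show "(\<lambda>(y, x). f ((dilate n t x)(n := y))) \<in> borel_measurable (lborel \<Otimes>\<^sub>M leb n)"
      by (simp only: case_prod_beta' fst_conv snd_conv)
  qed
  have upd_eq: "(dilate n t x)(n := t * y) = dilate (Suc n) t (x(n := y))" for x y
    by (auto simp: dilate_def fun_eq_iff)
  have "(\<integral>\<^sup>+x. f x \<partial>leb (Suc n)) = (\<integral>\<^sup>+y. ennreal (t ^ n) * g y \<partial>lborel)"
    unfolding g_def
    by (subst nn_integral_leb_Suc, fact, intro nn_integral_cong)
       (rule Suc.IH[OF measurable_compose[OF upd Suc.prems]])
  also have "\<dots> = ennreal (t ^ n) * (\<integral>\<^sup>+y. g y \<partial>lborel)"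
    by (intro nn_integral_cmult g)
  also have "(\<integral>\<^sup>+y. g y \<partial>lborel) = ennreal t * (\<integral>\<^sup>+y. g (t * y) \<partial>lborel)"
    using nn_integral_real_affine[of g t 0] assms(1) g by simp
  also have "(\<integral>\<^sup>+y. g (t * y) \<partial>lborel) = (\<integral>\<^sup>+x. f (dilate (Suc n) t x) \<partial>leb (Suc n))"
    by (subst nn_integral_leb_Suc) (auto simp: g_def upd_eq)
  finally show ?case
    using assms(1) by (simp add: ennreal_mult' mult_ac)
qed

lemma emeasure_leb_coordinate_null:
  assumes "i < n" shows "{x \<in> space (leb n). x i = 0} \<in> null_sets (leb n)"
proof -
  have eq: "{x \<in> space (leb n). x i = 0} = Pi\<^sub>E {..<n} (\<lambda>j. if j = i then {0} else UNIV)"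
    using assms by (auto simp: space_leb PiE_def Pi_def)
  have "emeasure (leb n) (Pi\<^sub>E {..<n} (\<lambda>j. if j = i then {0} else UNIV)) = 0"
    unfolding leb_def using assms by (subst lborel_prod.emeasure_PiM) (auto intro!: prod_zero)
  moreover have "{x \<in> space (leb n). x i = 0} \<in> sets (leb n)" using assms by measurable
  ultimately show ?thesis by (auto simp: null_sets_def eq)
qed

text \<open>Off this null set the logarithms, powers and quotients below have their usual meaning,
  so the default values at 0 do no harm.\<close>

lemma AE_leb_coordinates_nonzero: "AE x in leb n. \<forall>i<n. x i \<noteq> 0"
proof -
  have "AE x in leb n. x i \<noteq> 0" if "i < n" for i
    using emeasure_leb_coordinate_null[OF that] by (rule AE_I') auto
  then have "AE x in leb n. \<forall>i\<in>{..<n}. x i \<noteq> 0" by (intro AE_finite_allI) auto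
  then show ?thesis by (simp only: lessThan_iff Ball_def)
qed

definition powr_sum :: "real \<Rightarrow> nat \<Rightarrow> (nat \<Rightarrow> real) \<Rightarrow> real" where
  "powr_sum p n x = (\<Sum>i<n. \<bar>x i\<bar> powr p)"

lemma measurable_powr_sum [measurable]: "powr_sum p n \<in> borel_measurable (leb n)"
  unfolding powr_sum_def[abs_def] by measurable

lemma powr_sum_nonneg: "0 \<le> powr_sum p n x"
  by (simp add: powr_sum_def sum_nonneg)

lemma powr_sum_pos: "i < n \<Longrightarrow> x i \<noteq> 0 \<Longrightarrow> 0 < powr_sum p n x"
  unfolding powr_sum_def by (intro sum_pos2[of _ i]) auto

lemma powr_sum_dilate: "0 < t \<Longrightarrow> powr_sum p n (dilate n t x) = t powr p * powr_sum p n x"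
  by (simp add: powr_sum_def dilate_def sum_distrib_left abs_mult powr_mult)

lemma lp_norm_eq: "lp_norm p n x = powr_sum p n x powr (1 / p)"
  by (simp add: lp_norm_def powr_sum_def)

lemma lp_norm_le_1_iff: "0 < p \<Longrightarrow> lp_norm p n x \<le> 1 \<longleftrightarrow> powr_sum p n x \<le> 1"
  using powr_sum_nonneg[of p n x] powr_le1[of "1 / p" "powr_sum p n x"]
    gr_one_powr[of "powr_sum p n x" "1 / p"]
  by (cases "powr_sum p n x \<le> 1") (auto simp: lp_norm_eq not_le)

lemma lp_ball_eq: "0 < p \<Longrightarrow> lp_ball p n = {x \<in> space (leb n). powr_sum p n x \<le> 1}"
  by (simp add: lp_ball_def lp_norm_le_1_iff)

lemma sets_lp_ball [measurable]: "lp_ball p n \<in> sets (leb n)"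
  unfolding lp_ball_def lp_norm_eq by measurable

lemma nn_integral_powr_Iic:
  assumes "0 < c" "0 \<le> t"
  shows "(\<integral>\<^sup>+u. ennreal (indicator {0<..} u * (c * u powr (c - 1))) * indicator {..t} u \<partial>lborel) = ennreal (t powr c)"
proof -
  have "((\<lambda>u. c * u powr (c - 1)) has_integral (c * (t powr (c - 1 + 1) / (c - 1 + 1)))) {0..t}"
    using assms by (intro has_integral_mult_right has_integral_powr_from_0) auto
  from nn_integral_has_integral_lebesgue[OF _ this]
  have "(\<integral>\<^sup>+u. ennreal (indicator {0..t} u * (c * u powr (c - 1))) \<partial>lborel) = ennreal (t powr c)"
    using assms by simp
  then show ?thesis
    by (subst (asm) nn_integral_cong[of _ _ "\<lambda>u. ennreal (indicator {0<..} u * (c * u powr (c - 1))) * indicator {..t} u"])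
       (auto split: split_indicator)
qed

text \<open>Consider the image under \<open>powr_sum\<close> of Lebesgue measure weighted by
  \<open>F\<close>. By scaling, the half-line up to \<open>t\<close> has mass
  \<open>m * t powr (n / p)\<close>; half-lines determine a measure, so the image has the density on
  the right.\<close>

lemma nn_integral_leb_radial:
  fixes F :: "(nat \<Rightarrow> real) \<Rightarrow> ennreal" and k :: "real \<Rightarrow> ennreal"
  assumes p: "0 < p" and n: "0 < n"
    and F[measurable]: "F \<in> borel_measurable (leb n)"
    and hom: "\<And>t x. 0 < t \<Longrightarrow> x \<in> space (leb n) \<Longrightarrow> F (dilate n t x) = F x"
    and fin: "(\<integral>\<^sup>+x. F x * indicator (lp_ball p n) x \<partial>leb n) < \<infinity>"
    and k[measurable]: "k \<in> borel_measurable borel"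
  shows "(\<integral>\<^sup>+x. F x * k (powr_sum p n x) \<partial>leb n) =
    (\<integral>\<^sup>+x. F x * indicator (lp_ball p n) x \<partial>leb n) *
    (\<integral>\<^sup>+t. ennreal (indicator {0<..} t * (n / p * t powr (n / p - 1))) * k t \<partial>lborel)"
proof -
  define m where "m = (\<integral>\<^sup>+x. F x * indicator (lp_ball p n) x \<partial>leb n)"
  define \<rho> where "\<rho> = (\<lambda>t. ennreal (indicator {0<..} t * (n / p * t powr (n / p - 1))))"
  have [measurable]: "\<rho> \<in> borel_measurable borel" unfolding \<rho>_def by measurable
  define D where "D = distr (density (leb n) F) borel (powr_sum p n)"
  define N where "N = density lborel (\<lambda>t. m * \<rho> t)"
  have D: "emeasure D {..t} = (\<integral>\<^sup>+x. F x * indicator {x \<in> space (leb n). powr_sum p n x \<le> t} x \<partial>leb n)" for t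
  proof -
    have "emeasure D {..t} = emeasure (density (leb n) F) {x \<in> space (leb n). powr_sum p n x \<le> t}"
      unfolding D_def by (subst emeasure_distr) (auto intro!: arg_cong2[where f = emeasure])
    also have "\<dots> = (\<integral>\<^sup>+x. F x * indicator {x \<in> space (leb n). powr_sum p n x \<le> t} x \<partial>leb n)"
      by (subst emeasure_density) auto
    finally show ?thesis .
  qed
  have Dpos: "emeasure D {..t} = ennreal (t powr (n / p)) * m" if t: "0 < t" for t
  proof -
    \<comment> \<open>Dilation by \<open>r\<close> carries the unit ball onto the sublevel set of
      \<open>powr_sum\<close> at height \<open>t\<close>.\<close>
    define r where "r = t powr (1 / p)"
    have r: "0 < r" "r powr p = t" "r ^ n = t powr (n / p)"
      using t p by (auto simp: r_def powr_powr powr_realpow[symmetric])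
    have ind: "indicator {x \<in> space (leb n). powr_sum p n x \<le> t} (dilate n r x) = (indicator (lp_ball p n) x :: ennreal)"
      if "x \<in> space (leb n)" for x
      using that t r p measurable_space[OF measurable_dilate that]
      by (auto simp: lp_ball_eq powr_sum_dilate split: split_indicator)
    have "emeasure D {..t} = ennreal (r ^ n) * (\<integral>\<^sup>+x. F (dilate n r x) * indicator {x \<in> space (leb n). powr_sum p n x \<le> t} (dilate n r x) \<partial>leb n)"
      unfolding D by (rule nn_integral_leb_dilate[OF r(1)]) measurable
    also have "(\<integral>\<^sup>+x. F (dilate n r x) * indicator {x \<in> space (leb n). powr_sum p n x \<le> t} (dilate n r x) \<partial>leb n) = m"
      unfolding m_def by (intro nn_integral_cong) (simp add: ind hom r)
    finally show ?thesis by (simp add: r)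
  qed
  have Nt: "emeasure N {..t} = m * (\<integral>\<^sup>+u. \<rho> u * indicator {..t} u \<partial>lborel)" for t
    unfolding N_def by (subst emeasure_density) (auto simp: nn_integral_cmult mult.assoc)
  have "D = N"
  proof (rule measure_eqI_generator_eq)
    show "Int_stable (range (\<lambda>t::real. {..t}))"
      by (auto simp: Int_stable_def)
    show "emeasure D X = emeasure N X" if X: "X \<in> range (\<lambda>t::real. {..t})" for X
    proof -
      obtain t where t: "X = {..t}" using X by auto
      show ?thesis
      proof (cases "0 < t")
        case True
        then show ?thesis
          using nn_integral_powr_Iic[of "n / p" t] p n unfolding t Dpos[OF True] Nt \<rho>_def by (simp add: mult.commute)
      next
        case False
        \<comment> \<open>For \<open>t \<le> 0\<close> both sides vanish: there is at least one
          coordinate, so \<open>powr_sum\<close> is positive almost everywhere, and the density is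
          cut off at 0.\<close>
        have "AE x in leb n. 0 < powr_sum p n x"
          using AE_leb_coordinates_nonzero[of n] by eventually_elim (use n powr_sum_pos in blast)
        then have "emeasure D {..t} = 0"
          unfolding D using False by (subst nn_integral_0_iff_AE) (auto elim!: eventually_mono)
        moreover have "(\<integral>\<^sup>+u. \<rho> u * indicator {..t} u \<partial>lborel) = 0"
          using False unfolding \<rho>_def by (intro nn_integral_zero') (auto split: split_indicator)
        ultimately show ?thesis by (simp add: t Nt)
      qed
    qed
    show "sets D = sigma_sets UNIV (range (\<lambda>t::real. {..t}))" "sets N = sigma_sets UNIV (range (\<lambda>t::real. {..t}))"
      by (simp_all add: D_def N_def borel_eq_atMost sets_measure_of_conv)
    show "range (\<lambda>i. {..real (Suc i)}) \<subseteq> range (\<lambda>t::real. {..t})" by auto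
    show "(\<Union>i. {..real (Suc i)}) = UNIV"
    proof -
      have "\<exists>i. x \<le> real (Suc i)" for x :: real
      proof -
        obtain i where "x \<le> real i" using real_arch_simple by blast
        then show ?thesis by (intro exI[of _ i]) simp
      qed
      then show ?thesis by auto
    qed
    show "emeasure D {..real (Suc i)} \<noteq> \<infinity>" for i
      using fin unfolding Dpos[of "real (Suc i)", simplified] m_def[symmetric]
      by (simp add: Dpos ennreal_mult_eq_top_iff)
  qed simp
  have "(\<integral>\<^sup>+x. F x * k (powr_sum p n x) \<partial>leb n) = (\<integral>\<^sup>+t. k t \<partial>D)"
    unfolding D_def by (simp add: nn_integral_distr nn_integral_density)
  also have "\<dots> = (\<integral>\<^sup>+t. m * (\<rho> t * k t) \<partial>lborel)"
    unfolding \<open>D = N\<close> N_def by (subst nn_integral_density) (auto simp: mult.assoc)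
  also have "\<dots> = m * (\<integral>\<^sup>+t. \<rho> t * k t \<partial>lborel)"
    by (rule nn_integral_cmult) simp
  finally show ?thesis by (simp add: m_def \<rho>_def)
qed

text \<open>The radial formula in dimension one reduces this to the Gamma integral; the unit ball is
  [-1, 1], whose length is the factor 2.\<close>

lemma nn_integral_abs_powr_exp:
  assumes p: "0 < p" and a: "- 1 < a"
  shows "(\<integral>\<^sup>+x. ennreal (\<bar>x\<bar> powr a * exp (- (\<bar>x\<bar> powr p))) \<partial>lborel) = ennreal (2 / p * Gamma ((a + 1) / p))"
proof -
  define k where "k = (\<lambda>t::real. ennreal (t powr (a / p) * exp (- t)))"
  have [measurable]: "k \<in> borel_measurable borel" unfolding k_def by measurable
  have leb1: "leb 1 = Pi\<^sub>M {0} (\<lambda>_. lborel)" by (simp add: leb_def lessThan_Suc)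
  have leb1_int: "(\<integral>\<^sup>+x. f (x 0) \<partial>leb 1) = (\<integral>\<^sup>+x. f x \<partial>lborel)" if "f \<in> borel_measurable borel" for f
    unfolding leb1 using lborel_prod.product_nn_integral_singleton[of f 0] that by simp
  have ball: "(\<integral>\<^sup>+x. 1 * indicator (lp_ball p 1) x \<partial>leb 1) = 2"
  proof -
    have "(\<integral>\<^sup>+x. 1 * indicator (lp_ball p 1) x \<partial>leb 1) = (\<integral>\<^sup>+x. indicator {-1..1} (x 0) \<partial>leb 1)"
    proof (intro nn_integral_cong)
      fix x assume "x \<in> space (leb 1)"
      moreover have "\<bar>x 0\<bar> powr p \<le> 1 \<longleftrightarrow> \<bar>x 0\<bar> \<le> 1"
        using p powr_le1[of p "\<bar>x 0\<bar>"] gr_one_powr[of "\<bar>x 0\<bar>" p] by (cases "\<bar>x 0\<bar> \<le> 1") (auto simp: not_le)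
      ultimately show "1 * indicator (lp_ball p 1) x = (indicator {-1..1} (x 0) :: ennreal)"
        using p by (auto simp: lp_ball_eq powr_sum_def split: split_indicator)
    qed
    also have "\<dots> = 2" by (subst leb1_int) auto
    finally show ?thesis .
  qed
  have "(\<integral>\<^sup>+x. ennreal (\<bar>x\<bar> powr a * exp (- (\<bar>x\<bar> powr p))) \<partial>lborel) = (\<integral>\<^sup>+x. k (\<bar>x\<bar> powr p) \<partial>lborel)"
    using p by (simp add: k_def powr_powr)
  also have "\<dots> = (\<integral>\<^sup>+x. 1 * k (powr_sum p 1 x) \<partial>leb 1)"
    by (subst leb1_int[symmetric]) (auto simp: powr_sum_def)
  also have "\<dots> = 2 * (\<integral>\<^sup>+t. ennreal (indicator {0<..} t * (1 / p * t powr (1 / p - 1))) * k t \<partial>lborel)"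
    using nn_integral_leb_radial[of p 1 "\<lambda>_. 1" k] p ball by simp
  also have "(\<integral>\<^sup>+t. ennreal (indicator {0<..} t * (1 / p * t powr (1 / p - 1))) * k t \<partial>lborel)
      = (\<integral>\<^sup>+t. ennreal (1 / p) * ennreal (indicator {0..} t * t powr ((a + 1) / p - 1) / exp t) \<partial>lborel)"
  proof (intro nn_integral_cong)
    fix t :: real
    \<comment> \<open>At \<open>t = 0\<close> the two indicators differ, but
      \<open>0 powr _ = 0\<close> makes both sides vanish.\<close>
    have "indicator {0<..} t * (1 / p * t powr (1 / p - 1)) * (t powr (a / p) * exp (- t))
        = 1 / p * (indicator {0..} t * t powr ((a + 1) / p - 1) / exp t)"
      by (auto simp: exp_minus divide_inverse add_divide_distrib powr_add[symmetric] algebra_simps split: split_indicator)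
    then show "ennreal (indicator {0<..} t * (1 / p * t powr (1 / p - 1))) * k t
        = ennreal (1 / p) * ennreal (indicator {0..} t * t powr ((a + 1) / p - 1) / exp t)"
      using p unfolding k_def by (simp add: ennreal_mult'[symmetric])
  qed
  also have "\<dots> = ennreal (1 / p) * ennreal (Gamma ((a + 1) / p))"
    using p a by (subst nn_integral_cmult) (auto simp: Gamma_conv_nn_integral_real)
  also have "2 * (ennreal (1 / p) * ennreal (Gamma ((a + 1) / p))) = ennreal (2 / p * Gamma ((a + 1) / p))"
  proof -
    have "ennreal 2 * (ennreal (1 / p) * ennreal (Gamma ((a + 1) / p))) = ennreal (2 * (1 / p * Gamma ((a + 1) / p)))"
      using p by (simp only: ennreal_mult'[symmetric] zero_le_numeral zero_le_divide_1_iff less_imp_le)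
    then show ?thesis by simp
  qed
  finally show ?thesis .
qed

lemma nn_integral_prod_powr_exp:
  assumes p: "0 < p" and a: "- 1 < a"
  shows "(\<integral>\<^sup>+x. ennreal ((\<Prod>i<n. \<bar>x i\<bar>) powr a * exp (- powr_sum p n x)) \<partial>leb n)
    = ennreal ((2 / p * Gamma ((a + 1) / p)) ^ n)"
proof -
  have *: "ennreal ((\<Prod>i<n. \<bar>x i\<bar>) powr a * exp (- powr_sum p n x))
      = (\<Prod>i<n. ennreal (\<bar>x i\<bar> powr a * exp (- (\<bar>x i\<bar> powr p))))" for x
    by (simp add: prod_ennreal prod.distrib powr_sum_def exp_sum[symmetric] sum_negf prod_powr_distrib)
  have "0 \<le> 2 / p * Gamma ((a + 1) / p)"
    using p a by (intro mult_nonneg_nonneg less_imp_le[OF Gamma_real_pos]) auto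
  then show ?thesis
    unfolding * leb_def
    by (subst lborel_prod.product_nn_integral_prod)
       (simp_all add: nn_integral_abs_powr_exp[OF p a] ennreal_power)
qed

section \<open>The quotient of the two means and its moments\<close>

definition mean_ratio :: "real \<Rightarrow> nat \<Rightarrow> (nat \<Rightarrow> real) \<Rightarrow> real" where
  "mean_ratio p n x = geom_mean n x / power_mean p n x"

lemma measurable_geom_mean [measurable]: "geom_mean n \<in> borel_measurable (leb n)"
  unfolding geom_mean_def[abs_def] by measurable

lemma power_mean_eq: "power_mean p n x = (powr_sum p n x / real n) powr (1 / p)"
  by (simp add: power_mean_def powr_sum_def)

lemma measurable_power_mean [measurable]: "power_mean p n \<in> borel_measurable (leb n)"
  unfolding power_mean_eq[abs_def] by measurable

lemma measurable_mean_ratio [measurable]: "mean_ratio p n \<in> borel_measurable (leb n)"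
  unfolding mean_ratio_def[abs_def] by measurable

lemma geom_mean_dilate:
  assumes "0 < t" "0 < n" shows "geom_mean n (dilate n t x) = t * geom_mean n x"
proof -
  have "(\<Prod>i<n. \<bar>dilate n t x i\<bar>) = t ^ n * (\<Prod>i<n. \<bar>x i\<bar>)"
    using assms by (simp add: dilate_def abs_mult prod.distrib)
  moreover have "(t ^ n) powr (1 / real n) = t"
    using assms by (simp add: powr_realpow[symmetric] powr_powr)
  ultimately show ?thesis using assms by (simp add: geom_mean_def powr_mult prod_nonneg)
qed

lemma power_mean_dilate:
  assumes "0 < t" "0 < p" shows "power_mean p n (dilate n t x) = t * power_mean p n x"
proof -
  have "power_mean p n (dilate n t x) = (t powr p * (powr_sum p n x / real n)) powr (1 / p)"
    using assms by (simp add: power_mean_eq powr_sum_dilate)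
  also have "\<dots> = t * power_mean p n x"
    using assms powr_sum_nonneg[of p n x]
    by (subst powr_mult) (auto simp: powr_powr power_mean_eq)
  finally show ?thesis .
qed

lemma mean_ratio_dilate: "0 < t \<Longrightarrow> 0 < n \<Longrightarrow> 0 < p \<Longrightarrow> mean_ratio p n (dilate n t x) = mean_ratio p n x"
  by (simp add: mean_ratio_def geom_mean_dilate power_mean_dilate)

lemma power_mean_pos: "i < n \<Longrightarrow> x i \<noteq> 0 \<Longrightarrow> 0 < power_mean p n x"
  using powr_sum_pos[of i n x p] by (auto simp: power_mean_eq)

lemma geom_mean_pos: "(\<And>i. i < n \<Longrightarrow> x i \<noteq> 0) \<Longrightarrow> 0 < geom_mean n x"
  by (auto simp: geom_mean_def)

lemma AE_means_pos:
  assumes "0 < n" shows "AE x in leb n. 0 < geom_mean n x \<and> 0 < power_mean p n x \<and> 0 < mean_ratio p n x"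
  using AE_leb_coordinates_nonzero[of n]
proof eventually_elim
  case (elim x)
  then have "0 < geom_mean n x" "0 < power_mean p n x"
    using assms by (auto intro: geom_mean_pos power_mean_pos[of 0])
  then show ?case by (simp add: mean_ratio_def)
qed

text \<open>The exponent \<open>real n * a\<close> cancels the n-th root and separates the
  coordinates, apart from a power of \<open>powr_sum\<close>.\<close>

lemma mean_ratio_powr_eq:
  assumes "0 < n" "0 < p" "\<And>i. i < n \<Longrightarrow> x i \<noteq> 0"
  shows "mean_ratio p n x powr (real n * a)
    = real n powr (real n * a / p) * (\<Prod>i<n. \<bar>x i\<bar>) powr a * powr_sum p n x powr (- (real n * a / p))"
proof -
  have s: "0 < powr_sum p n x" using assms by (auto intro: powr_sum_pos[of 0])
  have pr: "0 < (\<Prod>i<n. \<bar>x i\<bar>)" using assms by (intro prod_pos) auto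
  have "mean_ratio p n x powr (real n * a)
      = (\<Prod>i<n. \<bar>x i\<bar>) powr a / (powr_sum p n x / real n) powr (real n * a / p)"
    unfolding mean_ratio_def geom_mean_def power_mean_eq
    using s pr assms by (simp add: powr_divide powr_powr powr_mult)
  also have "(powr_sum p n x / real n) powr (real n * a / p)
      = powr_sum p n x powr (real n * a / p) / real n powr (real n * a / p)"
    by (rule powr_divide)
  finally show ?thesis using s by (simp add: powr_minus divide_inverse mult_ac)
qed

text \<open>Every coordinate is at most the p-norm, which is \<open>real n powr (1 / p)\<close>
  times the power mean. This bounds the moments with nonnegative exponent.\<close>

lemma mean_ratio_le: "0 < n \<Longrightarrow> 0 < p \<Longrightarrow> mean_ratio p n x \<le> real n powr (1 / p)"
proof (cases "\<forall>i<n. x i \<noteq> 0")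
  case False
  assume "0 < n"
  with False have "geom_mean n x = 0" by (auto simp: geom_mean_def)
  then show ?thesis by (simp add: mean_ratio_def)
next
  case True
  assume n: "0 < n" and p: "0 < p"
  have s: "0 < powr_sum p n x" using n True by (auto intro: powr_sum_pos[of 0])
  have le: "\<bar>x i\<bar> \<le> powr_sum p n x powr (1 / p)" if "i < n" for i
  proof -
    have "\<bar>x i\<bar> powr p \<le> powr_sum p n x"
      unfolding powr_sum_def using that by (intro member_le_sum) auto
    then have "(\<bar>x i\<bar> powr p) powr (1 / p) \<le> powr_sum p n x powr (1 / p)"
      using p by (intro powr_mono2) auto
    then show ?thesis using p by (simp add: powr_powr)
  qed
  have "(\<Prod>i<n. \<bar>x i\<bar>) \<le> (\<Prod>i<n. powr_sum p n x powr (1 / p))"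
    using le by (intro prod_mono) auto
  then have "geom_mean n x \<le> ((powr_sum p n x powr (1 / p)) ^ n) powr (1 / real n)"
    unfolding geom_mean_def by (intro powr_mono2 prod_nonneg) auto
  also have "\<dots> = powr_sum p n x powr (1 / p)"
    using s n by (simp add: powr_realpow[symmetric] powr_powr)
  also have "\<dots> = real n powr (1 / p) * power_mean p n x"
    using s n by (simp add: power_mean_eq powr_divide)
  finally show ?thesis
    using power_mean_pos[of 0 n x p] n True by (simp add: mean_ratio_def pos_divide_le_eq)
qed

lemma emeasure_lp_ball_finite:
  assumes "0 < p" shows "emeasure (leb n) (lp_ball p n) < \<infinity>"
proof -
  have "\<bar>x i\<bar> \<le> 1" if "powr_sum p n x \<le> 1" "i < n" for x i
  proof -
    have "\<bar>x i\<bar> powr p \<le> powr_sum p n x"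
      unfolding powr_sum_def using that by (intro member_le_sum) auto
    then have "\<not> 1 < \<bar>x i\<bar> powr p" using that(1) by linarith
    then show ?thesis using gr_one_powr[of "\<bar>x i\<bar>" p] assms by argo
  qed
  note le = this
  have "lp_ball p n \<subseteq> Pi\<^sub>E {..<n} (\<lambda>_. {-1..1})"
  proof
    fix x assume "x \<in> lp_ball p n"
    then have "x \<in> extensional {..<n}" "powr_sum p n x \<le> 1"
      using assms by (auto simp: lp_ball_eq space_leb PiE_def)
    then show "x \<in> Pi\<^sub>E {..<n} (\<lambda>_. {-1..1})"
      using le[of x] by (simp add: PiE_def Pi_def abs_le_iff minus_le_iff)
  qed
  then have "emeasure (leb n) (lp_ball p n) \<le> emeasure (leb n) (Pi\<^sub>E {..<n} (\<lambda>_. {-1..1}))"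
    by (rule emeasure_mono) (auto simp: leb_def intro!: sets_PiM_I_finite)
  also have "\<dots> = (\<Prod>i<n. 2)"
    unfolding leb_def by (subst lborel_prod.emeasure_PiM) auto
  also have "\<dots> < \<infinity>" by (simp add: power_less_top_ennreal)
  finally show ?thesis .
qed

definition ratio_moment :: "real \<Rightarrow> nat \<Rightarrow> real \<Rightarrow> ennreal" where
  "ratio_moment p n a = (\<integral>\<^sup>+x. ennreal (mean_ratio p n x powr (real n * a)) * indicator (lp_ball p n) x \<partial>leb n)"

text \<open>Has to precede the exact value, because \<open>nn_integral_leb_radial\<close> assumes a
  finite integral. For negative \<open>a\<close> the integrand is dominated by that of
  \<open>nn_integral_prod_powr_exp\<close>.\<close>

lemma ratio_moment_finite:
  assumes n: "0 < n" and p: "0 < p" and a: "- 1 < a"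
  shows "ratio_moment p n a < \<infinity>"
proof (cases "0 \<le> a")
  case True
  have "ratio_moment p n a \<le> (\<integral>\<^sup>+x. ennreal ((real n powr (1 / p)) powr (real n * a)) * indicator (lp_ball p n) x \<partial>leb n)"
    unfolding ratio_moment_def
    by (intro nn_integral_mono mult_right_mono ennreal_leI powr_mono2 mean_ratio_le n p)
       (use True in \<open>auto simp: mean_ratio_def geom_mean_def power_mean_def\<close>)
  also have "\<dots> < \<infinity>"
    using emeasure_lp_ball_finite[OF p, of n]
    by (subst nn_integral_cmult) (auto simp: ennreal_mult_less_top)
  finally show ?thesis .
next
  case False
  have "ratio_moment p n a \<le> (\<integral>\<^sup>+x. ennreal (exp 1 * real n powr (real n * a / p)) *
      ennreal ((\<Prod>i<n. \<bar>x i\<bar>) powr a * exp (- powr_sum p n x)) \<partial>leb n)"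
    unfolding ratio_moment_def
  proof (rule nn_integral_mono_AE)
    show "AE x in leb n. ennreal (mean_ratio p n x powr (real n * a)) * indicator (lp_ball p n) x
      \<le> ennreal (exp 1 * real n powr (real n * a / p)) * ennreal ((\<Prod>i<n. \<bar>x i\<bar>) powr a * exp (- powr_sum p n x))"
      using AE_leb_coordinates_nonzero[of n]
    proof eventually_elim
      case (elim x)
      show ?case
      proof (cases "x \<in> lp_ball p n")
        case True
        then have s: "powr_sum p n x \<le> 1" using p by (simp add: lp_ball_eq)
        have "real n * a / p \<le> 0" using False n p by (simp add: divide_le_0_iff mult_le_0_iff)
        then have "powr_sum p n x powr (- (real n * a / p)) \<le> 1"
          using s powr_sum_nonneg[of p n x] by (intro powr_le1) auto
        \<comment> \<open>The factor \<open>exp 1\<close> compensates the exponential weight, which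
          is at least \<open>exp (- 1)\<close> on the ball.\<close>
        also have "1 \<le> exp 1 * exp (- powr_sum p n x)"
          using s by (simp add: exp_add[symmetric])
        finally have "mean_ratio p n x powr (real n * a)
            \<le> real n powr (real n * a / p) * (\<Prod>i<n. \<bar>x i\<bar>) powr a * (exp 1 * exp (- powr_sum p n x))"
          using elim by (subst mean_ratio_powr_eq[OF n p]) (auto intro!: mult_left_mono)
        then show ?thesis
          using True by (simp add: ennreal_mult'[symmetric] ennreal_leI mult_ac)
      qed auto
    qed
  qed
  also have "\<dots> < \<infinity>"
    by (subst nn_integral_cmult) (auto simp: nn_integral_prod_powr_exp[OF p a] ennreal_mult_less_top)
  finally show ?thesis .
qed

text \<open>Two evaluations of the integral of Z^(n a) S^\<beta> e^(-S) with S =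
  \<open>powr_sum p n\<close> and \<beta> = n a / p: the weight S^\<beta> cancels the power of S
  inside Z^(n a), which leaves a product integral, while the radial formula splits off the moment
  over the ball.\<close>

lemma ratio_moment_eq:
  assumes n: "0 < n" and p: "0 < p" and a: "- 1 < a"
  shows "ratio_moment p n a = ennreal (real n powr (real n * a / p) * (2 / p * Gamma ((a + 1) / p)) ^ n
    / (real n / p * Gamma (real n * (a + 1) / p)))"
proof -
  define \<beta> where "\<beta> = real n * a / p"
  define k where "k = (\<lambda>t::real. ennreal (t powr \<beta> * exp (- t)))"
  have [measurable]: "k \<in> borel_measurable borel" unfolding k_def by measurable
  have pos: "0 < real n * (a + 1) / p" "0 < (a + 1) / p" using n p a by auto
  have \<beta>: "\<beta> + real n / p = real n * (a + 1) / p" by (simp add: \<beta>_def add_divide_distrib algebra_simps)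
  have "(\<integral>\<^sup>+x. ennreal (mean_ratio p n x powr (real n * a)) * k (powr_sum p n x) \<partial>leb n)
      = (\<integral>\<^sup>+x. ennreal (real n powr \<beta>) * ennreal ((\<Prod>i<n. \<bar>x i\<bar>) powr a * exp (- powr_sum p n x)) \<partial>leb n)"
  proof (rule nn_integral_cong_AE)
    show "AE x in leb n. ennreal (mean_ratio p n x powr (real n * a)) * k (powr_sum p n x)
      = ennreal (real n powr \<beta>) * ennreal ((\<Prod>i<n. \<bar>x i\<bar>) powr a * exp (- powr_sum p n x))"
      using AE_leb_coordinates_nonzero[of n]
    proof eventually_elim
      case (elim x)
      then have s: "0 < powr_sum p n x" using n by (auto intro: powr_sum_pos[of 0])
      have "powr_sum p n x powr (- \<beta>) * powr_sum p n x powr \<beta> = 1"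
        using s by (simp add: powr_add[symmetric])
      then have "mean_ratio p n x powr (real n * a) * (powr_sum p n x powr \<beta> * exp (- powr_sum p n x))
          = real n powr \<beta> * ((\<Prod>i<n. \<bar>x i\<bar>) powr a * exp (- powr_sum p n x))"
        using mean_ratio_powr_eq[OF n p, of x a, folded \<beta>_def] elim by (simp add: mult_ac)
      then show ?case by (simp add: k_def ennreal_mult'[symmetric])
    qed
  qed
  also have "\<dots> = ennreal (real n powr \<beta> * (2 / p * Gamma ((a + 1) / p)) ^ n)"
    unfolding nn_integral_prod_powr_exp[OF p a, symmetric] ennreal_mult'[OF powr_ge_zero]
    by (rule nn_integral_cmult) measurable
  finally have 1: "(\<integral>\<^sup>+x. ennreal (mean_ratio p n x powr (real n * a)) * k (powr_sum p n x) \<partial>leb n)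
      = ennreal (real n powr \<beta> * (2 / p * Gamma ((a + 1) / p)) ^ n)" .
  have 2: "(\<integral>\<^sup>+x. ennreal (mean_ratio p n x powr (real n * a)) * k (powr_sum p n x) \<partial>leb n)
    = ratio_moment p n a * (\<integral>\<^sup>+t. ennreal (indicator {0<..} t * (n / p * t powr (n / p - 1))) * k t \<partial>lborel)"
    unfolding ratio_moment_def
    by (rule nn_integral_leb_radial[OF p n])
       (use ratio_moment_finite[OF n p a] n p in \<open>auto simp: mean_ratio_dilate ratio_moment_def\<close>)
  have "(\<integral>\<^sup>+t. ennreal (indicator {0<..} t * (n / p * t powr (n / p - 1))) * k t \<partial>lborel)
      = (\<integral>\<^sup>+t. ennreal (n / p) * ennreal (indicator {0..} t * t powr (real n * (a + 1) / p - 1) / exp t) \<partial>lborel)"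
  proof (intro nn_integral_cong)
    fix t :: real
    have "indicator {0<..} t * (n / p * t powr (n / p - 1)) * (t powr \<beta> * exp (- t))
        = n / p * (indicator {0..} t * t powr (real n * (a + 1) / p - 1) / exp t)"
      unfolding \<beta>[symmetric]
      by (auto simp: exp_minus divide_inverse powr_add[symmetric] algebra_simps split: split_indicator)
    then show "ennreal (indicator {0<..} t * (n / p * t powr (n / p - 1))) * k t
        = ennreal (n / p) * ennreal (indicator {0..} t * t powr (real n * (a + 1) / p - 1) / exp t)"
      using p unfolding k_def by (simp add: ennreal_mult'[symmetric])
  qed
  also have "\<dots> = ennreal (n / p * Gamma (real n * (a + 1) / p))"
    using p
    by (subst nn_integral_cmult)
       (simp_all add: Gamma_conv_nn_integral_real[OF pos(1), symmetric] ennreal_mult'[symmetric])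
  finally have 3: "ratio_moment p n a * ennreal (n / p * Gamma (real n * (a + 1) / p))
      = ennreal (real n powr \<beta> * (2 / p * Gamma ((a + 1) / p)) ^ n)"
    using 1 2 by simp
  obtain r where r: "ratio_moment p n a = ennreal r" "0 \<le> r"
    using ratio_moment_finite[OF n p a] by (cases "ratio_moment p n a") auto
  have G: "0 < n / p * Gamma (real n * (a + 1) / p)" "0 < Gamma ((a + 1) / p)"
    using n p pos by (auto simp: Gamma_real_pos)
  from 3 have "r * (n / p * Gamma (real n * (a + 1) / p)) = real n powr \<beta> * (2 / p * Gamma ((a + 1) / p)) ^ n"
    unfolding r(1) ennreal_mult'[OF r(2), symmetric]
    by (subst (asm) ennreal_inj) (use mult_nonneg_nonneg[OF r(2) less_imp_le[OF G(1)]] G p in auto)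
  then have "r = real n powr \<beta> * (2 / p * Gamma ((a + 1) / p)) ^ n / (n / p * Gamma (real n * (a + 1) / p))"
    using G n by (intro eq_divide_imp) auto
  then show ?thesis by (simp add: r(1) \<beta>_def)
qed

section \<open>Large deviations for the uniform distribution on the ball\<close>

definition unif_ball :: "real \<Rightarrow> nat \<Rightarrow> (nat \<Rightarrow> real) measure" where
  "unif_ball p n = uniform_measure (leb n) (lp_ball p n)"

lemma measurable_unif_ball [simp]: "measurable (unif_ball p n) N = measurable (leb n) N"
  by (simp add: unif_ball_def measurable_def)

lemma space_unif_ball [simp]: "space (unif_ball p n) = space (leb n)"
  and sets_unif_ball [simp, measurable_cong]: "sets (unif_ball p n) = sets (leb n)"
  by (simp_all add: unif_ball_def)

lemma emeasure_lp_ball: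
  assumes n: "0 < n" and p: "0 < p"
  shows "emeasure (leb n) (lp_ball p n) = ratio_moment p n 0"
proof -
  have "emeasure (leb n) (lp_ball p n) = (\<integral>\<^sup>+x. indicator (lp_ball p n) x \<partial>leb n)" by simp
  \<comment> \<open>Only almost everywhere: \<open>0 powr 0 = 0\<close>, so the integrand differs
    where \<open>mean_ratio\<close> is 0.\<close>
  also have "\<dots> = ratio_moment p n 0"
    unfolding ratio_moment_def
    by (rule nn_integral_cong_AE, rule eventually_mono[OF AE_means_pos[OF n, of p]]) auto
  finally show ?thesis .
qed

lemma ratio_moment_pos:
  assumes "0 < n" "0 < p" "- 1 < a"
  shows "0 < real n powr (real n * a / p) * (2 / p * Gamma ((a + 1) / p)) ^ n / (real n / p * Gamma (real n * (a + 1) / p))"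
  using assms by (intro divide_pos_pos mult_pos_pos zero_less_power Gamma_real_pos) auto

lemma emeasure_lp_ball_pos: "0 < n \<Longrightarrow> 0 < p \<Longrightarrow> 0 < emeasure (leb n) (lp_ball p n)"
  using ratio_moment_pos[of n p 0] by (simp add: emeasure_lp_ball ratio_moment_eq)

lemma prob_space_unif_ball: "0 < n \<Longrightarrow> 0 < p \<Longrightarrow> prob_space (unif_ball p n)"
  unfolding unif_ball_def
  using emeasure_lp_ball_pos[of n p] emeasure_lp_ball_finite[of p n]
  by (intro prob_space_uniform_measure) auto

text \<open>The logarithm, divided by \<open>n\<close>, of the quotient of the values in
  \<open>ratio_moment_eq\<close> at \<open>a\<close> and at 0; the factors
  \<open>(2 / p) ^ n\<close> and \<open>n / p\<close> have cancelled.\<close>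

definition scaled_log_moment :: "real \<Rightarrow> nat \<Rightarrow> real \<Rightarrow> real" where
  "scaled_log_moment p n a = a / p * ln (real n) + ln (Gamma ((a + 1) / p)) - ln (Gamma (1 / p))
     + ln (Gamma (real n / p)) / real n - ln (Gamma (real n * (a + 1) / p)) / real n"

lemma has_bochner_integral_ratio_moment:
  assumes n: "0 < n" and p: "0 < p" and a: "- 1 < a"
  shows "has_bochner_integral (unif_ball p n) (\<lambda>x. exp (real n * a * ln (mean_ratio p n x)))
    (exp (real n * scaled_log_moment p n a))"
proof (rule has_bochner_integral_nn_integral)
  have "(\<integral>\<^sup>+x. ennreal (exp (real n * a * ln (mean_ratio p n x))) \<partial>unif_ball p n)
      = (\<integral>\<^sup>+x. ennreal (exp (real n * a * ln (mean_ratio p n x))) * indicator (lp_ball p n) x \<partial>leb n) / emeasure (leb n) (lp_ball p n)"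
    unfolding unif_ball_def by (rule nn_integral_uniform_measure) auto
  also have "(\<integral>\<^sup>+x. ennreal (exp (real n * a * ln (mean_ratio p n x))) * indicator (lp_ball p n) x \<partial>leb n) = ratio_moment p n a"
    unfolding ratio_moment_def
    by (rule nn_integral_cong_AE, rule eventually_mono[OF AE_means_pos[OF n, of p]]) (auto simp: powr_def)
  also have "ratio_moment p n a / emeasure (leb n) (lp_ball p n) = ennreal (exp (real n * scaled_log_moment p n a))"
  proof -
    have G: "0 < Gamma ((a + 1) / p)" "0 < Gamma (1 / p)" "0 < Gamma (real n * (a + 1) / p)" "0 < Gamma (real n / p)"
      using n p a by (auto intro!: Gamma_real_pos)
    have e: "exp (real n * scaled_log_moment p n a) = real n powr (real n * a / p) * Gamma ((a + 1) / p) ^ n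
        / Gamma (1 / p) ^ n * Gamma (real n / p) / Gamma (real n * (a + 1) / p)"
    proof -
      have "real n * scaled_log_moment p n a = real n * a / p * ln (real n) + real n * ln (Gamma ((a + 1) / p))
          - real n * ln (Gamma (1 / p)) + ln (Gamma (real n / p)) - ln (Gamma (real n * (a + 1) / p))"
        using n by (simp add: scaled_log_moment_def algebra_simps)
      then show ?thesis using n G by (simp add: exp_diff exp_add exp_of_nat_mult powr_def)
    qed
    show ?thesis
      unfolding emeasure_lp_ball[OF n p] ratio_moment_eq[OF n p a] ratio_moment_eq[OF n p, of 0, simplified] e
      using ratio_moment_pos[OF n p a] ratio_moment_pos[OF n p, of 0] n p G
      by (subst divide_ennreal) (auto simp: field_simps power_mult_distrib power_divide)
  qed
  finally show "(\<integral>\<^sup>+x. ennreal (exp (real n * a * ln (mean_ratio p n x))) \<partial>unif_ball p n)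
      = ennreal (exp (real n * scaled_log_moment p n a))" .
qed auto

lemma tendsto_scaled_log_moment:
  assumes p: "1 \<le> p" and a: "- 1 < a"
  shows "(\<lambda>n. scaled_log_moment p n a) \<longlonglongrightarrow> log_moment p ((a + 1) / p)"
proof -
  define g where "g = (a + 1) / p"
  have g: "0 < g" using p a by (simp add: g_def)
  \<comment> \<open>The term \<open>a / p * ln n\<close> equals \<open>(g - 1 / p) * ln n\<close>
    and is shared out between the two Gamma terms so that each converges.\<close>
  have "(\<lambda>n. (ln (Gamma g) - ln (Gamma (1 / p))) + (ln (Gamma (real n * (1 / p))) / real n - (1 / p) * ln (real n))
      - (ln (Gamma (real n * g)) / real n - g * ln (real n)))
    \<longlonglongrightarrow> (ln (Gamma g) - ln (Gamma (1 / p))) + (1 / p * ln (1 / p) - 1 / p) - (g * ln g - g)"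
    using p by (intro tendsto_intros tendsto_ln_Gamma_scaled g) auto
  moreover have "a / p = g - 1 / p" using p by (simp add: g_def field_simps)
  then have "scaled_log_moment p n a = (ln (Gamma g) - ln (Gamma (1 / p))) + (ln (Gamma (real n * (1 / p))) / real n - (1 / p) * ln (real n))
      - (ln (Gamma (real n * g)) / real n - g * ln (real n))" for n
  proof -
    have "real n / p = real n * (1 / p)" "real n * (a + 1) / p = real n * g" by (simp_all add: g_def)
    then show ?thesis
      using \<open>a / p = g - 1 / p\<close> unfolding scaled_log_moment_def g_def[symmetric]
      by (simp only:) (simp add: left_diff_distrib)
  qed
  moreover have "log_moment p ((a + 1) / p)
      = (ln (Gamma g) - ln (Gamma (1 / p))) + (1 / p * ln (1 / p) - 1 / p) - (g * ln g - g)"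
    unfolding log_moment_def stirling_error_def g_def[symmetric] by simp
  ultimately show ?thesis by (simp only:)
qed

text \<open>Markov's inequality for \<open>exp (n * a * ln Z)\<close>. With the factor
  \<open>a\<close> on both sides of \<open>sub\<close>, one statement covers upper tails (a >= 0)
  and lower tails (a <= 0).\<close>

lemma unif_ball_upper_bound:
  assumes p: "1 \<le> p" and n: "0 < n" and a: "- 1 < a"
    and A: "A \<in> sets (leb n)"
    and sub: "\<And>x. x \<in> A \<Longrightarrow> 0 < mean_ratio p n x \<Longrightarrow> a * y \<le> a * ln (mean_ratio p n x)"
  shows "measure (unif_ball p n) A \<le> exp (real n * (scaled_log_moment p n a - a * y))"
proof -
  have p0: "0 < p" using p by simp
  interpret U: prob_space "unif_ball p n" by (rule prob_space_unif_ball[OF n p0])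
  note I = has_bochner_integral_ratio_moment[OF n p0 a]
  have AE: "AE x in unif_ball p n. 0 < mean_ratio p n x"
  proof -
    have "AE x in leb n. 0 < mean_ratio p n x"
      using AE_means_pos[OF n, of p] by (rule eventually_mono) simp
    then show ?thesis unfolding unif_ball_def
      using emeasure_lp_ball_pos[OF n p0] emeasure_lp_ball_finite[OF p0, of n]
      by (subst AE_uniform_measure) auto
  qed
  have "measure (unif_ball p n) A * exp (real n * (a * y)) = (\<integral>x. exp (real n * (a * y)) * indicator A x \<partial>unif_ball p n)"
    using A sets.sets_into_space[OF A] by (simp add: Int_absorb2)
  also have "\<dots> \<le> (\<integral>x. exp (real n * a * ln (mean_ratio p n x)) \<partial>unif_ball p n)"
  proof (rule integral_mono_AE)
    show "AE x in unif_ball p n. exp (real n * (a * y)) * indicator A x \<le> exp (real n * a * ln (mean_ratio p n x))"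
      using AE
    proof (rule eventually_mono)
      fix x assume x: "0 < mean_ratio p n x"
      show "exp (real n * (a * y)) * indicator A x \<le> exp (real n * a * ln (mean_ratio p n x))"
      proof (cases "x \<in> A")
        case True
        have "real n * (a * y) \<le> real n * (a * ln (mean_ratio p n x))"
          by (rule mult_left_mono[OF sub[OF True x]]) simp
        then show ?thesis using True by (simp add: mult.assoc)
      qed auto
    qed
    show "integrable (unif_ball p n) (\<lambda>x. exp (real n * (a * y)) * indicator A x)"
      using A by (intro integrable_mult_right integrable_real_indicator) (auto simp: U.emeasure_eq_measure)
  qed (use I in \<open>auto simp: has_bochner_integral_iff\<close>)
  also have "\<dots> = exp (real n * scaled_log_moment p n a)"
    using I by (simp add: has_bochner_integral_iff)
  finally show ?thesis by (simp add: right_diff_distrib exp_diff pos_le_divide_eq)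
qed

lemma unif_ball_eventually_le:
  assumes p: "1 \<le> p" and \<theta>: "0 < \<theta>" "\<theta> < 1" and \<epsilon>: "0 < \<epsilon>"
    and A: "\<And>n. 0 < n \<Longrightarrow> A n \<in> sets (leb n)"
    and sub: "\<And>n x. 0 < n \<Longrightarrow> x \<in> A n \<Longrightarrow> 0 < mean_ratio p n x \<Longrightarrow>
      (p * G_fun p \<theta> - 1) * ln \<theta> \<le> (p * G_fun p \<theta> - 1) * ln (mean_ratio p n x)"
  shows "\<forall>\<^sub>F n in sequentially. measure (unif_ball p n) (A n) \<le> exp (real n * (- J_rate p \<theta> + \<epsilon>))"
proof -
  \<comment> \<open>The stationary exponent of the Legendre transform: Markov's exponent then tends
    to \<open>- J_rate p \<theta>\<close>.\<close>
  define a where "a = p * G_fun p \<theta> - 1"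
  have a: "- 1 < a" "(a + 1) / p = G_fun p \<theta>" using G_fun(1)[OF p \<theta>] p by (auto simp: a_def)
  have "(\<lambda>n. scaled_log_moment p n a) \<longlonglongrightarrow> log_moment p (G_fun p \<theta>)"
    using tendsto_scaled_log_moment[OF p a(1)] a(2) by simp
  then have "\<forall>\<^sub>F n in sequentially. scaled_log_moment p n a < log_moment p (G_fun p \<theta>) + \<epsilon>"
    using \<epsilon> by (intro order_tendstoD) auto
  then show ?thesis
    using eventually_gt_at_top[of 0]
  proof eventually_elim
    case (elim n)
    have "measure (unif_ball p n) (A n) \<le> exp (real n * (scaled_log_moment p n a - a * ln \<theta>))"
      using sub[OF elim(2)] by (intro unif_ball_upper_bound p elim a A) (auto simp: a_def)
    also have "\<dots> \<le> exp (real n * (- J_rate p \<theta> + \<epsilon>))"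
      using elim p by (simp add: J_rate_eq a_def)
    finally show ?case .
  qed
qed

text \<open>The tilt aims at \<open>H_fun g / p\<close> for g close to, but different from,
  \<open>G_fun p \<theta>\<close>: a whole window around that point lies in the event, whereas
  \<open>ln \<theta>\<close> is on its boundary. The filter \<open>F\<close> selects the side that
  points into the event.\<close>

lemma unif_ball_eventually_ge:
  assumes p: "1 \<le> p" and \<theta>: "0 < \<theta>" "\<theta> < 1" and \<epsilon>: "0 < \<epsilon>"
    and A: "\<And>n. 0 < n \<Longrightarrow> A n \<in> sets (leb n)"
    and F: "F \<le> at (G_fun p \<theta>)" "F \<noteq> bot"
    and sub: "\<forall>\<^sub>F g in F. 0 < g \<and> (\<exists>\<delta>>0. \<forall>n>0. \<forall>x\<in>space (leb n).
       0 < power_mean p n x \<longrightarrow> 0 < mean_ratio p n x \<longrightarrow> \<bar>ln (mean_ratio p n x) - H_fun g / p\<bar> < \<delta> \<longrightarrow> x \<in> A n)"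
  shows "\<forall>\<^sub>F n in sequentially. exp (real n * (- J_rate p \<theta> - \<epsilon>)) \<le> measure (unif_ball p n) (A n)"
proof -
  define G where "G = G_fun p \<theta>"
  have p0: "0 < p" using p by simp
  have G: "0 < G" "H_fun G = p * ln \<theta>" using G_fun[OF p \<theta>] by (auto simp: G_def)
  \<comment> \<open>The negative rate at the level \<open>H_fun g / p\<close>; by continuity, moving
    g slightly away from \<open>G\<close> costs at most \<open>\<epsilon> / 3\<close>.\<close>
  define \<phi> where "\<phi> = (\<lambda>g. log_moment p g - (p * g - 1) * (H_fun g / p))"
  have "isCont \<phi> G"
    unfolding \<phi>_def log_moment_def using G p0
    by (intro continuous_intros isCont_H_fun DERIV_isCont[OF DERIV_stirling_error]) auto
  moreover have "\<phi> G = - J_rate p \<theta>"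
    using p G by (simp add: \<phi>_def J_rate_eq G_def)
  ultimately have "(\<phi> \<longlongrightarrow> - J_rate p \<theta>) (at G)" by (simp add: isCont_def)
  then have "\<forall>\<^sub>F g in F. - J_rate p \<theta> - \<epsilon> / 3 < \<phi> g"
    using F(1) \<epsilon> by (intro order_tendstoD(1)[OF tendsto_mono]) (auto simp: G_def)
  from eventually_happens'[OF F(2) eventually_conj[OF this sub]]
  obtain g \<delta> where g: "- J_rate p \<theta> - \<epsilon> / 3 < \<phi> g" "0 < g" "0 < \<delta>"
    and gsub: "\<And>n x. 0 < n \<Longrightarrow> x \<in> space (leb n) \<Longrightarrow> 0 < power_mean p n x \<Longrightarrow> 0 < mean_ratio p n x \<Longrightarrow>
      \<bar>ln (mean_ratio p n x) - H_fun g / p\<bar> < \<delta> \<Longrightarrow> x \<in> A n"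
    by blast
  define a where "a = p * g - 1"
  have a: "- 1 < a" "(a + 1) / p = g" using g p by (auto simp: a_def)
  \<comment> \<open>A smaller window bounds the tilting loss
    \<open>\<bar>a\<bar> * \<delta>'\<close> by \<open>\<epsilon> / 3\<close>; the summand 1 covers
    \<open>a = 0\<close>.\<close>
  define \<delta>' where "\<delta>' = min \<delta> (\<epsilon> / (3 * (\<bar>a\<bar> + 1)))"
  have \<delta>': "0 < \<delta>'" "\<delta>' \<le> \<delta>" using g \<epsilon> by (auto simp: \<delta>'_def)
  have "\<bar>a\<bar> * \<delta>' \<le> \<bar>a\<bar> * (\<epsilon> / (3 * (\<bar>a\<bar> + 1)))"
    by (intro mult_left_mono) (auto simp: \<delta>'_def)
  also have "\<dots> \<le> \<epsilon> / 3" using \<epsilon> by (simp add: field_simps)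
  finally have a\<delta>: "\<bar>a\<bar> * \<delta>' \<le> \<epsilon> / 3" .
  have deriv: "((\<lambda>s. log_moment p ((s + 1) / p)) has_real_derivative H_fun g / p) (at a)"
    unfolding log_moment_def using a g p0
    by (auto intro!: derivative_eq_intros DERIV_chain2[OF DERIV_stirling_error])
  have "\<forall>\<^sub>F n in sequentially.
    exp (real n * (log_moment p ((a + 1) / p) - a * (H_fun g / p) - \<bar>a\<bar> * \<delta>' - \<epsilon> / 3))
     \<le> measure (unif_ball p n) {x \<in> space (unif_ball p n). \<bar>ln (mean_ratio p n x) - H_fun g / p\<bar> < \<delta>'}"
  proof (rule gaertner_ellis_lower_bound[where I = "{-1<..}" and \<Lambda>n = "scaled_log_moment p"])
    show "has_bochner_integral (unif_ball p n) (\<lambda>x. exp (real n * s * ln (mean_ratio p n x)))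
        (exp (real n * scaled_log_moment p n s))" if "1 \<le> n" "s \<in> {-1<..}" for n s
      using that p0 by (intro has_bochner_integral_ratio_moment) auto
    show "(\<lambda>n. scaled_log_moment p n s) \<longlonglongrightarrow> log_moment p ((s + 1) / p)" if "s \<in> {-1<..}" for s
      using that by (intro tendsto_scaled_log_moment p) auto
  qed (use p0 a \<delta>' \<epsilon> deriv in \<open>auto intro: prob_space_unif_ball\<close>)
  then show ?thesis
    using eventually_gt_at_top[of 0]
  proof eventually_elim
    case (elim n)
    interpret U: prob_space "unif_ball p n" by (rule prob_space_unif_ball[OF elim(2) p0])
    have "real n * (- J_rate p \<theta> - \<epsilon>) \<le> real n * (log_moment p ((a + 1) / p) - a * (H_fun g / p) - \<bar>a\<bar> * \<delta>' - \<epsilon> / 3)"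
      using a\<delta> g(1) by (intro mult_left_mono) (auto simp: \<phi>_def a_def[symmetric] a(2))
    then have "exp (real n * (- J_rate p \<theta> - \<epsilon>)) \<le> exp (real n * (log_moment p ((a + 1) / p) - a * (H_fun g / p) - \<bar>a\<bar> * \<delta>' - \<epsilon> / 3))"
      by simp
    also note elim(1)
    also have "measure (unif_ball p n) {x \<in> space (unif_ball p n). \<bar>ln (mean_ratio p n x) - H_fun g / p\<bar> < \<delta>'}
        \<le> measure (unif_ball p n) (A n)"
    proof (rule U.finite_measure_mono_AE)
      have "AE x in leb n. 0 < power_mean p n x \<and> 0 < mean_ratio p n x"
        using AE_means_pos[OF elim(2), of p] by (rule eventually_mono) simp
      then have "AE x in unif_ball p n. 0 < power_mean p n x \<and> 0 < mean_ratio p n x"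
        unfolding unif_ball_def
        using emeasure_lp_ball_pos[OF elim(2) p0] emeasure_lp_ball_finite[OF p0, of n]
        by (subst AE_uniform_measure) auto
      then show "AE x in unif_ball p n. x \<in> {x \<in> space (unif_ball p n). \<bar>ln (mean_ratio p n x) - H_fun g / p\<bar> < \<delta>'} \<longrightarrow> x \<in> A n"
        by (rule eventually_mono) (use gsub[OF elim(2)] \<delta>'(2) in auto)
    qed (use A elim in auto)
    finally show ?case .
  qed
qed

section \<open>The two deviation events\<close>

definition ge_event :: "real \<Rightarrow> real \<Rightarrow> nat \<Rightarrow> (nat \<Rightarrow> real) set" where
  "ge_event p \<theta> n = {x \<in> space (leb n). \<theta> * power_mean p n x \<le> geom_mean n x}"

definition le_event :: "real \<Rightarrow> real \<Rightarrow> nat \<Rightarrow> (nat \<Rightarrow> real) set" where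
  "le_event p \<theta> n = {x \<in> space (leb n). geom_mean n x \<le> \<theta> * power_mean p n x}"

lemma sets_events [measurable]: "ge_event p \<theta> n \<in> sets (leb n)" "le_event p \<theta> n \<in> sets (leb n)"
  unfolding ge_event_def le_event_def by measurable

lemma mean_ratio_posD:
  assumes "0 < mean_ratio p n x" shows "0 < power_mean p n x"
proof -
  have "power_mean p n x \<noteq> 0" using assms by (auto simp: mean_ratio_def)
  then show ?thesis by (auto simp: power_mean_def)
qed

lemma ge_event_iff:
  "0 < mean_ratio p n x \<Longrightarrow> x \<in> ge_event p \<theta> n \<longleftrightarrow> x \<in> space (leb n) \<and> \<theta> \<le> mean_ratio p n x"
  using mean_ratio_posD[of p n x] by (auto simp: ge_event_def mean_ratio_def pos_le_divide_eq)

lemma le_event_iff: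
  "0 < mean_ratio p n x \<Longrightarrow> x \<in> le_event p \<theta> n \<longleftrightarrow> x \<in> space (leb n) \<and> mean_ratio p n x \<le> \<theta>"
  using mean_ratio_posD[of p n x] by (auto simp: le_event_def mean_ratio_def pos_divide_le_eq)

text \<open>Monotonicity of \<open>H_fun\<close> turns \<open>exp (m_exp p) \<le> \<theta>\<close>
  into \<open>1 / p \<le> G\<close>, so the exponent \<open>p * G - 1\<close> is nonnegative, as an
  upper tail requires. To the right of \<open>G\<close> the target \<open>H_fun g / p\<close>
  exceeds \<open>ln \<theta>\<close>.\<close>

lemma unif_ball_ge_event:
  assumes p: "1 \<le> p" and \<theta>: "\<theta> \<in> {exp (m_exp p)..<1}" and \<epsilon>: "0 < \<epsilon>"
  shows "\<forall>\<^sub>F n in sequentially. measure (unif_ball p n) (ge_event p \<theta> n) \<le> exp (real n * (- J_rate p \<theta> + \<epsilon>))"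
    and "\<forall>\<^sub>F n in sequentially. exp (real n * (- J_rate p \<theta> - \<epsilon>)) \<le> measure (unif_ball p n) (ge_event p \<theta> n)"
proof -
  have \<theta>': "0 < \<theta>" "\<theta> < 1" "m_exp p \<le> ln \<theta>"
    using \<theta> exp_gt_zero[of "m_exp p"] by (auto simp: ln_ge_iff simp del: exp_gt_zero intro: less_le_trans)
  define G where "G = G_fun p \<theta>"
  have G: "0 < G" "H_fun G = p * ln \<theta>" using G_fun[OF p \<theta>'(1,2)] by (auto simp: G_def)
  have "H_fun (1 / p) \<le> H_fun G" using \<theta>' p by (simp add: H_fun_inverse[OF p] G)
  then have "1 / p \<le> G" using H_fun_less[of G "1 / p"] G(1) by (cases "1 / p \<le> G") auto
  then have a: "0 \<le> p * G - 1" using p by (simp add: field_simps)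
  show "\<forall>\<^sub>F n in sequentially. measure (unif_ball p n) (ge_event p \<theta> n) \<le> exp (real n * (- J_rate p \<theta> + \<epsilon>))"
    by (rule unif_ball_eventually_le[OF p \<theta>'(1,2) \<epsilon>])
       (use a \<theta>' in \<open>auto simp: ge_event_iff G_def intro!: mult_left_mono\<close>)
  show "\<forall>\<^sub>F n in sequentially. exp (real n * (- J_rate p \<theta> - \<epsilon>)) \<le> measure (unif_ball p n) (ge_event p \<theta> n)"
  proof (rule unif_ball_eventually_ge[OF p \<theta>'(1,2) \<epsilon>])
    show "at_right G \<le> at (G_fun p \<theta>)" by (simp add: G_def at_le)
    show "\<forall>\<^sub>F g in at_right G. 0 < g \<and> (\<exists>\<delta>>0. \<forall>n>0. \<forall>x\<in>space (leb n).
       0 < power_mean p n x \<longrightarrow> 0 < mean_ratio p n x \<longrightarrow> \<bar>ln (mean_ratio p n x) - H_fun g / p\<bar> < \<delta> \<longrightarrow> x \<in> ge_event p \<theta> n)"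
      using eventually_at_right_less[of G]
    proof eventually_elim
      case (elim g)
      have "ln \<theta> < H_fun g / p" using H_fun_less[OF G(1) elim] G(2) p by (simp add: field_simps)
      moreover have "x \<in> ge_event p \<theta> n"
        if "x \<in> space (leb n)" "0 < mean_ratio p n x" "\<bar>ln (mean_ratio p n x) - H_fun g / p\<bar> < H_fun g / p - ln \<theta>" for n x
      proof -
        have "ln \<theta> \<le> ln (mean_ratio p n x)" using that(3) by linarith
        then show ?thesis using that \<theta>' by (simp add: ge_event_iff)
      qed
      ultimately show ?case using elim G(1) by (intro conjI exI[of _ "H_fun g / p - ln \<theta>"]) auto
    qed
  qed auto
qed

text \<open>All signs reverse: now \<open>G \<le> 1 / p\<close>, the exponent is nonpositive, and
  \<open>G\<close> is approached from the left.\<close>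

lemma unif_ball_le_event:
  assumes p: "1 \<le> p" and \<theta>: "\<theta> \<in> {0<..exp (m_exp p)}" and \<epsilon>: "0 < \<epsilon>"
  shows "\<forall>\<^sub>F n in sequentially. measure (unif_ball p n) (le_event p \<theta> n) \<le> exp (real n * (- J_rate p \<theta> + \<epsilon>))"
    and "\<forall>\<^sub>F n in sequentially. exp (real n * (- J_rate p \<theta> - \<epsilon>)) \<le> measure (unif_ball p n) (le_event p \<theta> n)"
proof -
  have \<theta>': "0 < \<theta>" "\<theta> < 1" "ln \<theta> \<le> m_exp p"
    using \<theta> exp_m_exp[OF p] ln_le_cancel_iff[of \<theta> "exp (m_exp p)"] by (auto simp del: exp_less_one_iff)
  define G where "G = G_fun p \<theta>"
  have G: "0 < G" "H_fun G = p * ln \<theta>" using G_fun[OF p \<theta>'(1,2)] by (auto simp: G_def)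
  have "H_fun G \<le> H_fun (1 / p)" using \<theta>' p by (simp add: H_fun_inverse[OF p] G)
  then have "G \<le> 1 / p" using H_fun_less[of "1 / p" G] p by (cases "G \<le> 1 / p") auto
  then have a: "p * G - 1 \<le> 0" using p by (simp add: field_simps)
  show "\<forall>\<^sub>F n in sequentially. measure (unif_ball p n) (le_event p \<theta> n) \<le> exp (real n * (- J_rate p \<theta> + \<epsilon>))"
    by (rule unif_ball_eventually_le[OF p \<theta>'(1,2) \<epsilon>])
       (use a \<theta>' in \<open>auto simp: le_event_iff G_def intro!: mult_left_mono_neg\<close>)
  show "\<forall>\<^sub>F n in sequentially. exp (real n * (- J_rate p \<theta> - \<epsilon>)) \<le> measure (unif_ball p n) (le_event p \<theta> n)"
  proof (rule unif_ball_eventually_ge[OF p \<theta>'(1,2) \<epsilon>])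
    show "at_left G \<le> at (G_fun p \<theta>)" by (simp add: G_def at_le)
    have "\<forall>\<^sub>F g in at_left G. g \<in> {0<..<G}" by (rule eventually_at_left_real[OF G(1)])
    then show "\<forall>\<^sub>F g in at_left G. 0 < g \<and> (\<exists>\<delta>>0. \<forall>n>0. \<forall>x\<in>space (leb n).
       0 < power_mean p n x \<longrightarrow> 0 < mean_ratio p n x \<longrightarrow> \<bar>ln (mean_ratio p n x) - H_fun g / p\<bar> < \<delta> \<longrightarrow> x \<in> le_event p \<theta> n)"
    proof eventually_elim
      case (elim g)
      have "H_fun g / p < ln \<theta>" using H_fun_less[of g G] elim G(2) p by (simp add: field_simps)
      moreover have "x \<in> le_event p \<theta> n"
        if "x \<in> space (leb n)" "0 < mean_ratio p n x" "\<bar>ln (mean_ratio p n x) - H_fun g / p\<bar> < ln \<theta> - H_fun g / p" for n x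
      proof -
        have "ln (mean_ratio p n x) \<le> ln \<theta>" using that(3) by linarith
        then show ?thesis using that \<theta>' by (simp add: le_event_iff)
      qed
      ultimately show ?case using elim by (intro conjI exI[of _ "ln \<theta> - H_fun g / p"]) auto
    qed
  qed auto
qed

section \<open>Hausdorff measure\<close>

lemma diam_on_le:
  assumes "\<And>x y. x \<in> U \<Longrightarrow> y \<in> U \<Longrightarrow> ennreal (d x y) \<le> D"
  shows "diam_on d U \<le> D"
  unfolding diam_on_def using assms by (intro SUP_least)

lemma dist_le_diam_on: "x \<in> U \<Longrightarrow> y \<in> U \<Longrightarrow> ennreal (d x y) \<le> diam_on d U"
  unfolding diam_on_def by (meson SUP_upper2 SUP_upper)

lemma diam_on_empty [simp]: "diam_on d {} = 0"
  by (simp add: diam_on_def bot_ennreal)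

text \<open>The summand in \<open>hausdorff_content\<close>. As empty sets are free, finite covers
  can be padded to sequences.\<close>

definition hausdorff_cost :: "('a \<Rightarrow> 'a \<Rightarrow> real) \<Rightarrow> nat \<Rightarrow> 'a set \<Rightarrow> ennreal" where
  "hausdorff_cost d k U = (if U = {} then 0 else diam_on d U ^ k)"

lemma hausdorff_cost_empty [simp]: "hausdorff_cost d k {} = 0"
  by (simp add: hausdorff_cost_def)

lemma hausdorff_content_le:
  assumes "A \<subseteq> (\<Union>i. U i)" "\<And>i. diam_on d (U i) \<le> ennreal \<delta>"
  shows "hausdorff_content d k \<delta> A \<le> (\<Sum>i. hausdorff_cost d k (U i))"
  unfolding hausdorff_content_def hausdorff_cost_def using assms by (intro INF_lower) auto

lemma hausdorff_content_approx:
  assumes "hausdorff_content d k \<delta> A < c"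
  obtains U where "A \<subseteq> (\<Union>i. U i)" "\<And>i. diam_on d (U i) \<le> ennreal \<delta>"
    "(\<Sum>i. hausdorff_cost d k (U i)) < c"
  using assms unfolding hausdorff_content_def hausdorff_cost_def[symmetric] INF_less_iff by auto

lemma hausdorff_content_greatest:
  assumes "\<And>U. A \<subseteq> (\<Union>i. U i) \<Longrightarrow> (\<And>i. diam_on d (U i) \<le> ennreal \<delta>) \<Longrightarrow>
    c \<le> (\<Sum>i. hausdorff_cost d k (U i))"
  shows "c \<le> hausdorff_content d k \<delta> A"
  unfolding hausdorff_content_def hausdorff_cost_def[symmetric] using assms by (intro INF_greatest) auto

text \<open>Covers of the \<open>B j\<close> with errors e / 2^(j + 1) are merged into one sequence
  through the pairing \<open>prod_decode\<close>.\<close>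

lemma hausdorff_content_subadditive:
  assumes sub: "A \<subseteq> (\<Union>j. B j)"
  shows "hausdorff_content d k \<delta> A \<le> (\<Sum>j::nat. hausdorff_content d k \<delta> (B j))"
proof (rule ennreal_le_epsilon)
  fix e :: real assume e: "0 < e" and fin: "(\<Sum>j. hausdorff_content d k \<delta> (B j)) < top"
  have "hausdorff_content d k \<delta> (B j) < hausdorff_content d k \<delta> (B j) + e * (1/2)^Suc j" for j
    using e fin by (auto simp add: less_top dest!: ennreal_suminf_lessD)
  then have "\<exists>U. B j \<subseteq> (\<Union>i. U i) \<and> (\<forall>i. diam_on d (U i) \<le> ennreal \<delta>) \<and>
      (\<Sum>i. hausdorff_cost d k (U i)) \<le> hausdorff_content d k \<delta> (B j) + e * (1/2)^Suc j" for j
    by (rule hausdorff_content_approx) (blast intro: less_imp_le)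
  then obtain U where U: "\<And>j. B j \<subseteq> (\<Union>i. U j i)" "\<And>j i. diam_on d (U j i) \<le> ennreal \<delta>"
    "\<And>j. (\<Sum>i. hausdorff_cost d k (U j i)) \<le> hausdorff_content d k \<delta> (B j) + e * (1/2)^Suc j"
    by metis
  define C where "C = case_prod U o prod_decode"
  have "A \<subseteq> (\<Union>i. C i)"
    using sub U(1) by (auto simp add: C_def subset_eq) (metis prod.case prod_encode_inverse)
  moreover have "diam_on d (C i) \<le> ennreal \<delta>" for i
    using U(2) by (simp add: C_def split_def)
  ultimately have "hausdorff_content d k \<delta> A \<le> (\<Sum>i. hausdorff_cost d k (C i))"
    by (rule hausdorff_content_le)
  also have "\<dots> = (\<Sum>j. \<Sum>i. hausdorff_cost d k (U j i))"
    unfolding C_def comp_def by (intro suminf_ennreal_2dimen) (auto simp: split_def)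
  also have "\<dots> \<le> (\<Sum>j. hausdorff_content d k \<delta> (B j) + e * (1/2) ^ Suc j)"
    by (intro suminf_le U(3)) auto
  also have "\<dots> = (\<Sum>j. hausdorff_content d k \<delta> (B j)) + (\<Sum>j. ennreal e * ennreal ((1/2) ^ Suc j))"
    using e by (subst suminf_add[symmetric]) (auto simp del: ennreal_suminf_cmult simp add: ennreal_mult[symmetric])
  also have "\<dots> = (\<Sum>j. hausdorff_content d k \<delta> (B j)) + e"
    unfolding ennreal_suminf_cmult by (subst suminf_ennreal_eq[OF zero_le_power power_half_series]) auto
  finally show "hausdorff_content d k \<delta> A \<le> (\<Sum>j. hausdorff_content d k \<delta> (B j)) + e" .
qed

lemma hausdorff_content_le_measure: "0 < \<delta> \<Longrightarrow> hausdorff_content d k \<delta> A \<le> hausdorff_measure d k A"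
  unfolding hausdorff_measure_def by (rule SUP_upper) simp

lemma hausdorff_measure_subadditive:
  assumes "A \<subseteq> (\<Union>j. B j)"
  shows "hausdorff_measure d k A \<le> (\<Sum>j::nat. hausdorff_measure d k (B j))"
  unfolding hausdorff_measure_def[of d k A]
proof (rule SUP_least)
  fix \<delta> :: real assume "\<delta> \<in> {0<..}"
  then show "hausdorff_content d k \<delta> A \<le> (\<Sum>j. hausdorff_measure d k (B j))"
    using hausdorff_content_subadditive[OF assms, of d k \<delta>]
    by (elim order_trans) (auto intro!: suminf_le hausdorff_content_le_measure)
qed

lemma hausdorff_measure_empty [simp]: "hausdorff_measure d k {} = 0"
proof -
  have "hausdorff_content d k \<delta> {} \<le> 0" for \<delta>
    using hausdorff_content_le[of "{}" "\<lambda>_. {}" d \<delta> k] by simp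
  then show ?thesis by (simp add: hausdorff_measure_def)
qed

lemma hausdorff_measure_Un: "hausdorff_measure d k (A \<union> B) \<le> hausdorff_measure d k A + hausdorff_measure d k B"
proof -
  have "hausdorff_measure d k (A \<union> B) \<le> (\<Sum>j. hausdorff_measure d k (binaryset A B j))"
    by (rule hausdorff_measure_subadditive) (simp add: UN_binaryset_eq)
  also have "\<dots> = hausdorff_measure d k A + hausdorff_measure d k B"
    by (subst suminf_binaryset_eq) auto
  finally show ?thesis .
qed

lemma hausdorff_measure_mono:
  assumes "A \<subseteq> B" shows "hausdorff_measure d k A \<le> hausdorff_measure d k B"
proof -
  have "hausdorff_measure d k A \<le> (\<Sum>j. hausdorff_measure d k (binaryset B {} j))"
    using assms by (intro hausdorff_measure_subadditive) (simp add: UN_binaryset_eq)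
  then show ?thesis by (subst (asm) suminf_binaryset_eq) auto
qed

lemma hausdorff_measure_Lipschitz_image:
  assumes L: "0 < L" and lip: "\<And>x y. x \<in> A \<Longrightarrow> y \<in> A \<Longrightarrow> d' (f x) (f y) \<le> L * d x y"
  shows "hausdorff_measure d' k (f ` A) \<le> ennreal (L ^ k) * hausdorff_measure d k A"
  unfolding hausdorff_measure_def[of d']
proof (rule SUP_least)
  fix \<delta> :: real assume \<delta>: "\<delta> \<in> {0<..}"
  \<comment> \<open>A cover of mesh \<open>\<delta> / L\<close> is carried by \<open>f\<close> to
    one of mesh \<open>\<delta>\<close>; its sets are first cut down to \<open>A\<close>, where
    alone \<open>f\<close> is controlled.\<close>
  have "hausdorff_content d' k \<delta> (f ` A) \<le> ennreal (L ^ k) * (\<Sum>i. hausdorff_cost d k (U i))"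
    if U: "A \<subseteq> (\<Union>i. U i)" "\<And>i. diam_on d (U i) \<le> ennreal (\<delta> / L)" for U
  proof -
    have diam: "diam_on d' (f ` (U i \<inter> A)) \<le> ennreal L * diam_on d (U i)" for i
    proof (rule diam_on_le)
      fix x y assume "x \<in> f ` (U i \<inter> A)" "y \<in> f ` (U i \<inter> A)"
      then obtain x' y' where xy: "x = f x'" "y = f y'" "x' \<in> U i \<inter> A" "y' \<in> U i \<inter> A" by auto
      then have "ennreal (d' x y) \<le> ennreal (L * d x' y')" using lip by (intro ennreal_leI) auto
      also have "\<dots> = ennreal L * ennreal (d x' y')" using L by (simp add: ennreal_mult')
      also have "\<dots> \<le> ennreal L * diam_on d (U i)"
        using xy by (intro mult_left_mono dist_le_diam_on) auto
      finally show "ennreal (d' x y) \<le> ennreal L * diam_on d (U i)" .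
    qed
    have cost: "hausdorff_cost d' k (f ` (U i \<inter> A)) \<le> ennreal (L ^ k) * hausdorff_cost d k (U i)" for i
      using power_mono[OF diam[of i], of k] L
      by (auto simp: hausdorff_cost_def power_mult_distrib ennreal_power)
    have "ennreal L * diam_on d (U i) \<le> ennreal L * ennreal (\<delta> / L)" for i
      using U(2) by (intro mult_left_mono) auto
    also have "ennreal L * ennreal (\<delta> / L) = ennreal \<delta>"
      using L by (simp add: ennreal_mult'[symmetric])
    finally have "hausdorff_content d' k \<delta> (f ` A) \<le> (\<Sum>i. hausdorff_cost d' k (f ` (U i \<inter> A)))"
      using U(1) by (intro hausdorff_content_le) (blast, rule order_trans[OF diam])
    also have "\<dots> \<le> (\<Sum>i. ennreal (L ^ k) * hausdorff_cost d k (U i))"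
      by (intro suminf_le cost) auto
    finally show ?thesis by simp
  qed
  then have "hausdorff_content d' k \<delta> (f ` A) / ennreal (L ^ k) \<le> hausdorff_content d k (\<delta> / L) A"
    using L by (intro hausdorff_content_greatest divide_le_posI_ennreal) (auto simp: mult.commute)
  also have "\<dots> \<le> hausdorff_measure d k A"
    using L \<delta> by (intro hausdorff_content_le_measure) auto
  finally have "ennreal (L ^ k) * (hausdorff_content d' k \<delta> (f ` A) / ennreal (L ^ k)) \<le> ennreal (L ^ k) * hausdorff_measure d k A"
    by (rule mult_left_mono) simp
  then show "hausdorff_content d' k \<delta> (f ` A) \<le> ennreal (L ^ k) * hausdorff_measure d k A"
    using L by (simp add: ennreal_times_divide mult.commute[of "ennreal _"] mult_divide_eq_ennreal)
qed

section \<open>Lebesgue measure and dyadic cells\<close>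

definition dyadic_index :: "nat \<Rightarrow> nat \<Rightarrow> (nat \<Rightarrow> real) \<Rightarrow> nat \<Rightarrow> int" where
  "dyadic_index k m x = (\<lambda>i\<in>{..<k}. \<lfloor>2 ^ m * x i\<rfloor>)"

definition dyadic_cell :: "nat \<Rightarrow> nat \<Rightarrow> (nat \<Rightarrow> int) \<Rightarrow> (nat \<Rightarrow> real) set" where
  "dyadic_cell k m j = {x \<in> space (leb k). dyadic_index k m x = j}"

text \<open>Unions of half-open cells of one common level. They form an algebra generating
  \<open>sets (leb k)\<close>, and scaling controls the Hausdorff measure of a single cell, so they
  suit covers that compare the two measures.\<close>

definition dyadic_algebra :: "nat \<Rightarrow> (nat \<Rightarrow> real) set set" where
  "dyadic_algebra k = {S. S \<subseteq> space (leb k) \<and>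
     (\<exists>m. \<forall>x\<in>S. \<forall>y\<in>space (leb k). dyadic_index k m x = dyadic_index k m y \<longrightarrow> y \<in> S)}"

lemma dyadic_index_mono:
  assumes "m \<le> m'" "dyadic_index k m' x = dyadic_index k m' y"
  shows "dyadic_index k m x = dyadic_index k m y"
proof -
  \<comment> \<open>The coarse index is an integer quotient of the fine one.\<close>
  have *: "\<lfloor>2 ^ m * t\<rfloor> = \<lfloor>2 ^ m' * t\<rfloor> div 2 ^ (m' - m)" for t :: real
  proof -
    have "2 ^ m * t = 2 ^ m' * t / real_of_int (2 ^ (m' - m))"
      using power_add[of "2::real" m "m' - m"] assms(1) by simp
    then show ?thesis by (metis floor_divide_real_eq_div zero_le_numeral zero_le_power)
  qed
  have "\<lfloor>2 ^ m' * x i\<rfloor> = \<lfloor>2 ^ m' * y i\<rfloor>" if "i < k" for i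
    using fun_cong[OF assms(2), of i] that by (simp add: dyadic_index_def)
  then show ?thesis by (auto simp: dyadic_index_def *)
qed

lemma dyadic_index_PiE: "dyadic_index k m x \<in> {..<k} \<rightarrow>\<^sub>E UNIV"
  by (auto simp: dyadic_index_def)

lemma countable_dyadic_indices: "countable (dyadic_index k m ` S)"
  by (rule countable_subset[OF image_subsetI[OF dyadic_index_PiE]]) (intro countable_PiE; simp)

lemma dyadic_cell_eq:
  assumes "j \<in> {..<k} \<rightarrow>\<^sub>E UNIV"
  shows "dyadic_cell k m j = (\<Pi>\<^sub>E i\<in>{..<k}. {j i / 2 ^ m ..< (j i + 1) / 2 ^ m})"
proof -
  have "dyadic_index k m x = j \<longleftrightarrow> (\<forall>i<k. \<lfloor>2 ^ m * x i\<rfloor> = j i)" for x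
    using assms by (auto simp: dyadic_index_def fun_eq_iff PiE_def extensional_def)
  moreover have "\<lfloor>2 ^ m * t\<rfloor> = z \<longleftrightarrow> z / 2 ^ m \<le> t \<and> t < (z + 1) / 2 ^ m" for t :: real and z :: int
    by (simp add: floor_eq_iff field_simps)
  ultimately show ?thesis
    unfolding dyadic_cell_def by (auto simp: space_leb PiE_def Pi_def)
qed

lemma sets_dyadic_cell: "j \<in> {..<k} \<rightarrow>\<^sub>E UNIV \<Longrightarrow> dyadic_cell k m j \<in> sets (leb k)"
  by (simp add: dyadic_cell_eq leb_def sets_PiM_I_finite)

lemma emeasure_dyadic_cell:
  assumes "j \<in> {..<k} \<rightarrow>\<^sub>E UNIV"
  shows "emeasure (leb k) (dyadic_cell k m j) = ennreal ((1 / 2 ^ m) ^ k)"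
proof -
  have "emeasure (leb k) (dyadic_cell k m j) = (\<Prod>i<k. ennreal (1 / 2 ^ m))"
    unfolding dyadic_cell_eq[OF assms] leb_def
    by (subst lborel_prod.emeasure_PiM) (auto simp: divide_right_mono add_divide_distrib)
  then show ?thesis by (simp add: ennreal_power)
qed

lemma algebra_dyadic: "algebra (space (leb k)) (dyadic_algebra k)"
  unfolding algebra_iff_Un
proof (intro conjI ballI)
  fix S T assume "S \<in> dyadic_algebra k" "T \<in> dyadic_algebra k"
  then obtain m m' where *: "S \<subseteq> space (leb k)" "T \<subseteq> space (leb k)"
    "\<forall>x\<in>S. \<forall>y\<in>space (leb k). dyadic_index k m x = dyadic_index k m y \<longrightarrow> y \<in> S"
    "\<forall>x\<in>T. \<forall>y\<in>space (leb k). dyadic_index k m' x = dyadic_index k m' y \<longrightarrow> y \<in> T"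
    by (auto simp: dyadic_algebra_def)
  have "\<forall>x\<in>S \<union> T. \<forall>y\<in>space (leb k). dyadic_index k (max m m') x = dyadic_index k (max m m') y \<longrightarrow> y \<in> S \<union> T"
    using * dyadic_index_mono[of m "max m m'" k] dyadic_index_mono[of m' "max m m'" k]
    by (metis Un_iff max.cobounded1 max.cobounded2)
  with * show "S \<union> T \<in> dyadic_algebra k" by (auto simp: dyadic_algebra_def)
next
  fix S assume "S \<in> dyadic_algebra k"
  then obtain m where *: "\<forall>x\<in>S. \<forall>y\<in>space (leb k). dyadic_index k m x = dyadic_index k m y \<longrightarrow> y \<in> S" "S \<subseteq> space (leb k)"
    by (auto simp: dyadic_algebra_def)
  then have "\<forall>x\<in>space (leb k) - S. \<forall>y\<in>space (leb k). dyadic_index k m x = dyadic_index k m y \<longrightarrow> y \<in> space (leb k) - S"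
    by (metis Diff_iff)
  then show "space (leb k) - S \<in> dyadic_algebra k" by (auto simp: dyadic_algebra_def)
qed (auto simp: dyadic_algebra_def)

lemma dyadic_algebra_cells:
  assumes "S \<in> dyadic_algebra k"
  obtains m where "S = (\<Union>j\<in>dyadic_index k m ` S. dyadic_cell k m j)"
proof -
  from assms obtain m where "\<forall>x\<in>S. \<forall>y\<in>space (leb k). dyadic_index k m x = dyadic_index k m y \<longrightarrow> y \<in> S"
    "S \<subseteq> space (leb k)"
    by (auto simp: dyadic_algebra_def)
  then have "S = (\<Union>j\<in>dyadic_index k m ` S. dyadic_cell k m j)" by (auto simp: dyadic_cell_def)
  then show ?thesis by (rule that)
qed

lemma dyadic_cell_in_algebra: "dyadic_cell k m j \<in> dyadic_algebra k"
  unfolding dyadic_algebra_def dyadic_cell_def by (auto intro!: exI[of _ m])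

lemma dyadic_algebra_subset_sets: "dyadic_algebra k \<subseteq> sets (leb k)"
proof
  fix S assume "S \<in> dyadic_algebra k"
  then obtain m where S: "S = (\<Union>j\<in>dyadic_index k m ` S. dyadic_cell k m j)" by (rule dyadic_algebra_cells)
  have "(\<Union>j\<in>dyadic_index k m ` S. dyadic_cell k m j) \<in> sets (leb k)"
    by (intro sets.countable_UN' countable_dyadic_indices image_subsetI)
       (erule imageE, simp only: sets_dyadic_cell[OF dyadic_index_PiE])
  with S show "S \<in> sets (leb k)" by simp
qed

lemma sets_leb_eq_sigma_dyadic: "sets (leb k) = sigma_sets (space (leb k)) (dyadic_algebra k)"
proof
  show "sigma_sets (space (leb k)) (dyadic_algebra k) \<subseteq> sets (leb k)"
    by (rule sets.sigma_sets_subset) (rule dyadic_algebra_subset_sets)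
  let ?N = "sigma (space (leb k)) (dyadic_algebra k)"
  have sub: "dyadic_algebra k \<subseteq> Pow (space (leb k))" by (auto simp: dyadic_algebra_def)
  have N: "space ?N = space (leb k)" "sets ?N = sigma_sets (space (leb k)) (dyadic_algebra k)"
    using sub by auto
  have coord: "(\<lambda>x. x i) \<in> borel_measurable ?N" if i: "i < k" for i
    unfolding borel_measurable_iff_less
  proof
    fix a :: real
    \<comment> \<open>The points whose level-m cell ends at or before \<open>a\<close> in direction
      \<open>i\<close>; these sets exhaust the open half-space as m grows.\<close>
    let ?S = "\<lambda>m. {x \<in> space (leb k). \<lfloor>2 ^ m * x i\<rfloor> + 1 \<le> 2 ^ m * a}"
    have "?S m \<in> dyadic_algebra k" for m
    proof -
      have eq: "\<lfloor>2 ^ m * x i\<rfloor> = \<lfloor>2 ^ m * y i\<rfloor>" if "dyadic_index k m x = dyadic_index k m y" for x y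
        using fun_cong[OF that, of i] i by (simp add: dyadic_index_def)
      have "y \<in> ?S m" if "x \<in> ?S m" "y \<in> space (leb k)" "dyadic_index k m x = dyadic_index k m y" for x y
        using that(1,2) unfolding mem_Collect_eq eq[OF that(3)] by blast
      then show ?thesis unfolding dyadic_algebra_def by blast
    qed
    then have "(\<Union>m. ?S m) \<in> sets ?N" unfolding N by (intro sigma_sets.Union) auto
    moreover have "(\<Union>m. ?S m) = {x \<in> space ?N. x i < a}"
    proof (intro set_eqI iffI)
      fix x assume "x \<in> (\<Union>m. ?S m)"
      then obtain m where x: "x \<in> space (leb k)" "\<lfloor>2 ^ m * x i\<rfloor> + 1 \<le> 2 ^ m * a" by auto
      have "2 ^ m * x i < \<lfloor>2 ^ m * x i\<rfloor> + 1" by linarith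
      then have "2 ^ m * x i < 2 ^ m * a" using x(2) by linarith
      then show "x \<in> {x \<in> space ?N. x i < a}" using x(1) by (simp add: N)
    next
      fix x assume "x \<in> {x \<in> space ?N. x i < a}"
      then have x: "x \<in> space (leb k)" "x i < a" by (auto simp: N)
      obtain m where m: "1 / (a - x i) < 2 ^ m" using real_arch_pow[of 2 "1 / (a - x i)"] by auto
      have "0 < a - x i" using x(2) by simp
      from pos_divide_less_eq[OF this, of 1 "2 ^ m"] m have "1 < 2 ^ m * (a - x i)" by blast
      moreover have "2 ^ m * (a - x i) = 2 ^ m * a - 2 ^ m * x i" by (rule right_diff_distrib)
      ultimately have "\<lfloor>2 ^ m * x i\<rfloor> + 1 \<le> 2 ^ m * a"
        using of_int_floor_le[of "2 ^ m * x i"] by linarith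
      then show "x \<in> (\<Union>m. ?S m)" using x(1) by auto
    qed
    ultimately show "{x \<in> space ?N. x i < a} \<in> sets ?N" by simp
  qed
  \<comment> \<open>This map is the identity on \<open>space (leb k)\<close>, so its measurability
    says that every set of \<open>leb k\<close> belongs to the generated sigma-algebra.\<close>
  have id: "(\<lambda>x. \<lambda>i\<in>{..<k}. x i) \<in> measurable ?N (leb k)"
    by (rule measurable_leb_I) (rule coord)
  show "sets (leb k) \<subseteq> sigma_sets (space (leb k)) (dyadic_algebra k)"
  proof
    fix A assume A: "A \<in> sets (leb k)"
    have "(\<lambda>i\<in>{..<k}. x i) = x" if "x \<in> space (leb k)" for x
      using that by (simp add: space_leb PiE_restrict)
    then have "(\<lambda>x. \<lambda>i\<in>{..<k}. x i) -` A \<inter> space ?N = A"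
      using sets.sets_into_space[OF A] by (auto simp: N)
    then show "A \<in> sigma_sets (space (leb k)) (dyadic_algebra k)"
      using measurable_sets[OF id A] by (simp only: N)
  qed
qed

text \<open>Caratheodory's extension of \<open>leb k\<close> from the dyadic algebra is
  \<open>leb k\<close> itself by uniqueness, the level-0 cells being a countable cover by sets of
  finite measure. Hence sets of finite measure have dyadic covers of almost the same
  measure.\<close>

lemma emeasure_leb_eq_outer_measure:
  assumes B: "B \<in> sets (leb k)"
  shows "emeasure (leb k) B = outer_measure (dyadic_algebra k) (emeasure (leb k)) B"
proof -
  let ?\<Omega> = "space (leb k)" and ?D = "dyadic_algebra k"
  let ?O = "outer_measure ?D (emeasure (leb k))"
  interpret D: algebra ?\<Omega> ?D by (rule algebra_dyadic)
  have pos: "positive ?D (emeasure (leb k))" by (simp add: positive_def)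
  have ca: "countably_additive ?D (emeasure (leb k))"
    using dyadic_algebra_subset_sets[of k]
    by (auto simp: countably_additive_def intro!: suminf_emeasure)
  have add: "additive ?D (emeasure (leb k))" by (rule D.countably_additive_additive[OF pos ca])
  have inc: "increasing ?D (emeasure (leb k))" by (rule D.additive_increasing[OF pos add])
  have "measure_space ?\<Omega> (lambda_system ?\<Omega> (Pow ?\<Omega>) ?O) ?O"
    by (rule sigma_algebra.caratheodory_lemma[OF sigma_algebra_Pow D.outer_measure_space_outer_measure[OF pos inc]])
  moreover from this have "sigma_sets ?\<Omega> ?D \<subseteq> lambda_system ?\<Omega> (Pow ?\<Omega>) ?O"
    by (intro sigma_algebra.sigma_sets_subset D.algebra_subset_lambda_system[OF pos inc add])
       (simp add: measure_space_def)
  ultimately have ms: "measure_space ?\<Omega> (sigma_sets ?\<Omega> ?D) ?O"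
    by (rule measure_down[OF _ sigma_algebra_sigma_sets[OF D.space_closed]])
  define N where "N = measure_of ?\<Omega> ?D ?O"
  have sub: "?D \<subseteq> Pow ?\<Omega>" by (rule D.space_closed)
  have sN: "sets N = sigma_sets ?\<Omega> ?D" unfolding N_def using sub by simp
  have eN: "emeasure N A = ?O A" if "A \<in> sets N" for A
    using that ms by (intro emeasure_measure_of[OF N_def sub]) (auto simp: measure_space_def sN)
  have agree: "?O A = emeasure (leb k) A" if "A \<in> ?D" for A
    by (rule D.outer_measure_agrees[OF pos ca that])
  have "leb k = N"
  proof (rule measure_eqI_generator_eq_countable)
    show "Int_stable ?D" by (auto simp: Int_stable_def)
    show "?D \<subseteq> Pow ?\<Omega>" by (rule sub)
    show "emeasure (leb k) A = emeasure N A" if "A \<in> ?D" for A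
      using that agree eN sN by auto
    show "sets (leb k) = sigma_sets ?\<Omega> ?D" by (rule sets_leb_eq_sigma_dyadic)
    show "sets N = sigma_sets ?\<Omega> ?D" by (rule sN)
    let ?A = "dyadic_cell k 0 ` dyadic_index k 0 ` ?\<Omega>"
    show "?A \<subseteq> ?D" by (auto intro: dyadic_cell_in_algebra)
    show "\<Union>?A = ?\<Omega>" by (auto simp: dyadic_cell_def)
    show "countable ?A" by (intro countable_image[OF countable_dyadic_indices])
    show "emeasure (leb k) a \<noteq> \<infinity>" if "a \<in> ?A" for a
      using that by (auto simp: emeasure_dyadic_cell dyadic_index_PiE)
  qed
  then show ?thesis using eN[of B] B by simp
qed

section \<open>Hausdorff measure and Lebesgue measure\<close>

lemma eucl_dist_nonneg [simp]: "0 \<le> eucl_dist n x y"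
  by (simp add: eucl_dist_def L2_set_nonneg)

lemma abs_le_eucl_dist: "i < n \<Longrightarrow> \<bar>x i - y i\<bar> \<le> eucl_dist n x y"
  using member_le_L2_set[of "{..<n}" i "\<lambda>i. \<bar>x i - y i\<bar>"] by (simp add: eucl_dist_def L2_set_def)

lemma eucl_dist_le:
  assumes "\<And>i. i < n \<Longrightarrow> \<bar>x i - y i\<bar> \<le> e" "0 \<le> e"
  shows "eucl_dist n x y \<le> sqrt n * e"
proof -
  have "(\<Sum>i<n. (x i - y i)\<^sup>2) \<le> (\<Sum>i<n. e\<^sup>2)"
    using assms by (intro sum_mono) (simp add: abs_le_square_iff[symmetric])
  then have "eucl_dist n x y \<le> sqrt (real n * e\<^sup>2)"
    by (simp add: eucl_dist_def L2_set_def)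
  then show ?thesis using assms(2) by (simp add: real_sqrt_mult)
qed

lemma eucl_dist_scale:
  assumes "\<And>i. i < n \<Longrightarrow> x' i - y' i = c * (x i - y i)" "0 \<le> c"
  shows "eucl_dist n x' y' = c * eucl_dist n x y"
proof -
  have "eucl_dist n x' y' = L2_set (\<lambda>i. c * (x i - y i)) {..<n}"
    unfolding eucl_dist_def using assms(1) by (intro L2_set_cong) auto
  also have "\<dots> = c * eucl_dist n x y"
    unfolding eucl_dist_def using assms(2) by (rule L2_set_right_distrib[symmetric])
  finally show ?thesis .
qed

abbreviation haus :: "nat \<Rightarrow> nat \<Rightarrow> (nat \<Rightarrow> real) set \<Rightarrow> ennreal" where
  "haus n k \<equiv> hausdorff_measure (eucl_dist n) k"

definition unit_cube :: "nat \<Rightarrow> (nat \<Rightarrow> real) set" where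
  "unit_cube k = ({..<k} \<rightarrow>\<^sub>E {0..<1})"

lemma unit_cube_eq: "unit_cube k = {x \<in> space (leb k). \<forall>i<k. 0 \<le> x i \<and> x i < 1}"
  by (auto simp: unit_cube_def space_leb PiE_def Pi_def)

lemma emeasure_unit_cube: "emeasure (leb k) (unit_cube k) = 1"
  and sets_unit_cube [measurable]: "unit_cube k \<in> sets (leb k)"
  unfolding unit_cube_def leb_def by (simp_all add: lborel_prod.emeasure_PiM sets_PiM_I_finite)

text \<open>The constant ratio of the unnormalised Hausdorff measure to Lebesgue measure in
  dimension \<open>k\<close>.\<close>

definition cube_haus :: "nat \<Rightarrow> ennreal" where
  "cube_haus k = haus k k (unit_cube k)"

text \<open>A cell is the image of the unit cube under a homothety of ratio
  \<open>1 / 2 ^ m\<close>, whose k-th power is the volume of the cell.\<close>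

lemma haus_dyadic_cell_le:
  assumes j: "j \<in> {..<k} \<rightarrow>\<^sub>E UNIV"
  shows "haus k k (dyadic_cell k m j) \<le> cube_haus k * emeasure (leb k) (dyadic_cell k m j)"
proof -
  define f where "f = (\<lambda>x. \<lambda>i\<in>{..<k}. (1 / 2 ^ m) * (x i + real_of_int (j i)))"
  have "dyadic_cell k m j \<subseteq> f ` unit_cube k"
  proof
    fix x assume x: "x \<in> dyadic_cell k m j"
    let ?y = "\<lambda>i\<in>{..<k}. 2 ^ m * x i - real_of_int (j i)"
    have "?y \<in> unit_cube k"
      unfolding unit_cube_def
    proof (rule PiE_I)
      fix i assume i: "i \<in> {..<k}"
      then have "\<lfloor>2 ^ m * x i\<rfloor> = j i"
        using x by (auto simp: dyadic_cell_def dyadic_index_def)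
      then show "?y i \<in> {0..<1}" using i by (auto simp: floor_eq_iff)
    qed auto
    moreover have "x = f ?y"
      using x unfolding dyadic_cell_eq[OF j] by (auto simp: f_def fun_eq_iff PiE_def extensional_def)
    ultimately show "x \<in> f ` unit_cube k" by blast
  qed
  then have "haus k k (dyadic_cell k m j) \<le> haus k k (f ` unit_cube k)"
    by (rule hausdorff_measure_mono)
  also have "\<dots> \<le> ennreal ((1 / 2 ^ m) ^ k) * haus k k (unit_cube k)"
  proof (rule hausdorff_measure_Lipschitz_image)
    show "eucl_dist k (f x) (f y) \<le> 1 / 2 ^ m * eucl_dist k x y" for x y
      by (rule eq_refl, rule eucl_dist_scale) (simp_all add: f_def diff_divide_distrib add_divide_distrib)
  qed simp
  finally show ?thesis using j by (simp add: cube_haus_def emeasure_dyadic_cell mult.commute)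
qed

lemma haus_dyadic_algebra_le:
  assumes S: "S \<in> dyadic_algebra k"
  shows "haus k k S \<le> cube_haus k * emeasure (leb k) S"
proof -
  obtain m where S_eq: "S = (\<Union>j\<in>dyadic_index k m ` S. dyadic_cell k m j)" using S by (rule dyadic_algebra_cells)
  let ?J = "dyadic_index k m ` S"
  define B where "B = (\<lambda>i. \<Union>j\<in>{j\<in>?J. to_nat_on ?J j = i}. dyadic_cell k m j)"
  have inj: "inj_on (to_nat_on ?J) ?J" by (rule inj_on_to_nat_on[OF countable_dyadic_indices])
  have B: "B i = {} \<or> (\<exists>j\<in>?J. B i = dyadic_cell k m j)" for i
  proof (cases "\<exists>j\<in>?J. to_nat_on ?J j = i")
    case True
    then obtain j where "j \<in> ?J" "to_nat_on ?J j = i" by blast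
    then have "{j\<in>?J. to_nat_on ?J j = i} = {j}" using inj by (auto dest: inj_onD)
    then have "B i = dyadic_cell k m j" by (simp add: B_def)
    then show ?thesis using \<open>j \<in> ?J\<close> by blast
  qed (auto simp: B_def)
  have UB: "(\<Union>i. B i) = S" unfolding B_def by (subst S_eq) blast
  have disj: "disjoint_family B"
    unfolding disjoint_family_on_def B_def by (auto simp: dyadic_cell_def)
  have Bi: "B i \<in> sets (leb k)" "haus k k (B i) \<le> cube_haus k * emeasure (leb k) (B i)" for i
    using B[of i] sets_dyadic_cell[OF dyadic_index_PiE] haus_dyadic_cell_le[OF dyadic_index_PiE] by auto
  have "haus k k S \<le> (\<Sum>i. haus k k (B i))"
    by (rule hausdorff_measure_subadditive) (simp add: UB)
  also have "\<dots> \<le> (\<Sum>i. cube_haus k * emeasure (leb k) (B i))"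
    by (intro suminf_le Bi) auto
  also have "\<dots> = cube_haus k * emeasure (leb k) S"
    using suminf_emeasure[OF image_subsetI[OF Bi(1)] disj] by (simp add: UB)
  finally show ?thesis .
qed

text \<open>At level m the cube has \<open>(2 ^ m) ^ k\<close> cells of diameter at most
  \<open>sqrt k / 2 ^ m\<close>, so the total cost \<open>sqrt k ^ k\<close> is the same at every
  level.\<close>

lemma cube_haus_finite: "cube_haus k < \<infinity>"
proof -
  have "hausdorff_content (eucl_dist k) k \<delta> (unit_cube k) \<le> ennreal (sqrt k ^ k)" if \<delta>: "0 < \<delta>" for \<delta>
  proof -
    obtain m where m: "sqrt k / \<delta> < 2 ^ m" using real_arch_pow[of 2 "sqrt k / \<delta>"] by auto
    have diam_le: "sqrt k * (1 / 2 ^ m) \<le> \<delta>" using m \<delta> by (simp add: field_simps)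
    define J where "J = ({..<k} \<rightarrow>\<^sub>E {0..<2 ^ m :: int})"
    have J: "finite J" "card J = (2 ^ m) ^ k" by (auto simp: J_def card_PiE nat_power_eq intro!: finite_PiE)
    obtain e where e: "bij_betw e {..<card J} J"
      using ex_bij_betw_nat_finite[OF J(1)] by (auto simp: atLeast0LessThan)
    define U where "U = (\<lambda>i. if i < card J then dyadic_cell k m (e i) else {})"
    have diam: "diam_on (eucl_dist k) (dyadic_cell k m j) \<le> ennreal (sqrt k * (1 / 2 ^ m))" for j
    proof (rule diam_on_le)
      fix x y assume xy: "x \<in> dyadic_cell k m j" "y \<in> dyadic_cell k m j"
      have "\<bar>x i - y i\<bar> \<le> 1 / 2 ^ m" if "i < k" for i
      proof -
        have "\<lfloor>2 ^ m * x i\<rfloor> = \<lfloor>2 ^ m * y i\<rfloor>"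
          using xy that by (auto simp: dyadic_cell_def dyadic_index_def dest!: fun_cong[where x = i])
        then have "\<bar>2 ^ m * x i - 2 ^ m * y i\<bar> \<le> 1" by linarith
        then have "2 ^ m * \<bar>x i - y i\<bar> \<le> 1" by (simp add: right_diff_distrib[symmetric] abs_mult)
        then show ?thesis by (simp add: field_simps)
      qed
      then show "ennreal (eucl_dist k x y) \<le> ennreal (sqrt k * (1 / 2 ^ m))"
        by (intro ennreal_leI eucl_dist_le) auto
    qed
    have cover: "unit_cube k \<subseteq> (\<Union>i. U i)"
    proof
      fix x assume x: "x \<in> unit_cube k"
      have "dyadic_index k m x \<in> J"
        using x by (auto simp: J_def dyadic_index_def unit_cube_eq floor_less_iff mult_less_cancel_left_pos)
      then have "dyadic_index k m x \<in> e ` {..<card J}" using e by (simp add: bij_betw_def)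
      then obtain i where "i < card J" "e i = dyadic_index k m x" by auto
      then show "x \<in> (\<Union>i. U i)"
        using x by (intro UN_I[of i]) (auto simp: U_def dyadic_cell_def unit_cube_eq)
    qed
    have "hausdorff_content (eucl_dist k) k \<delta> (unit_cube k) \<le> (\<Sum>i. hausdorff_cost (eucl_dist k) k (U i))"
      using cover order_trans[OF diam ennreal_leI[OF diam_le]]
      by (intro hausdorff_content_le) (auto simp: U_def)
    also have "\<dots> = (\<Sum>i<card J. hausdorff_cost (eucl_dist k) k (U i))"
      by (rule suminf_finite) (auto simp: U_def)
    also have "\<dots> \<le> (\<Sum>i<card J. ennreal ((sqrt k * (1 / 2 ^ m)) ^ k))"
      using power_mono[OF diam] by (intro sum_mono) (auto simp: hausdorff_cost_def U_def ennreal_power)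
    also have "\<dots> = ennreal (real (card J) * (sqrt k * (1 / 2 ^ m)) ^ k)"
      by (simp add: ennreal_mult' ennreal_of_nat_eq_real_of_nat)
    also have "real (card J) * (sqrt k * (1 / 2 ^ m)) ^ k = sqrt k ^ k"
      by (simp add: J power_mult_distrib power_divide)
    finally show ?thesis .
  qed
  then have "cube_haus k \<le> ennreal (sqrt k ^ k)"
    unfolding cube_haus_def hausdorff_measure_def by (intro SUP_least) auto
  then show ?thesis using le_less_trans by fastforce
qed

text \<open>A dyadic cover of \<open>B\<close> with nearly minimal volume transfers the bound from
  dyadic sets by subadditivity.\<close>

lemma haus_le:
  assumes B: "B \<in> sets (leb k)"
  shows "haus k k B \<le> cube_haus k * emeasure (leb k) B"
proof (rule ennreal_le_epsilon)
  fix e :: real assume fin: "cube_haus k * emeasure (leb k) B < top" and e: "0 < e"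
  obtain c where c: "cube_haus k = ennreal c" "0 \<le> c"
    using cube_haus_finite[of k] by (cases "cube_haus k") auto
  show "haus k k B \<le> cube_haus k * emeasure (leb k) B + ennreal e"
  proof (cases "emeasure (leb k) B = \<infinity>")
    case True
    \<comment> \<open>Infinite volume with a finite product forces \<open>c = 0\<close>, and then
      the whole space has Hausdorff measure 0.\<close>
    then have "c = 0" using fin c by (cases "c = 0") (auto simp: ennreal_mult_top)
    interpret D: algebra "space (leb k)" "dyadic_algebra k" by (rule algebra_dyadic)
    have "haus k k B \<le> haus k k (space (leb k))"
      using sets.sets_into_space[OF B] by (rule hausdorff_measure_mono)
    also have "\<dots> \<le> 0"
      using haus_dyadic_algebra_le[OF D.top] c \<open>c = 0\<close> by simp
    finally show ?thesis by simp
  next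
    case False
    interpret D: algebra "space (leb k)" "dyadic_algebra k" by (rule algebra_dyadic)
    \<comment> \<open>Dividing by \<open>c + 1\<close> instead of \<open>c\<close> also serves
      \<open>c = 0\<close>.\<close>
    define e' where "e' = e / (c + 1)"
    have e': "0 < e'" "c * e' \<le> e" using e c by (auto simp: e'_def field_simps)
    have "outer_measure (dyadic_algebra k) (emeasure (leb k)) B < emeasure (leb k) B + ennreal e'"
      using False e' by (simp add: emeasure_leb_eq_outer_measure[OF B, symmetric] less_top)
    from D.outer_measure_close[OF this]
    obtain A where A: "range A \<subseteq> dyadic_algebra k" "B \<subseteq> (\<Union>i. A i)"
      "(\<Sum>i. emeasure (leb k) (A i)) < emeasure (leb k) B + ennreal e'" by blast
    have "haus k k B \<le> (\<Sum>i. haus k k (A i))" using A(2) by (rule hausdorff_measure_subadditive)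
    also have "\<dots> \<le> (\<Sum>i. cube_haus k * emeasure (leb k) (A i))"
      using A(1) by (intro suminf_le haus_dyadic_algebra_le) auto
    also have "\<dots> = cube_haus k * (\<Sum>i. emeasure (leb k) (A i))" by simp
    also have "\<dots> \<le> cube_haus k * (emeasure (leb k) B + ennreal e')"
      using A(3) by (intro mult_left_mono) auto
    also have "\<dots> = cube_haus k * emeasure (leb k) B + ennreal (c * e')"
      using c by (simp add: distrib_left ennreal_mult')
    also have "\<dots> \<le> cube_haus k * emeasure (leb k) B + ennreal e"
      using e' by (intro add_left_mono ennreal_leI) auto
    finally show ?thesis .
  qed
qed

lemma emeasure_leb_box:
  assumes "a \<le> b"
  shows "emeasure (leb k) ({..<k} \<rightarrow>\<^sub>E {a..<b}) = ennreal ((b - a) ^ k)"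
    "({..<k} \<rightarrow>\<^sub>E {a..<b}) \<in> sets (leb k)"
  using assms unfolding leb_def
  by (simp_all add: lborel_prod.emeasure_PiM sets_PiM_I_finite ennreal_power)

lemma ennreal_power_mult_cancel:
  assumes "0 < a" shows "ennreal (a ^ k) * (ennreal ((1 / a) ^ k) * x) = x"
proof -
  have "ennreal (a ^ k) * ennreal ((1 / a) ^ k) = ennreal (a ^ k * (1 / a) ^ k)"
    using assms by (intro ennreal_mult'[symmetric]) simp
  also have "a ^ k * (1 / a) ^ k = 1" using assms by (simp add: power_divide)
  finally show ?thesis by (simp add: mult.assoc[symmetric])
qed

text \<open>The lower bound for \<open>B\<close> is the upper bound for its complement in a cube:
  the cube itself satisfies the lower bound by scaling, Hausdorff measure is subadditive, and the
  finite contribution of the complement cancels.\<close>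

lemma haus_ge_bounded:
  assumes B: "B \<in> sets (leb k)" and sub: "B \<subseteq> ({..<k} \<rightarrow>\<^sub>E {-real N..<real N})" and N: "0 < N"
  shows "cube_haus k * emeasure (leb k) B \<le> haus k k B"
proof -
  let ?Q = "{..<k} \<rightarrow>\<^sub>E {-real N..<real N}"
  have Q: "?Q \<in> sets (leb k)" "emeasure (leb k) ?Q = ennreal ((2 * real N) ^ k)"
    using emeasure_leb_box[of "- real N" "real N" k] by auto
  define f where "f = (\<lambda>x. \<lambda>i\<in>{..<k}. (1 / (2 * real N)) * (x i + real N))"
  have "unit_cube k \<subseteq> f ` ?Q"
  proof
    fix x assume x: "x \<in> unit_cube k"
    let ?y = "\<lambda>i\<in>{..<k}. 2 * real N * x i - real N"
    have "?y \<in> ?Q"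
    proof (rule PiE_I)
      fix i assume "i \<in> {..<k}"
      then have "0 \<le> x i" "x i < 1" "(\<lambda>i\<in>{..<k}. 2 * real N * x i - real N) i = 2 * real N * x i - real N"
        using x by (auto simp: unit_cube_eq)
      moreover have "2 * real N * x i < 2 * real N * 1" using \<open>x i < 1\<close> N by (intro mult_strict_left_mono) auto
      ultimately show "(\<lambda>i\<in>{..<k}. 2 * real N * x i - real N) i \<in> {- real N..<real N}" by simp
    qed auto
    moreover have "x = f ?y"
      using x N by (auto simp: f_def fun_eq_iff unit_cube_def PiE_def extensional_def field_simps)
    ultimately show "x \<in> f ` ?Q" by blast
  qed
  then have "cube_haus k \<le> haus k k (f ` ?Q)" unfolding cube_haus_def by (rule hausdorff_measure_mono)
  also have "\<dots> \<le> ennreal ((1 / (2 * real N)) ^ k) * haus k k ?Q"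
  proof (rule hausdorff_measure_Lipschitz_image)
    show "eucl_dist k (f x) (f y) \<le> 1 / (2 * real N) * eucl_dist k x y" for x y
      by (rule eq_refl, rule eucl_dist_scale) (simp_all add: f_def diff_divide_distrib add_divide_distrib)
  qed (use N in simp)
  finally have "ennreal ((2 * real N) ^ k) * cube_haus k \<le> ennreal ((2 * real N) ^ k) * (ennreal ((1 / (2 * real N)) ^ k) * haus k k ?Q)"
    by (rule mult_left_mono) simp
  also have "\<dots> = haus k k ?Q"
    using N by (intro ennreal_power_mult_cancel) simp
  also have "haus k k ?Q \<le> haus k k B + haus k k (?Q - B)"
    using hausdorff_measure_Un[of "eucl_dist k" k B "?Q - B"] sub by (simp add: Un_absorb1)
  also have "\<dots> \<le> haus k k B + cube_haus k * emeasure (leb k) (?Q - B)"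
    using B Q by (intro add_left_mono haus_le) auto
  finally have *: "cube_haus k * emeasure (leb k) ?Q \<le> haus k k B + cube_haus k * emeasure (leb k) (?Q - B)"
    by (simp add: Q(2) mult.commute)
  have fin: "cube_haus k * emeasure (leb k) (?Q - B) < \<infinity>"
  proof -
    have "emeasure (leb k) (?Q - B) \<le> emeasure (leb k) ?Q" using Q by (intro emeasure_mono) auto
    also have "\<dots> < \<infinity>" by (simp add: Q(2))
    finally show ?thesis using cube_haus_finite[of k] by (simp add: ennreal_mult_less_top)
  qed
  have "cube_haus k * emeasure (leb k) B + cube_haus k * emeasure (leb k) (?Q - B) = cube_haus k * emeasure (leb k) ?Q"
    using plus_emeasure[OF B, of "?Q - B"] B Q sub by (simp add: distrib_left[symmetric] Un_absorb1)
  with * have "cube_haus k * emeasure (leb k) B + cube_haus k * emeasure (leb k) (?Q - B)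
      \<le> haus k k B + cube_haus k * emeasure (leb k) (?Q - B)" by simp
  then show ?thesis using fin by (auto simp: add.commute ennreal_add_left_cancel_le)
qed

text \<open>Bounded parts suffice for the lower bound: Lebesgue measure is continuous along growing
  cubes, and Hausdorff measure is monotone.\<close>

theorem haus_eq_leb:
  assumes B: "B \<in> sets (leb k)"
  shows "haus k k B = cube_haus k * emeasure (leb k) B"
proof (rule antisym[OF haus_le[OF B]])
  let ?Q = "\<lambda>N. {..<k} \<rightarrow>\<^sub>E {-real (Suc N)..<real (Suc N)}"
  have Q: "?Q N \<in> sets (leb k)" for N by (rule emeasure_leb_box) simp
  have rng: "range (\<lambda>N. B \<inter> ?Q N) \<subseteq> sets (leb k)" using B Q by (intro image_subsetI sets.Int)
  have inc: "incseq (\<lambda>N. B \<inter> ?Q N)"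
    by (intro incseq_SucI Int_mono order_refl PiE_mono) auto
  have "(\<Union>N. B \<inter> ?Q N) = B"
  proof -
    have "\<exists>N. x \<in> ?Q N" if "x \<in> B" for x
    proof -
      obtain N where N: "(\<Sum>i<k. \<bar>x i\<bar>) < real N" using reals_Archimedean2 by blast
      have "\<bar>x i\<bar> \<le> (\<Sum>i<k. \<bar>x i\<bar>)" if "i < k" for i using that by (intro member_le_sum) auto
      then have "- real (Suc N) \<le> x i \<and> x i < real (Suc N)" if "i < k" for i
        using N that by (smt (verit) of_nat_Suc)
      moreover have "x \<in> extensional {..<k}" using sets.sets_into_space[OF B] that by (auto simp: space_leb PiE_def)
      ultimately show ?thesis by (auto simp: PiE_def Pi_def)
    qed
    then show ?thesis by blast
  qed
  then have "emeasure (leb k) B = (SUP N. emeasure (leb k) (B \<inter> ?Q N))"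
    using SUP_emeasure_incseq[OF rng inc] by simp
  then have "cube_haus k * emeasure (leb k) B = (SUP N. cube_haus k * emeasure (leb k) (B \<inter> ?Q N))"
    by (simp add: SUP_mult_left_ennreal)
  also have "\<dots> \<le> haus k k B"
  proof (rule SUP_least)
    fix N
    have "cube_haus k * emeasure (leb k) (B \<inter> ?Q N) \<le> haus k k (B \<inter> ?Q N)"
      using B Q by (intro haus_ge_bounded[where N = "Suc N"]) auto
    also have "\<dots> \<le> haus k k B" by (intro hausdorff_measure_mono) auto
    finally show "cube_haus k * emeasure (leb k) (B \<inter> ?Q N) \<le> haus k k B" .
  qed
  finally show "cube_haus k * emeasure (leb k) B \<le> haus k k B" .
qed

text \<open>A set of diameter D lies in a box of side 2 D, of volume 2^k D^k. Over a cover of the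
  unit cube these volumes add up to at least 1, so every cover costs at least 2^(-k).\<close>

lemma cube_haus_pos:
  assumes k: "0 < k" shows "0 < cube_haus k"
proof -
  have "ennreal ((1 / 2) ^ k) \<le> hausdorff_content (eucl_dist k) k 1 (unit_cube k)"
  proof (rule hausdorff_content_greatest)
    fix U :: "nat \<Rightarrow> (nat \<Rightarrow> real) set"
    assume cover: "unit_cube k \<subseteq> (\<Union>i. U i)" and small: "\<And>i. diam_on (eucl_dist k) (U i) \<le> ennreal 1"
    have "\<exists>C. C \<in> sets (leb k) \<and> U i \<inter> unit_cube k \<subseteq> C \<and> emeasure (leb k) C \<le> ennreal (2 ^ k) * hausdorff_cost (eucl_dist k) k (U i)" for i
    proof (cases "U i \<inter> unit_cube k = {}")
      case False
      then obtain x where x: "x \<in> U i" by auto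
      obtain D where D: "diam_on (eucl_dist k) (U i) = ennreal D" "0 \<le> D"
        using small[of i] by (cases "diam_on (eucl_dist k) (U i)") (auto simp: top_unique)
      let ?C = "\<Pi>\<^sub>E j\<in>{..<k}. {x j - D..x j + D}"
      have "?C \<in> sets (leb k)" unfolding leb_def by (rule sets_PiM_I_finite) auto
      moreover have "U i \<inter> unit_cube k \<subseteq> ?C"
      proof
        fix y assume y: "y \<in> U i \<inter> unit_cube k"
        have "ennreal (eucl_dist k x y) \<le> ennreal D"
          using dist_le_diam_on[of x "U i" y "eucl_dist k"] x y D by auto
        then have "eucl_dist k x y \<le> D" using D by simp
        then have "\<bar>x j - y j\<bar> \<le> D" if "j < k" for j
          using abs_le_eucl_dist[OF that, of x y] by linarith
        then have "y j \<in> {x j - D..x j + D}" if "j < k" for j using that by (simp add: abs_le_iff algebra_simps)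
        then show "y \<in> ?C" using y by (simp add: unit_cube_def PiE_def Pi_def)
      qed
      moreover have "emeasure (leb k) ?C = ennreal (2 ^ k) * hausdorff_cost (eucl_dist k) k (U i)"
      proof -
        have "emeasure (leb k) ?C = (\<Prod>j<k. ennreal (2 * D))"
          unfolding leb_def using D by (subst lborel_prod.emeasure_PiM) auto
        also have "\<dots> = ennreal ((2 * D) ^ k)" using D(2) by (simp add: ennreal_power)
        also have "\<dots> = ennreal (2 ^ k) * ennreal (D ^ k)"
          unfolding power_mult_distrib by (rule ennreal_mult') simp
        also have "ennreal (D ^ k) = hausdorff_cost (eucl_dist k) k (U i)"
          using x D by (auto simp: hausdorff_cost_def ennreal_power)
        finally show ?thesis .
      qed
      ultimately show ?thesis by (intro exI[of _ ?C]) auto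
    qed (auto intro: exI[of _ "{}"])
    then obtain C where C: "\<And>i. C i \<in> sets (leb k)" "\<And>i. U i \<inter> unit_cube k \<subseteq> C i"
      "\<And>i. emeasure (leb k) (C i) \<le> ennreal (2 ^ k) * hausdorff_cost (eucl_dist k) k (U i)" by metis
    have "1 = emeasure (leb k) (unit_cube k)" by (simp add: emeasure_unit_cube)
    also have "\<dots> \<le> emeasure (leb k) (\<Union>i. C i)"
    proof (rule emeasure_mono)
      show "unit_cube k \<subseteq> (\<Union>i. C i)"
      proof
        fix x assume x: "x \<in> unit_cube k"
        with cover obtain i where "x \<in> U i" by auto
        with x C(2)[of i] show "x \<in> (\<Union>i. C i)" by auto
      qed
    qed (use C(1) in auto)
    also have "\<dots> \<le> (\<Sum>i. emeasure (leb k) (C i))"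
      using C(1) by (intro emeasure_subadditive_countably) auto
    also have "\<dots> \<le> (\<Sum>i. ennreal (2 ^ k) * hausdorff_cost (eucl_dist k) k (U i))"
      by (intro suminf_le C) auto
    finally have "1 \<le> ennreal (2 ^ k) * (\<Sum>i. hausdorff_cost (eucl_dist k) k (U i))" by simp
    then have "ennreal ((1 / 2) ^ k) * 1 \<le> ennreal ((1 / 2) ^ k) * (ennreal (2 ^ k) * (\<Sum>i. hausdorff_cost (eucl_dist k) k (U i)))"
      by (rule mult_left_mono) simp
    also have "\<dots> = (\<Sum>i. hausdorff_cost (eucl_dist k) k (U i))"
      using ennreal_power_mult_cancel[of "1 / 2" k] by simp
    finally show "ennreal ((1 / 2) ^ k) \<le> (\<Sum>i. hausdorff_cost (eucl_dist k) k (U i))" by simp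
  qed
  also have "\<dots> \<le> cube_haus k" unfolding cube_haus_def by (rule hausdorff_content_le_measure) simp
  finally show ?thesis by (rule less_le_trans[rotated]) simp
qed

section \<open>Reflections and cones\<close>

definition dot :: "nat \<Rightarrow> (nat \<Rightarrow> real) \<Rightarrow> (nat \<Rightarrow> real) \<Rightarrow> real" where
  "dot n x y = (\<Sum>i<n. x i * y i)"

lemma dot_commute: "dot n x y = dot n y x"
  by (simp add: dot_def mult.commute)

lemma dot_self_nonneg: "0 \<le> dot n x x"
  by (simp add: dot_def sum_nonneg)

lemma eucl_dist_sq: "(eucl_dist n x y)\<^sup>2 = dot n (\<lambda>i. x i - y i) (\<lambda>i. x i - y i)"
  by (simp add: eucl_dist_def L2_set_def dot_def sum_nonneg power2_eq_square)

lemma dot_diff_right: "dot n u x - dot n u y = dot n u (\<lambda>i. x i - y i)"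
  by (simp add: dot_def sum_subtractf right_diff_distrib)

lemma dot_Cauchy: "(dot n x y)\<^sup>2 \<le> dot n x x * dot n y y"
  using Cauchy_Schwarz_ineq_sum[of x y "{..<n}"] by (simp add: dot_def power2_eq_square)

definition reflection :: "nat \<Rightarrow> (nat \<Rightarrow> real) \<Rightarrow> (nat \<Rightarrow> real) \<Rightarrow> nat \<Rightarrow> real" where
  "reflection n v x = (\<lambda>i\<in>{..<n}. x i - 2 * dot n v x / dot n v v * v i)"

lemma reflection_space [simp]: "reflection n v x \<in> space (leb n)"
  by (simp add: reflection_def space_leb)

lemma measurable_reflection [measurable]: "reflection n v \<in> measurable (leb n) (leb n)"
  unfolding reflection_def[abs_def] dot_def by (intro measurable_leb_I) measurable

lemma dot_reflection: "dot n v (reflection n v x) = - dot n v x"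
proof -
  have "dot n v (\<lambda>i\<in>{..<n}. x i - c * v i) = dot n v x - c * dot n v v" for c
    by (simp add: dot_def sum_subtractf right_diff_distrib sum_distrib_left mult_ac)
  then have "dot n v (reflection n v x) = dot n v x - 2 * dot n v x / dot n v v * dot n v v"
    unfolding reflection_def .
  \<comment> \<open>In the degenerate case the quotient is 0 by convention, so
    \<open>dot n v x\<close> itself must vanish.\<close>
  moreover have "dot n v x = 0" if "dot n v v = 0"
    using dot_Cauchy[of n v x] that by simp
  ultimately show ?thesis by (cases "dot n v v = 0") auto
qed

lemma reflection_reflection:
  assumes "x \<in> space (leb n)" shows "reflection n v (reflection n v x) = x"
proof
  fix i
  show "reflection n v (reflection n v x) i = x i"
  proof (cases "i < n")
    case True
    then have "reflection n v (reflection n v x) i = reflection n v x i - 2 * dot n v (reflection n v x) / dot n v v * v i"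
      by (simp add: reflection_def[of n v "reflection n v x"])
    with True show ?thesis unfolding dot_reflection by (simp add: reflection_def)
  next
    case False
    then show ?thesis using assms by (simp add: reflection_def space_leb PiE_def extensional_def)
  qed
qed

lemma eucl_dist_reflection: "eucl_dist n (reflection n v x) (reflection n v y) = eucl_dist n x y"
proof -
  let ?z = "\<lambda>i. x i - y i"
  define c where "c = 2 * dot n v ?z / dot n v v"
  have eq: "reflection n v x i - reflection n v y i = ?z i - c * v i" if "i < n" for i
    using that unfolding c_def dot_diff_right[symmetric]
    by (simp add: reflection_def diff_divide_distrib algebra_simps)
  have "(eucl_dist n (reflection n v x) (reflection n v y))\<^sup>2 = (\<Sum>i<n. (?z i - c * v i) * (?z i - c * v i))"
    unfolding eucl_dist_sq dot_def by (intro sum.cong) (auto simp: eq)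
  also have "\<dots> = dot n ?z ?z - 2 * c * dot n v ?z + c * c * dot n v v"
    by (simp add: dot_def algebra_simps sum.distrib sum_subtractf sum_distrib_left)
  \<comment> \<open>The choice of \<open>c\<close> makes the cross term cancel the quadratic
    one.\<close>
  also have "2 * c * dot n v ?z = c * c * dot n v v"
    by (cases "dot n v v = 0") (auto simp: c_def)
  finally have "(eucl_dist n (reflection n v x) (reflection n v y))\<^sup>2 = (eucl_dist n x y)\<^sup>2"
    by (simp add: eucl_dist_sq)
  then show ?thesis by (simp add: power2_eq_iff_nonneg)
qed

lemma reflection_dilate: "reflection n v (dilate n r x) = dilate n r (reflection n v x)"
proof -
  have "dot n v (dilate n r x) = r * dot n v x"
    by (simp add: dot_def dilate_def sum_distrib_left mult_ac)
  then show ?thesis by (auto simp: reflection_def dilate_def fun_eq_iff algebra_simps)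
qed

text \<open>Reflecting in the bisector of \<open>u\<close> and the last basis vector turns \<open>u\<close> into that basis vector.
  If the two coincide then \<open>v = 0\<close> and, since \<open>x / 0 = 0\<close>, the reflection is the identity.\<close>
lemma reflection_last:
  assumes u: "dot (Suc k) u u = 1"
  defines "v \<equiv> \<lambda>i. u i - (if i = k then 1 else 0)"
  shows "reflection (Suc k) v x k = dot (Suc k) u x"
proof -
  have vx: "dot (Suc k) v y = dot (Suc k) u y - y k" for y
    by (simp add: dot_def v_def left_diff_distrib sum_subtractf)
  have "dot (Suc k) v u = dot (Suc k) u v" by (rule dot_commute)
  then have vv: "dot (Suc k) v v = 2 - 2 * u k"
    unfolding vx[of v] using vx[of u] u by (simp add: v_def)
  have "reflection (Suc k) v x k = x k - 2 * dot (Suc k) v x / dot (Suc k) v v * v k"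
    by (simp add: reflection_def)
  moreover have "v k = u k - 1" by (simp add: v_def)
  ultimately have R: "reflection (Suc k) v x k = x k - 2 * (dot (Suc k) u x - x k) / (2 - 2 * u k) * (u k - 1)"
    unfolding vv vx[of x] by simp
  show ?thesis
  proof (cases "u k = 1")
    case False
    then show ?thesis unfolding R by (simp add: field_simps)
  next
    case True
    have "(\<Sum>i<k. u i * u i) = 0" using u True by (simp add: dot_def)
    then have "\<forall>i<k. u i = 0" by (subst (asm) sum_nonneg_eq_0_iff) auto
    then show ?thesis unfolding R using True by (simp add: dot_def)
  qed
qed

text \<open>A product measure is not visibly invariant under reflections, whereas Hausdorff measure
  depends on distances only; the two are proportional with a positive finite constant.\<close>

lemma emeasure_leb_reflection:
  assumes A: "A \<in> sets (leb n)" and n: "0 < n"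
  shows "emeasure (leb n) {x \<in> space (leb n). reflection n v x \<in> A} = emeasure (leb n) A"
proof -
  let ?B = "{x \<in> space (leb n). reflection n v x \<in> A}"
  have B: "?B \<in> sets (leb n)" using A by measurable
  have BA: "reflection n v ` A = ?B"
    using sets.sets_into_space[OF A] by (force simp: reflection_reflection image_iff subset_eq intro!: rev_image_eqI)
  have AB: "reflection n v ` ?B = A"
    using sets.sets_into_space[OF A] by (auto simp: reflection_reflection image_iff subset_eq) (metis reflection_reflection reflection_space)
  have "haus n n ?B \<le> ennreal (1 ^ n) * haus n n A"
    unfolding BA[symmetric] by (rule hausdorff_measure_Lipschitz_image) (auto simp: eucl_dist_reflection)
  moreover have "haus n n A \<le> ennreal (1 ^ n) * haus n n ?B"
    by (subst AB[symmetric], rule hausdorff_measure_Lipschitz_image) (auto simp: eucl_dist_reflection)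
  ultimately have "cube_haus n * emeasure (leb n) ?B = cube_haus n * emeasure (leb n) A"
    unfolding haus_eq_leb[OF A, symmetric] haus_eq_leb[OF B, symmetric] by simp
  then show ?thesis
    using cube_haus_pos[OF n] cube_haus_finite[of n] by (auto simp: ennreal_mult_cancel_left)
qed

section \<open>Cones over subsets of the sphere\<close>

definition normalize_lp :: "real \<Rightarrow> nat \<Rightarrow> (nat \<Rightarrow> real) \<Rightarrow> nat \<Rightarrow> real" where
  "normalize_lp p n x = dilate n (1 / lp_norm p n x) x"

text \<open>Without the apex, base point and radius are determined by the point. Membership can thus
  be tested by normalising, and disjoint bases have disjoint cones.\<close>

definition open_cone :: "nat \<Rightarrow> (nat \<Rightarrow> real) set \<Rightarrow> (nat \<Rightarrow> real) set" where
  "open_cone n A = {dilate n r x |r x. x \<in> A \<and> 0 < r \<and> r \<le> 1}"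

lemma measurable_lp_norm [measurable]: "lp_norm p n \<in> borel_measurable (leb n)"
  unfolding lp_norm_eq[abs_def] by measurable

lemma measurable_normalize_lp [measurable]: "normalize_lp p n \<in> measurable (leb n) (leb n)"
  unfolding normalize_lp_def[abs_def] dilate_def[abs_def] by (intro measurable_leb_I) measurable

lemma lp_norm_dilate: "0 < t \<Longrightarrow> 0 < p \<Longrightarrow> lp_norm p n (dilate n t x) = t * lp_norm p n x"
  by (simp add: lp_norm_eq powr_sum_dilate powr_mult powr_sum_nonneg powr_powr)

lemma dilate_space [simp]: "dilate n t x \<in> space (leb n)"
  by (simp add: dilate_def space_leb)

lemma dilate_dilate: "dilate n s (dilate n t x) = dilate n (s * t) x"
  by (auto simp: dilate_def fun_eq_iff mult.assoc)

lemma dilate_1: "x \<in> space (leb n) \<Longrightarrow> dilate n 1 x = x"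
  by (auto simp: dilate_def fun_eq_iff space_leb PiE_def extensional_def)

lemma normalize_lp_dilate:
  assumes "lp_norm p n x = 1" "x \<in> space (leb n)" "0 < t" "0 < p"
  shows "normalize_lp p n (dilate n t x) = x"
  using assms by (simp add: normalize_lp_def lp_norm_dilate dilate_dilate dilate_1)

lemma sets_lp_sphere [measurable]: "lp_sphere p n \<in> sets (leb n)"
  unfolding lp_sphere_def by measurable

lemma open_cone_eq:
  assumes "A \<subseteq> lp_sphere p n" "0 < p"
  shows "open_cone n A = {x \<in> space (leb n). normalize_lp p n x \<in> A \<and> 0 < lp_norm p n x \<and> lp_norm p n x \<le> 1}"
proof (intro set_eqI iffI)
  fix x assume "x \<in> open_cone n A"
  then obtain r y where x: "x = dilate n r y" "y \<in> A" "0 < r" "r \<le> 1" by (auto simp: open_cone_def)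
  then have "lp_norm p n y = 1" "y \<in> space (leb n)" using assms by (auto simp: lp_sphere_def)
  then show "x \<in> {x \<in> space (leb n). normalize_lp p n x \<in> A \<and> 0 < lp_norm p n x \<and> lp_norm p n x \<le> 1}"
    using x assms by (simp add: normalize_lp_dilate lp_norm_dilate)
next
  fix x assume x: "x \<in> {x \<in> space (leb n). normalize_lp p n x \<in> A \<and> 0 < lp_norm p n x \<and> lp_norm p n x \<le> 1}"
  then have "x = dilate n (lp_norm p n x) (normalize_lp p n x)"
    by (simp add: normalize_lp_def dilate_dilate dilate_1)
  with x show "x \<in> open_cone n A" unfolding open_cone_def by blast
qed

lemma sets_open_cone:
  assumes "A \<in> sets (leb n)" "A \<subseteq> lp_sphere p n" "0 < p"
  shows "open_cone n A \<in> sets (leb n)"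
  unfolding open_cone_eq[OF assms(2,3)] using assms(1) by measurable

lemma emeasure_cone_over:
  assumes "A \<in> sets (leb n)" "A \<subseteq> lp_sphere p n" "0 < p" "0 < n"
  shows "emeasure (leb n) (cone_over n A) = emeasure (leb n) (open_cone n A)"
proof (cases "A = {}")
  case False
  \<comment> \<open>Only the apex is added: dilation by 0 gives the zero vector whatever its
    argument, so \<open>undefined\<close> is harmless.\<close>
  have "cone_over n A = open_cone n A \<union> {dilate n 0 undefined}"
  proof -
    have "dilate n 0 x = dilate n 0 undefined" for x by (simp add: dilate_def)
    then show ?thesis
      using False unfolding cone_over_def open_cone_def dilate_def[symmetric]
      by (auto simp: order_le_less) (metis order_le_less zero_le_one)+
  qed
  moreover have "{dilate n 0 undefined} \<in> null_sets (leb n)"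
  proof -
    have *: "{dilate n 0 undefined} = Pi\<^sub>E {..<n} (\<lambda>_. {0})"
      by (auto simp: dilate_def PiE_def extensional_def fun_eq_iff)
    have "emeasure (leb n) (Pi\<^sub>E {..<n} (\<lambda>_. {0})) = (\<Prod>i<n. emeasure lborel {0::real})"
      unfolding leb_def by (rule lborel_prod.emeasure_PiM) auto
    moreover have "Pi\<^sub>E {..<n} (\<lambda>_. {0}) \<in> sets (leb n)"
      unfolding leb_def by (rule sets_PiM_I_finite) auto
    ultimately show ?thesis using assms(4) unfolding * by (intro null_setsI) (simp_all only: emeasure_lborel_singleton prod_constant card_lessThan zero_power)
  qed
  ultimately show ?thesis
    using sets_open_cone[OF assms(1-3)] by (simp only: emeasure_Un_null_set)
qed (simp add: cone_over_def open_cone_def)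

section \<open>Surface measure and cone measure\<close>

text \<open>Central projection from the origin to the hyperplane where coordinate \<open>k\<close>
  is 1, with that coordinate dropped.\<close>

definition gnomonic :: "nat \<Rightarrow> (nat \<Rightarrow> real) \<Rightarrow> nat \<Rightarrow> real" where
  "gnomonic k x = (\<lambda>i\<in>{..<k}. x i / x k)"

lemma eucl_dist_triangle: "eucl_dist n x z \<le> eucl_dist n x y + eucl_dist n y z"
  using L2_set_triangle_ineq[of "\<lambda>i. x i - y i" "\<lambda>i. y i - z i" "{..<n}"] by (simp add: eucl_dist_def)

lemma eucl_dist_Suc_sq: "(eucl_dist (Suc k) x y)\<^sup>2 = (eucl_dist k x y)\<^sup>2 + (x k - y k)\<^sup>2"
  unfolding eucl_dist_sq dot_def by (simp add: power2_eq_square)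

lemma eucl_dist_mono_Suc: "eucl_dist k x y \<le> eucl_dist (Suc k) x y"
  by (rule power2_le_imp_le) (auto simp: eucl_dist_Suc_sq)

text \<open>If \<open>x\<close> and \<open>x'\<close> have nearly the same height, the projection is
  nearly division by that height. The term with \<open>b\<close> is the radial correction for the
  difference of heights; the further \<open>\<epsilon>\<close> in the lower bound is the loss from
  distance to horizontal distance.\<close>

lemma eucl_dist_gnomonic:
  fixes x x' :: "nat \<Rightarrow> real"
  assumes z: "0 < x k" "0 < x' k" and bound: "eucl_dist k x' (\<lambda>_. 0) \<le> b"
    and tangent: "\<bar>x k - x' k\<bar> \<le> \<epsilon> * eucl_dist (Suc k) x x'" and \<epsilon>: "0 \<le> \<epsilon>"
  shows "eucl_dist k (gnomonic k x) (gnomonic k x') \<le> (1 + b * \<epsilon> / x' k) / x k * eucl_dist (Suc k) x x'"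
    and "(1 - \<epsilon> - b * \<epsilon> / x' k) / x k * eucl_dist (Suc k) x x' \<le> eucl_dist k (gnomonic k x) (gnomonic k x')"
proof -
  let ?D = "eucl_dist (Suc k) x x'"
  \<comment> \<open>Intermediate point, \<open>x'\<close> divided by the height of \<open>x\<close>:
    from the first image to \<open>m\<close> there is an exact scaling, from \<open>m\<close> to the
    second image a radial shift.\<close>
  define m where "m = (\<lambda>i. x' i / x k)"
  have b: "0 \<le> b" using bound order_trans[OF eucl_dist_nonneg] by blast
  have d1: "eucl_dist k (gnomonic k x) m = 1 / x k * eucl_dist k x x'"
    by (rule eucl_dist_scale) (use z in \<open>auto simp: gnomonic_def m_def field_simps\<close>)
  have "eucl_dist k m (gnomonic k x') = \<bar>1 / x k - 1 / x' k\<bar> * eucl_dist k x' (\<lambda>_. 0)"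
  proof -
    have "eucl_dist k m (gnomonic k x') = L2_set (\<lambda>i. \<bar>(1 / x k - 1 / x' k) * x' i\<bar>) {..<k}"
      unfolding eucl_dist_def L2_set_def
      by (auto intro!: arg_cong[where f = sqrt] sum.cong simp: m_def gnomonic_def algebra_simps)
    also have "\<dots> = L2_set (\<lambda>i. \<bar>1 / x k - 1 / x' k\<bar> * (x' i - 0)) {..<k}"
      by (simp add: L2_set_def abs_mult power_mult_distrib)
    also have "\<dots> = \<bar>1 / x k - 1 / x' k\<bar> * eucl_dist k x' (\<lambda>_. 0)"
      unfolding eucl_dist_def by (rule L2_set_right_distrib[symmetric]) simp
    finally show ?thesis .
  qed
  also have "\<bar>1 / x k - 1 / x' k\<bar> = \<bar>x k - x' k\<bar> / (x k * x' k)"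
  proof -
    have "1 / x k - 1 / x' k = (x' k - x k) / (x k * x' k)" using z by (simp add: field_simps)
    then show ?thesis using z by (simp add: abs_minus_commute)
  qed
  also have "\<bar>x k - x' k\<bar> / (x k * x' k) * eucl_dist k x' (\<lambda>_. 0) \<le> \<epsilon> * ?D / (x k * x' k) * b"
    using z tangent bound b \<epsilon> by (intro mult_mono divide_right_mono) auto
  also have "\<dots> = b * \<epsilon> / x' k / x k * ?D" by (simp add: mult_ac)
  finally have d2: "eucl_dist k m (gnomonic k x') \<le> b * \<epsilon> / x' k / x k * ?D" .
  have "eucl_dist k (gnomonic k x) (gnomonic k x') \<le> 1 / x k * eucl_dist k x x' + b * \<epsilon> / x' k / x k * ?D"
    using eucl_dist_triangle[of k "gnomonic k x" "gnomonic k x'" m] d1 d2 by simp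
  also have "\<dots> \<le> 1 / x k * ?D + b * \<epsilon> / x' k / x k * ?D"
    using z by (intro add_right_mono mult_left_mono eucl_dist_mono_Suc) auto
  finally show "eucl_dist k (gnomonic k x) (gnomonic k x') \<le> (1 + b * \<epsilon> / x' k) / x k * ?D"
    by (simp add: add_divide_distrib distrib_right)
  have comm: "eucl_dist k x y = eucl_dist k y x" for x y
    by (simp add: eucl_dist_def L2_set_def power2_commute)
  \<comment> \<open>Pythagoras: a height difference of at most \<open>\<epsilon> * ?D\<close> leaves
    at least the fraction \<open>1 - \<epsilon>\<close> in horizontal direction. For
    \<open>\<epsilon> > 1\<close> the left side is nonpositive.\<close>
  have "(1 - \<epsilon>) * ?D \<le> eucl_dist k x x'"
  proof (cases "\<epsilon> \<le> 1")
    case True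
    have "(x k - x' k)\<^sup>2 \<le> (\<epsilon> * ?D)\<^sup>2"
      using tangent by (metis abs_ge_zero order_trans power2_abs power_mono)
    then have "(1 - \<epsilon>\<^sup>2) * ?D\<^sup>2 \<le> (eucl_dist k x x')\<^sup>2"
      using eucl_dist_Suc_sq[of k x x'] by (simp add: power_mult_distrib algebra_simps)
    moreover have "((1 - \<epsilon>) * ?D)\<^sup>2 \<le> (1 - \<epsilon>\<^sup>2) * ?D\<^sup>2"
    proof -
      have "\<epsilon> * \<epsilon> \<le> \<epsilon> * 1" using True \<epsilon> by (intro mult_left_mono) auto
      then have "(1 - \<epsilon>)\<^sup>2 \<le> 1 - \<epsilon>\<^sup>2" by (simp add: power2_eq_square algebra_simps)
      then show ?thesis unfolding power_mult_distrib by (intro mult_right_mono) auto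
    qed
    ultimately have "((1 - \<epsilon>) * ?D)\<^sup>2 \<le> (eucl_dist k x x')\<^sup>2" by linarith
    then show ?thesis by (rule power2_le_imp_le) simp
  next
    case False
    then have "(1 - \<epsilon>) * ?D \<le> 0" by (intro mult_nonpos_nonneg) auto
    then show ?thesis using eucl_dist_nonneg[of k x x'] by linarith
  qed
  then have "1 / x k * ((1 - \<epsilon>) * ?D) \<le> eucl_dist k (gnomonic k x) m"
    unfolding d1 using z by (intro mult_left_mono) auto
  also have "\<dots> \<le> eucl_dist k (gnomonic k x) (gnomonic k x') + b * \<epsilon> / x' k / x k * ?D"
    using eucl_dist_triangle[of k "gnomonic k x" m "gnomonic k x'"] d2 comm[of "gnomonic k x'" m] by simp
  finally show "(1 - \<epsilon> - b * \<epsilon> / x' k) / x k * ?D \<le> eucl_dist k (gnomonic k x) (gnomonic k x')"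
    by (simp add: diff_divide_distrib left_diff_distrib)
qed

text \<open>The slice of the cone at height \<open>t \<le> lo\<close> is the dilate by \<open>t\<close> of the gnomonic image, and every slice is
  contained in that dilate.\<close>
lemma emeasure_open_cone_graph:
  fixes A :: "(nat \<Rightarrow> real) set"
  assumes C: "open_cone (Suc k) A \<in> sets (leb (Suc k))" and A: "A \<subseteq> space (leb (Suc k))"
    and W: "gnomonic k ` A \<in> sets (leb k)"
    and h: "0 < lo" "\<And>x. x \<in> A \<Longrightarrow> lo \<le> x k" "\<And>x. x \<in> A \<Longrightarrow> x k \<le> hi" "0 \<le> hi"
  shows "ennreal (lo ^ Suc k / real (Suc k)) * emeasure (leb k) (gnomonic k ` A) \<le> emeasure (leb (Suc k)) (open_cone (Suc k) A)"
    and "emeasure (leb (Suc k)) (open_cone (Suc k) A) \<le> ennreal (hi ^ Suc k / real (Suc k)) * emeasure (leb k) (gnomonic k ` A)"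
proof -
  let ?W = "gnomonic k ` A" and ?C = "open_cone (Suc k) A"
  \<comment> \<open>\<open>S t\<close> is the slice of the cone at height \<open>t\<close> and
    \<open>V t\<close> the dilate by \<open>t\<close> of the projected base. They differ because a
    ray reaches height \<open>t\<close> inside the cone only if its base point is at least that
    high.\<close>
  define S where "S = (\<lambda>t. {y \<in> space (leb k). y(k := t) \<in> ?C})"
  define V where "V = (\<lambda>t. {y \<in> space (leb k). dilate k (1 / t) y \<in> ?W})"
  have V_sets: "V t \<in> sets (leb k)" for t unfolding V_def using W by measurable
  have V_emeasure: "emeasure (leb k) (V t) = ennreal (t ^ k) * emeasure (leb k) ?W" if t: "0 < t" for t
  proof -
    have "emeasure (leb k) (V t) = (\<integral>\<^sup>+y. indicator (V t) y \<partial>leb k)" using V_sets by simp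
    also have "\<dots> = ennreal (t ^ k) * (\<integral>\<^sup>+y. indicator (V t) (dilate k t y) \<partial>leb k)"
      using t V_sets by (intro nn_integral_leb_dilate) auto
    also have "(\<integral>\<^sup>+y. indicator (V t) (dilate k t y) \<partial>leb k) = (\<integral>\<^sup>+y. indicator ?W y \<partial>leb k)"
      using t by (intro nn_integral_cong) (simp add: V_def indicator_def dilate_dilate dilate_1)
    finally show ?thesis using W by simp
  qed
  have S_iff: "y \<in> S t \<longleftrightarrow> y \<in> V t \<and> (\<exists>x\<in>A. gnomonic k x = dilate k (1 / t) y \<and> t \<le> x k)"
    if t: "0 < t" and y: "y \<in> space (leb k)" for t y
  proof
    assume "y \<in> S t"
    then obtain r x where x: "y(k := t) = dilate (Suc k) r x" "x \<in> A" "0 < r" "r \<le> 1"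
      by (auto simp: S_def open_cone_def)
    have tk: "t = r * x k" using fun_cong[OF x(1), of k] by (simp add: dilate_def)
    have yi: "y i = r * x i" if "i < k" for i
      using fun_cong[OF x(1), of i] that by (simp add: dilate_def)
    have "0 < x k" using h(1) h(2)[OF x(2)] by linarith
    then have "gnomonic k x = dilate k (1 / t) y"
      using x(3) t by (auto simp: gnomonic_def dilate_def fun_eq_iff yi tk)
    moreover have "t \<le> x k" using tk x(4) \<open>0 < x k\<close> by (simp add: mult_le_cancel_right1)
    ultimately show "y \<in> V t \<and> (\<exists>x\<in>A. gnomonic k x = dilate k (1 / t) y \<and> t \<le> x k)"
      using x(2) y unfolding V_def by (auto intro: image_eqI[of _ _ x])
  next
    assume "y \<in> V t \<and> (\<exists>x\<in>A. gnomonic k x = dilate k (1 / t) y \<and> t \<le> x k)"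
    then obtain x where x: "x \<in> A" "gnomonic k x = dilate k (1 / t) y" "t \<le> x k" by auto
    have xk: "0 < x k" using x t by simp
    have yi: "y i = t / x k * x i" if "i < k" for i
      using fun_cong[OF x(2), of i] that t xk by (simp add: gnomonic_def dilate_def field_simps)
    have "y(k := t) = dilate (Suc k) (t / x k) x"
      using y yi xk by (auto simp: fun_eq_iff dilate_def space_leb PiE_def extensional_def less_Suc_eq)
    then have "y(k := t) \<in> ?C" unfolding open_cone_def using x t xk by (intro CollectI exI[of _ "t / x k"] exI[of _ x]) auto
    then show "y \<in> S t" using y by (simp add: S_def)
  qed
  have S_neg: "S t = {}" if t: "t \<le> 0" for t
  proof -
    have False if y: "y \<in> S t" for y
    proof -
      obtain r x where x: "y(k := t) = dilate (Suc k) r x" "x \<in> A" "0 < r"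
        using y by (auto simp: S_def open_cone_def)
      have "t = r * x k" using fun_cong[OF x(1), of k] by (simp add: dilate_def)
      moreover have "0 < x k" using h(1) h(2)[OF x(2)] by linarith
      ultimately show False using x(3) t mult_pos_pos[of r "x k"] by linarith
    qed
    then show ?thesis by blast
  qed
  have lower: "V t \<subseteq> S t" if "0 < t" "t \<le> lo" for t
  proof
    fix y assume y: "y \<in> V t"
    then obtain x where "x \<in> A" "dilate k (1 / t) y = gnomonic k x" "y \<in> space (leb k)" by (auto simp: V_def)
    with y h(2)[of x] that show "y \<in> S t" by (subst S_iff) (auto intro: order_trans)
  qed
  have upper: "S t \<subseteq> (if 0 < t \<and> t \<le> hi then V t else {})" for t
  proof
    fix y assume y: "y \<in> S t"
    then have t: "0 < t" using S_neg[of t] by (cases "0 < t") auto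
    have "y \<in> space (leb k)" using y by (simp add: S_def)
    with y S_iff[OF t] h(3) t show "y \<in> (if 0 < t \<and> t \<le> hi then V t else {})"
      by (auto intro: order_trans)
  qed
  have upd[measurable]: "(\<lambda>x. x(k := t)) \<in> measurable (leb k) (leb (Suc k))" for t
    using measurable_compose[OF measurable_Pair1'[of t lborel "leb k"] measurable_leb_Suc_upd] by simp
  have S_sets: "S t \<in> sets (leb k)" for t
    unfolding S_def using C by measurable
  have C_eq: "emeasure (leb (Suc k)) ?C = (\<integral>\<^sup>+t. emeasure (leb k) (S t) \<partial>lborel)"
  proof -
    have "emeasure (leb (Suc k)) ?C = (\<integral>\<^sup>+x. indicator ?C x \<partial>leb (Suc k))" using C by simp
    also have "\<dots> = (\<integral>\<^sup>+t. (\<integral>\<^sup>+y. indicator ?C (y(k := t)) \<partial>leb k) \<partial>lborel)"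
      using C by (intro nn_integral_leb_Suc) auto
    also have "\<dots> = (\<integral>\<^sup>+t. (\<integral>\<^sup>+y. indicator (S t) y \<partial>leb k) \<partial>lborel)"
      by (intro nn_integral_cong) (simp add: S_def indicator_def)
    finally show ?thesis using S_sets by simp
  qed
  \<comment> \<open>The integral of t^k from 0 to h, written with the density of
    \<open>nn_integral_powr_Iic\<close>.\<close>
  have int: "(\<integral>\<^sup>+t. ennreal (indicator {0<..} t * (real (Suc k) * t powr (real (Suc k) - 1))) * indicator {..h} t * ennreal (1 / real (Suc k)) * emeasure (leb k) ?W \<partial>lborel)
      = ennreal (h ^ Suc k / real (Suc k)) * emeasure (leb k) ?W" if h: "0 \<le> h" for h
  proof -
    have "(\<integral>\<^sup>+t. ennreal (indicator {0<..} t * (real (Suc k) * t powr (real (Suc k) - 1))) * indicator {..h} t * ennreal (1 / real (Suc k)) * emeasure (leb k) ?W \<partial>lborel)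
      = ennreal (h powr real (Suc k)) * ennreal (1 / real (Suc k)) * emeasure (leb k) ?W"
      using nn_integral_powr_Iic[of "real (Suc k)" h] h by (simp add: nn_integral_multc del: of_nat_Suc)
    also have "ennreal (h powr real (Suc k)) * ennreal (1 / real (Suc k)) = ennreal (h ^ Suc k / real (Suc k))"
      using h by (simp add: ennreal_mult'[symmetric] powr_realpow' del: of_nat_Suc power_Suc)
    finally show ?thesis .
  qed
  have integrand: "ennreal (indicator {0<..} t * (real (Suc k) * t powr (real (Suc k) - 1))) * indicator {..h} t * ennreal (1 / real (Suc k)) * emeasure (leb k) ?W
      = (if 0 < t \<and> t \<le> h then emeasure (leb k) (V t) else 0)" for t h
  proof (cases "0 < t \<and> t \<le> h")
    case True
    then have "ennreal (real (Suc k) * t powr (real (Suc k) - 1)) * ennreal (1 / real (Suc k)) = ennreal (t ^ k)"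
      by (subst ennreal_mult'[symmetric]) (auto simp: powr_realpow)
    then show ?thesis using True V_emeasure[of t] by simp
  qed auto
  show "ennreal (lo ^ Suc k / real (Suc k)) * emeasure (leb k) ?W \<le> emeasure (leb (Suc k)) ?C"
    unfolding int[OF less_imp_le[OF h(1)], symmetric] C_eq integrand
  proof (intro nn_integral_mono)
    fix t
    have "emeasure (leb k) (V t) \<le> emeasure (leb k) (S t)" if "0 < t" "t \<le> lo"
      using lower[OF that] S_sets by (rule emeasure_mono)
    then show "(if 0 < t \<and> t \<le> lo then emeasure (leb k) (V t) else 0) \<le> emeasure (leb k) (S t)" by auto
  qed
  show "emeasure (leb (Suc k)) ?C \<le> ennreal (hi ^ Suc k / real (Suc k)) * emeasure (leb k) ?W"
    unfolding int[OF h(4), symmetric] C_eq integrand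
  proof (intro nn_integral_mono)
    fix t
    have "emeasure (leb k) (S t) \<le> emeasure (leb k) (if 0 < t \<and> t \<le> hi then V t else {})"
      using V_sets by (intro emeasure_mono upper) auto
    then show "emeasure (leb k) (S t) \<le> (if 0 < t \<and> t \<le> hi then emeasure (leb k) (V t) else 0)" by (simp split: if_splits)
  qed
qed

lemma ennreal_mult_le_imp_le:
  assumes "0 < a" "ennreal a * x \<le> y" shows "x \<le> ennreal (1 / a) * y"
proof -
  have "ennreal (1 / a) * ennreal a = 1"
    using assms(1) by (subst ennreal_mult'[symmetric]) auto
  then have "x = ennreal (1 / a) * (ennreal a * x)" by (simp add: mult.assoc[symmetric])
  also have "\<dots> \<le> ennreal (1 / a) * y" using assms(2) by (rule mult_left_mono) simp
  finally show ?thesis .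
qed

lemma eucl_dist_cong:
  "(\<And>i. i < n \<Longrightarrow> x i = x' i) \<Longrightarrow> (\<And>i. i < n \<Longrightarrow> y i = y' i) \<Longrightarrow> eucl_dist n x y = eucl_dist n x' y'"
  unfolding eucl_dist_def by (intro L2_set_cong) auto

lemma eucl_dist_eq_0:
  assumes "eucl_dist n x y = 0" "x \<in> space (leb n)" "y \<in> space (leb n)" shows "x = y"
proof
  fix i show "x i = y i"
    using assms abs_le_eucl_dist[of i n x y]
    by (cases "i < n") (auto simp: space_leb PiE_def extensional_def)
qed

lemma eucl_dist_commute: "eucl_dist n x y = eucl_dist n y x"
  by (simp add: eucl_dist_def L2_set_def power2_commute)

text \<open>Bernoulli's inequality gives the first bound, with \<open>\<eta>\<close> chosen so that
  2 n factors lose at most one half; the second follows since the product of the two powers is at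
  most 1.\<close>

lemma one_plus_minus_power_bounds:
  fixes \<eta> :: real
  assumes "0 < n" "\<eta> = 1 / (4 * real n)" "m \<le> 2 * n"
  shows "1 / 2 \<le> (1 - \<eta>) ^ m" "(1 + \<eta>) ^ m \<le> 2"
proof -
  have \<eta>: "0 < \<eta>" "\<eta> \<le> 1 / 4" using assms(1) unfolding assms(2) by (auto simp: divide_simps)
  have "1 / 2 \<le> 1 + real (2 * n) * (- \<eta>)" using assms by simp
  also have "\<dots> \<le> (1 + - \<eta>) ^ (2 * n)" using \<eta> by (intro Bernoulli_inequality) auto
  also have "\<dots> \<le> (1 - \<eta>) ^ m" using \<eta> assms(3) by (simp add: power_decreasing)
  finally show *: "1 / 2 \<le> (1 - \<eta>) ^ m" .
  have "(1 + \<eta>) ^ m * (1 / 2) \<le> (1 + \<eta>) ^ m * (1 - \<eta>) ^ m"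
    using * \<eta> by (intro mult_left_mono) auto
  also have "\<dots> = (1 - \<eta> * \<eta>) ^ m" by (simp add: power_mult_distrib[symmetric] algebra_simps)
  also have "\<dots> \<le> 1" using \<eta> by (intro power_le_one) (auto simp: mult_le_one)
  finally show "(1 + \<eta>) ^ m \<le> 2" by simp
qed

text \<open>The k-th power of a Lipschitz constant against a cone volume of order k + 1 leaves one
  factor \<open>h\<close>, while the error factor \<open>b\<close> accumulates to the power 2 k +
  1.\<close>

lemma similarity_power_identities:
  fixes h b N :: real
  assumes "0 < h" "0 < b" "0 < N"
  shows "(h / b) ^ k * (1 / ((h * b) ^ Suc k / N)) = N / (h * b ^ (Suc k + k))"
    "(h * b) ^ Suc k / N * (b / h) ^ k = h / N * b ^ (Suc k + k)"
proof -
  have "h ^ k > 0" "b ^ k > 0" using assms by auto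
  then show "(h / b) ^ k * (1 / ((h * b) ^ Suc k / N)) = N / (h * b ^ (Suc k + k))"
    "(h * b) ^ Suc k / N * (b / h) ^ k = h / N * b ^ (Suc k + k)"
    using assms by (simp_all add: power_divide power_mult_distrib power_add field_simps)
qed

text \<open>On a piece of the sphere which deviates little from a hyperplane with normal \<open>u\<close>, the gnomonic projection
  along \<open>u\<close> is almost a similarity of ratio \<open>1/h\<close>. It therefore transports Hausdorff measure to a multiple of
  Lebesgue measure, which in turn determines the volume of the cone.\<close>
lemma haus_flat_piece_bounds:
  fixes n k :: nat and A :: "(nat \<Rightarrow> real) set"
  assumes n: "n = Suc k" and p: "0 < p"
    and A: "A \<in> sets (leb n)" "A \<subseteq> lp_sphere p n"
    and u: "dot n u u = 1"
    and \<epsilon>: "0 \<le> \<epsilon>" "64 * real n ^ 3 * \<epsilon> \<le> 1"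
    and tangent: "\<And>x y. x \<in> A \<Longrightarrow> y \<in> A \<Longrightarrow> \<bar>dot n u x - dot n u y\<bar> \<le> \<epsilon> * eucl_dist n x y"
    and x0: "x0 \<in> A" "1 / real n \<le> dot n u x0" "dot n u x0 \<le> real n"
    and bound: "\<And>x. x \<in> A \<Longrightarrow> eucl_dist n x (\<lambda>_. 0) \<le> real n"
  shows "haus n k A \<le> ennreal (2 * real n ^ 2) * (cube_haus k * emeasure (leb n) (open_cone n A))"
    and "cube_haus k * emeasure (leb n) (open_cone n A) \<le> 2 * haus n k A"
proof -
  \<comment> \<open>The relative error allowed per dimension: \<open>n + k \<le> 2 * n\<close> such
    factors change the result by at most 2.\<close>
  define \<eta> where "\<eta> = 1 / (4 * real n)"
  define h where "h = dot n u x0"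
  \<comment> \<open>An isometry taking \<open>u\<close> to the last basis vector, so that the height
    \<open>dot n u x\<close> becomes the coordinate by which \<open>gnomonic\<close>
    divides.\<close>
  define R where "R = reflection n (\<lambda>i. u i - (if i = k then 1 else 0))"
  have n1: "1 \<le> real n" using n by simp
  have \<eta>: "0 < \<eta>" "\<eta> \<le> 1 / 4" using n1 by (auto simp: \<eta>_def field_simps)
  have h: "0 < h" "1 / real n \<le> h" "h \<le> real n" using x0 n1 by (auto simp: h_def intro: less_le_trans[of 0 "1 / real n"])
  \<comment> \<open>The origin of 64 n^3: the projection error is of size
    \<open>2 * n ^ 2 * \<epsilon>\<close>, and \<open>\<eta> / 8\<close> is
    \<open>1 / (32 * n)\<close>.\<close>
  have \<epsilon>n: "2 * real n ^ 2 * \<epsilon> \<le> \<eta> / 8" "\<epsilon> \<le> \<eta> / 8"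
  proof -
    have "64 * (real n ^ 2 * \<epsilon>) * real n \<le> 1"
      using \<epsilon>(2) by (simp add: power3_eq_cube power2_eq_square mult_ac)
    then have "64 * (real n ^ 2 * \<epsilon>) \<le> 1 / real n" using n1 by (simp add: pos_le_divide_eq)
    then show *: "2 * real n ^ 2 * \<epsilon> \<le> \<eta> / 8" by (simp add: \<eta>_def)
    have "1 * \<epsilon> \<le> 2 * real n ^ 2 * \<epsilon>" using one_le_power[OF n1, of 2] \<epsilon>(1) by (intro mult_right_mono) auto
    then show "\<epsilon> \<le> \<eta> / 8" using * by simp
  qed
  have A_space: "A \<subseteq> space (leb n)" using A(1) by (rule sets.sets_into_space)
  have R_last: "R x k = dot n u x" for x
    using reflection_last[of k u x] u unfolding R_def n by simp
  have R_R: "R (R x) = x" if "x \<in> space (leb n)" for x using that by (simp add: R_def reflection_reflection)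
  have R_dist: "eucl_dist n (R x) (R y) = eucl_dist n x y" for x y by (simp add: R_def eucl_dist_reflection)
  have R_space: "R x \<in> space (leb n)" for x by (simp add: R_def)
  have R_dilate: "R (dilate n r x) = dilate n r (R x)" for r x by (simp add: R_def reflection_dilate)
  have R_meas[measurable]: "R \<in> measurable (leb n) (leb n)" by (simp add: R_def)
  have R_zero: "R (\<lambda>_. 0) i = 0" if "i < n" for i using that by (simp add: R_def reflection_def dot_def)
  define A' where "A' = R ` A"
  have A'_eq: "A' = {x \<in> space (leb n). R x \<in> A}"
    unfolding A'_def using A_space by (auto simp: R_R R_space image_iff) (metis R_R subsetD)+
  have A'_sets: "A' \<in> sets (leb n)" unfolding A'_eq using A(1) by measurable
  \<comment> \<open>Points of the piece are at distance at most 2 n, so heights differ by at most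
    \<open>2 * n * \<epsilon>\<close>, a small fraction of \<open>h \<ge> 1 / n\<close>.\<close>
  have last: "h * (1 - \<eta> / 4) \<le> x k" "x k \<le> h * (1 + \<eta> / 4)" if x: "x \<in> A'" for x
  proof -
    obtain a where a: "a \<in> A" "x = R a" using x by (auto simp: A'_def)
    have "\<bar>dot n u a - h\<bar> \<le> \<epsilon> * eucl_dist n a x0" unfolding h_def by (rule tangent[OF a(1) x0(1)])
    also have "eucl_dist n a x0 \<le> real n + real n"
      using eucl_dist_triangle[of n a x0 "\<lambda>_. 0"] bound[OF a(1)] bound[OF x0(1)]
      by (simp add: eucl_dist_commute[of n "\<lambda>_. 0"])
    also have "\<epsilon> * (real n + real n) = (2 * real n ^ 2 * \<epsilon>) * (1 / real n)"
      using n1 by (simp add: power2_eq_square)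
    also have "\<dots> \<le> \<eta> / 8 * h" using \<epsilon>n h \<epsilon>(1) \<eta> by (intro mult_mono) auto
    also have "\<dots> \<le> \<eta> / 4 * h" using \<eta> h by (intro mult_right_mono) auto
    finally have "\<bar>x k - h\<bar> \<le> \<eta> / 4 * h" using \<epsilon>(1) by (simp add: a R_last mult_left_mono)
    moreover have "h * (1 - \<eta> / 4) = h - \<eta> / 4 * h" by (subst right_diff_distrib) simp
    moreover have "h * (1 + \<eta> / 4) = h + \<eta> / 4 * h" by (subst distrib_left) simp
    ultimately have "h * (1 - \<eta> / 4) \<le> x k \<and> x k \<le> h * (1 + \<eta> / 4)" unfolding abs_le_iff by argo
    then show "h * (1 - \<eta> / 4) \<le> x k" "x k \<le> h * (1 + \<eta> / 4)" by blast+
  qed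
  have last_pos: "0 < x k" "1 / (2 * real n) \<le> x k" if "x \<in> A'" for x
  proof -
    have "1 / real n * (1 / 2) \<le> h * (1 - \<eta> / 4)" using h \<eta> n1 by (intro mult_mono) auto
    then show *: "1 / (2 * real n) \<le> x k" using last(1)[OF that] by simp
    have "0 < 1 / (2 * real n)" using n1 by simp
    then show "0 < x k" using * by linarith
  qed
  have lip: "eucl_dist k (gnomonic k x) (gnomonic k x') \<le> (1 + \<eta>) / h * eucl_dist n x x'"
    "(1 - \<eta>) / h * eucl_dist n x x' \<le> eucl_dist k (gnomonic k x) (gnomonic k x')"
    if x: "x \<in> A'" and x': "x' \<in> A'" for x x'
  proof -
    obtain a a' where a: "a \<in> A" "x = R a" "a' \<in> A" "x' = R a'" using x x' by (auto simp: A'_def)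
    have t: "\<bar>x k - x' k\<bar> \<le> \<epsilon> * eucl_dist (Suc k) x x'"
      using tangent[OF a(1,3)] unfolding a n[symmetric] R_last R_dist .
    have "eucl_dist k x' (\<lambda>_. 0) \<le> eucl_dist n x' (\<lambda>_. 0)" unfolding n by (rule eucl_dist_mono_Suc)
    also have "\<dots> = eucl_dist n (R a') (R (\<lambda>_. 0))" unfolding a by (rule eucl_dist_cong) (auto simp: R_zero)
    also have "\<dots> \<le> real n" unfolding R_dist by (rule bound[OF a(3)])
    finally have b: "eucl_dist k x' (\<lambda>_. 0) \<le> real n" .
    have frac: "real n * \<epsilon> / x' k \<le> \<eta> / 8"
    proof -
      have "real n * \<epsilon> / x' k \<le> real n * \<epsilon> / (1 / (2 * real n))"
        using last_pos[OF x'] \<epsilon>(1) n1 by (intro divide_left_mono) auto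
      also have "\<dots> = 2 * real n ^ 2 * \<epsilon>" by (simp add: power2_eq_square)
      also have "\<dots> \<le> \<eta> / 8" by (rule \<epsilon>n(1))
      finally show ?thesis .
    qed
    note zz = last_pos(1)[OF x] last_pos(1)[OF x']
    have D: "0 \<le> eucl_dist (Suc k) x x'" by simp
    have "(1 + real n * \<epsilon> / x' k) / x k \<le> (1 + \<eta> / 8) / (h * (1 - \<eta> / 4))"
      using frac last(1)[OF x] zz h \<eta> \<epsilon>(1) by (intro frac_le) auto
    also have "\<dots> \<le> (1 + \<eta>) / h"
    proof -
      have "\<eta> * \<eta> \<le> \<eta> * (1 / 4)" using \<eta> by (intro mult_left_mono) auto
      moreover have "(1 + \<eta>) * (1 - \<eta> / 4) = 1 + 3 / 4 * \<eta> - \<eta> * \<eta> / 4" by (simp add: field_simps)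
      ultimately have "1 + \<eta> / 8 \<le> (1 + \<eta>) * (1 - \<eta> / 4)" using \<eta>(1) by linarith
      then show ?thesis using h \<eta> by (simp add: divide_simps mult_ac)
    qed
    finally have "(1 + real n * \<epsilon> / x' k) / x k * eucl_dist (Suc k) x x' \<le> (1 + \<eta>) / h * eucl_dist (Suc k) x x'"
      by (rule mult_right_mono) simp
    then show "eucl_dist k (gnomonic k x) (gnomonic k x') \<le> (1 + \<eta>) / h * eucl_dist n x x'"
      using eucl_dist_gnomonic(1)[OF zz b t \<epsilon>(1)] unfolding n by linarith
    have "(1 - \<eta>) / h \<le> (1 - \<eta> / 4) / (h * (1 + \<eta> / 4))"
    proof -
      have "(1 - \<eta>) * (1 + \<eta> / 4) = 1 - 3 / 4 * \<eta> - \<eta> * \<eta> / 4" by (simp add: field_simps)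
      moreover have "0 \<le> \<eta> * \<eta>" by simp
      ultimately have "(1 - \<eta>) * (1 + \<eta> / 4) \<le> 1 - \<eta> / 4" using \<eta>(1) by linarith
      then show ?thesis using h \<eta> by (simp add: divide_simps mult_ac)
    qed
    also have "\<dots> \<le> (1 - \<epsilon> - real n * \<epsilon> / x' k) / x k"
    proof (rule frac_le[OF _ _ zz(1) last(2)[OF x]])
      show "1 - \<eta> / 4 \<le> 1 - \<epsilon> - real n * \<epsilon> / x' k" using frac \<epsilon>n(2) by linarith
      then show "0 \<le> 1 - \<epsilon> - real n * \<epsilon> / x' k" using \<eta>(2) by linarith
    qed
    finally have "(1 - \<eta>) / h * eucl_dist (Suc k) x x' \<le> (1 - \<epsilon> - real n * \<epsilon> / x' k) / x k * eucl_dist (Suc k) x x'"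
      by (rule mult_right_mono) simp
    then show "(1 - \<eta>) / h * eucl_dist n x x' \<le> eucl_dist k (gnomonic k x) (gnomonic k x')"
      using eucl_dist_gnomonic(2)[OF zz b t \<epsilon>(1)] unfolding n by linarith
  qed
  define W where "W = gnomonic k ` A'"
  \<comment> \<open>Images of measurable sets need not be measurable; \<open>W\<close> is therefore
    a preimage of \<open>A\<close>, under lifting to height 1, reflecting back and
    renormalising.\<close>
  have W_eq: "W = {y \<in> space (leb k). normalize_lp p n (R (y(k := 1))) \<in> A}"
  proof (intro set_eqI iffI)
    fix y assume "y \<in> W"
    then obtain x where x: "x \<in> A'" "y = gnomonic k x" by (auto simp: W_def)
    then obtain a where a: "a \<in> A" "x = R a" by (auto simp: A'_def)
    have "y(k := 1) = dilate n (1 / x k) x"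
      using last_pos[OF x(1)] unfolding x(2) n
      by (auto simp: gnomonic_def dilate_def fun_eq_iff)
    then have "R (y(k := 1)) = dilate n (1 / x k) a"
      using A_space a by (simp add: R_dilate R_R subset_eq)
    then have "normalize_lp p n (R (y(k := 1))) = a"
      using a A last_pos[OF x(1)] p by (auto simp: lp_sphere_def intro!: normalize_lp_dilate)
    then show "y \<in> {y \<in> space (leb k). normalize_lp p n (R (y(k := 1))) \<in> A}"
      using a x by (auto simp: gnomonic_def space_leb)
  next
    fix y assume y: "y \<in> {y \<in> space (leb k). normalize_lp p n (R (y(k := 1))) \<in> A}"
    define a where "a = normalize_lp p n (R (y(k := 1)))"
    define c where "c = 1 / lp_norm p n (R (y(k := 1)))"
    have a: "a \<in> A" using y by (simp add: a_def)
    have "y(k := 1) \<in> space (leb n)"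
      using y by (auto simp: n space_leb PiE_def extensional_def)
    then have Ra: "R a = dilate n c (y(k := 1))"
      unfolding a_def normalize_lp_def c_def[symmetric] R_dilate by (simp add: R_R)
    have RaA: "R a \<in> A'" using a by (simp add: A'_def)
    have "c = R a k" unfolding Ra by (simp add: dilate_def n)
    then have c: "0 < c" using last_pos[OF RaA] by simp
    have "y = gnomonic k (R a)"
      unfolding Ra using c y by (auto simp: gnomonic_def dilate_def n fun_eq_iff space_leb PiE_def extensional_def)
    then show "y \<in> W" using RaA by (auto simp: W_def)
  qed
  have [measurable]: "(\<lambda>x. x(k := 1)) \<in> measurable (leb k) (leb n)"
    using measurable_compose[OF measurable_Pair1'[of 1 lborel "leb k"] measurable_leb_Suc_upd] unfolding n by simp
  have W: "W \<in> sets (leb k)" unfolding W_eq using A(1) by measurable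
  have HW: "haus k k W = cube_haus k * emeasure (leb k) W" by (rule haus_eq_leb[OF W])
  have HA: "haus n k A' = haus n k A"
  proof (rule antisym)
    show "haus n k A' \<le> haus n k A"
      using hausdorff_measure_Lipschitz_image[of 1 A "eucl_dist n" R "eucl_dist n" k] by (simp add: R_dist A'_def)
    have "R ` A' = A" using A_space by (auto simp: A'_def R_R image_image subset_eq)
    then show "haus n k A \<le> haus n k A'"
      using hausdorff_measure_Lipschitz_image[of 1 A' "eucl_dist n" R "eucl_dist n" k] by (simp add: R_dist)
  qed
  have up: "haus k k W \<le> ennreal (((1 + \<eta>) / h) ^ k) * haus n k A"
    unfolding W_def HA[symmetric] using h \<eta> lip(1) by (intro hausdorff_measure_Lipschitz_image) auto
  have inj: "inj_on (gnomonic k) A'"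
  proof (rule inj_onI)
    fix x y assume xy: "x \<in> A'" "y \<in> A'" "gnomonic k x = gnomonic k y"
    then have "(1 - \<eta>) / h * eucl_dist n x y \<le> 0"
      using lip(2)[OF xy(1,2)] by (simp add: eucl_dist_def L2_set_def)
    moreover have "0 < (1 - \<eta>) / h" using h \<eta> by simp
    ultimately have "eucl_dist n x y = 0"
      using eucl_dist_nonneg[of n x y] mult_pos_pos[of "(1 - \<eta>) / h" "eucl_dist n x y"] by linarith
    then show "x = y" using xy by (intro eucl_dist_eq_0) (auto simp: A'_eq)
  qed
  \<comment> \<open>The lower distance bound makes the inverse of the projection Lipschitz.\<close>
  have down: "haus n k A \<le> ennreal ((h / (1 - \<eta>)) ^ k) * haus k k W"
  proof -
    have "haus n k (inv_into A' (gnomonic k) ` W) \<le> ennreal ((h / (1 - \<eta>)) ^ k) * haus k k W"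
    proof (rule hausdorff_measure_Lipschitz_image)
      show "0 < h / (1 - \<eta>)" using h \<eta> by simp
      fix y y' assume "y \<in> W" "y' \<in> W"
      then obtain x x' where x: "x \<in> A'" "y = gnomonic k x" "x' \<in> A'" "y' = gnomonic k x'" by (auto simp: W_def)
      have "eucl_dist n x x' \<le> h / (1 - \<eta>) * eucl_dist k y y'"
        using lip(2)[OF x(1,3)] h \<eta> unfolding x(2,4) by (simp add: field_simps)
      then show "eucl_dist n (inv_into A' (gnomonic k) y) (inv_into A' (gnomonic k) y') \<le> h / (1 - \<eta>) * eucl_dist k y y'"
        using x inj by simp
    qed
    moreover have "inv_into A' (gnomonic k) ` W = A'" unfolding W_def using inj by (rule inv_into_image_cancel) simp
    ultimately show ?thesis by (simp add: HA)
  qed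
  have C: "open_cone n A \<in> sets (leb n)" using A p by (rule sets_open_cone)
  have C'_eq: "open_cone n A' = {x \<in> space (leb n). R x \<in> open_cone n A}"
  proof (intro set_eqI iffI)
    fix x assume "x \<in> open_cone n A'"
    then obtain r a where x: "x = dilate n r (R a)" "a \<in> A" "0 < r" "r \<le> 1" by (auto simp: open_cone_def A'_def)
    then have "R x = dilate n r a" using A_space by (simp add: R_dilate R_R subset_eq)
    then show "x \<in> {x \<in> space (leb n). R x \<in> open_cone n A}" using x by (auto simp: open_cone_def)
  next
    fix x assume x: "x \<in> {x \<in> space (leb n). R x \<in> open_cone n A}"
    then obtain r a where ra: "R x = dilate n r a" "a \<in> A" "0 < r" "r \<le> 1" by (auto simp: open_cone_def)
    then have "x = dilate n r (R a)" using x R_R[of x] by (simp add: R_dilate)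
    then show "x \<in> open_cone n A'" using ra by (auto simp: open_cone_def A'_def)
  qed
  have C': "open_cone n A' \<in> sets (leb n)" unfolding C'_eq using C by measurable
  have mu: "emeasure (leb n) (open_cone n A') = emeasure (leb n) (open_cone n A)"
    unfolding C'_eq R_def using C n by (intro emeasure_leb_reflection) auto
  have h12: "h * (1 - \<eta>) \<le> x k" "x k \<le> h * (1 + \<eta>)" if "x \<in> A'" for x
  proof -
    have "h * (1 - \<eta>) \<le> h * (1 - \<eta> / 4)" "h * (1 + \<eta> / 4) \<le> h * (1 + \<eta>)"
      using h \<eta> by (auto intro!: mult_left_mono)
    then show "h * (1 - \<eta>) \<le> x k" "x k \<le> h * (1 + \<eta>)" using last[OF that] by linarith+
  qed
  have A's: "A' \<subseteq> space (leb (Suc k))" unfolding n[symmetric] A'_eq by auto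
  have h1pos: "0 < h * (1 - \<eta>)" using h \<eta> by simp
  have h2nn: "0 \<le> h * (1 + \<eta>)" using h \<eta> by simp
  have graph: "ennreal ((h * (1 - \<eta>)) ^ n / real n) * emeasure (leb k) W \<le> emeasure (leb n) (open_cone n A)"
    "emeasure (leb n) (open_cone n A) \<le> ennreal ((h * (1 + \<eta>)) ^ n / real n) * emeasure (leb k) W"
    unfolding mu[symmetric] unfolding W_def n
    by (rule emeasure_open_cone_graph[where A = A' and k = k and lo = "h * (1 - \<eta>)" and hi = "h * (1 + \<eta>)"];
        use C' A's W h1pos h2nn h12 in \<open>simp add: n W_def\<close>)+
  have powers: "1 / 2 \<le> (1 - \<eta>) ^ (n + k)" "(1 + \<eta>) ^ (n + k) \<le> 2"
    using one_plus_minus_power_bounds[of n \<eta> "n + k"] n by (auto simp: \<eta>_def)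
  define c where "c = cube_haus k"
  define \<mu> where "\<mu> = emeasure (leb n) (open_cone n A)"
  define L where "L = emeasure (leb k) W"
  define H where "H = haus n k A"
  have g1: "ennreal ((h * (1 - \<eta>)) ^ n / real n) * L \<le> \<mu>" and g2: "\<mu> \<le> ennreal ((h * (1 + \<eta>)) ^ n / real n) * L"
    using graph by (auto simp: \<mu>_def L_def)
  have w1: "c * L \<le> ennreal (((1 + \<eta>) / h) ^ k) * H" and w2: "H \<le> ennreal ((h / (1 - \<eta>)) ^ k) * (c * L)"
    using up down by (simp_all add: HW c_def L_def H_def)
  have "L \<le> ennreal (1 / ((h * (1 - \<eta>)) ^ n / real n)) * \<mu>"
    using h1pos n1 by (intro ennreal_mult_le_imp_le[OF _ g1]) auto
  then have "H \<le> ennreal ((h / (1 - \<eta>)) ^ k) * (c * (ennreal (1 / ((h * (1 - \<eta>)) ^ n / real n)) * \<mu>))"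
    by (intro order_trans[OF w2] mult_left_mono) auto
  also have "\<dots> = ennreal ((h / (1 - \<eta>)) ^ k * (1 / ((h * (1 - \<eta>)) ^ n / real n))) * (c * \<mu>)"
    using h \<eta> by (subst ennreal_mult') (auto simp: mult_ac)
  also have "\<dots> \<le> ennreal (2 * real n ^ 2) * (c * \<mu>)"
  proof (intro mult_right_mono ennreal_leI)
    have "(h / (1 - \<eta>)) ^ k * (1 / ((h * (1 - \<eta>)) ^ n / real n)) = real n / (h * (1 - \<eta>) ^ (n + k))"
      using similarity_power_identities(1)[of h "1 - \<eta>" "real n" k] h \<eta> n1 by (simp add: n)
    \<comment> \<open>The worst case \<open>h = 1 / n\<close> produces the factor
      \<open>2 * n ^ 2\<close>.\<close>
    also have "\<dots> \<le> real n / (1 / real n * (1 / 2))"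
      using h powers n1 by (intro divide_left_mono mult_mono mult_pos_pos) (use \<eta> in auto)
    also have "\<dots> = 2 * real n ^ 2" by (simp add: power2_eq_square)
    finally show "(h / (1 - \<eta>)) ^ k * (1 / ((h * (1 - \<eta>)) ^ n / real n)) \<le> 2 * real n ^ 2" .
  qed simp
  finally show "haus n k A \<le> ennreal (2 * real n ^ 2) * (cube_haus k * emeasure (leb n) (open_cone n A))"
    by (simp add: H_def c_def \<mu>_def)
  have "c * \<mu> \<le> c * (ennreal ((h * (1 + \<eta>)) ^ n / real n) * L)"
    by (intro mult_left_mono g2) simp
  also have "\<dots> = ennreal ((h * (1 + \<eta>)) ^ n / real n) * (c * L)" by (simp add: mult_ac)
  also have "\<dots> \<le> ennreal ((h * (1 + \<eta>)) ^ n / real n) * (ennreal (((1 + \<eta>) / h) ^ k) * H)"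
    by (intro mult_left_mono w1) simp
  also have "\<dots> = ennreal ((h * (1 + \<eta>)) ^ n / real n * ((1 + \<eta>) / h) ^ k) * H"
    using h \<eta> by (subst ennreal_mult') (auto simp: mult_ac)
  also have "\<dots> \<le> ennreal 2 * H"
  proof (intro mult_right_mono ennreal_leI)
    have "(h * (1 + \<eta>)) ^ n / real n * ((1 + \<eta>) / h) ^ k = h / real n * (1 + \<eta>) ^ (n + k)"
      using similarity_power_identities(2)[of h "1 + \<eta>" "real n" k] h \<eta> n1 by (simp add: n)
    \<comment> \<open>Here \<open>h \<le> n\<close> absorbs the division by
      \<open>n\<close>.\<close>
    also have "\<dots> \<le> 1 * 2" using h powers n1 \<eta> by (intro mult_mono) auto
    finally show "(h * (1 + \<eta>)) ^ n / real n * ((1 + \<eta>) / h) ^ k \<le> 2" by simp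
  qed simp
  finally show "cube_haus k * emeasure (leb n) (open_cone n A) \<le> 2 * haus n k A"
    by (simp add: H_def c_def \<mu>_def)
qed

text \<open>The derivative of \<open>t powr p\<close> on \<open>[0, \<infinity>)\<close>; for \<open>p = 1\<close> the formula \<open>p * t powr (p - 1)\<close>
  fails at 0 because \<open>0 powr 0 = 0\<close>.\<close>
definition powr_deriv :: "real \<Rightarrow> real \<Rightarrow> real" where
  "powr_deriv p t = (if p = 1 then 1 else p * t powr (p - 1))"

lemma continuous_on_powr_deriv:
  assumes "1 \<le> p" shows "continuous_on {0..} (powr_deriv p)"
proof (cases "p = 1")
  case False
  then have "continuous_on {0..} (\<lambda>t. p * t powr (p - 1))"
    using assms by (intro continuous_intros continuous_on_powr') auto
  with False show ?thesis by (simp add: powr_deriv_def[abs_def])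
qed (simp add: powr_deriv_def[abs_def])

lemma powr_deriv_mult: "0 \<le> t \<Longrightarrow> powr_deriv p t * t = p * t powr p"
proof (cases "t = 0")
  case False
  assume "0 \<le> t"
  with False have "t powr (p - 1) * t = t powr p"
    using powr_add[of t "p - 1" 1] by simp
  then show ?thesis using \<open>0 \<le> t\<close> by (simp add: powr_deriv_def mult.assoc)
qed simp

lemma powr_deriv_bounds: "1 \<le> p \<Longrightarrow> 0 \<le> t \<Longrightarrow> t \<le> 1 \<Longrightarrow> 0 \<le> powr_deriv p t \<and> powr_deriv p t \<le> p"
  using powr_le1[of "p - 1" t] by (auto simp: powr_deriv_def)

text \<open>Intermediate points are positive, so the classical derivative formula applies even if
  the interval starts at 0.\<close>

lemma powr_mean_value:
  assumes p: "1 \<le> p" and ab: "0 \<le> a" "a < b"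
  obtains z where "a < z" "z < b" "b powr p - a powr p = powr_deriv p z * (b - a)"
proof -
  have "\<exists>l z. a < z \<and> z < b \<and> ((\<lambda>t. t powr p) has_real_derivative l) (at z) \<and> b powr p - a powr p = (b - a) * l"
  proof (rule MVT)
    show "continuous_on {a..b} (\<lambda>t. t powr p)"
      using ab p by (intro continuous_on_powr' continuous_intros) auto
    fix z assume "a < z" "z < b"
    then have "((\<lambda>t. t powr p) has_real_derivative p * z powr (p - 1)) (at z)"
      using ab by (intro has_real_derivative_powr) auto
    then show "(\<lambda>t. t powr p) differentiable (at z)" by (auto simp: real_differentiable_def)
  qed (use ab in auto)
  then obtain l z where z: "a < z" "z < b" "((\<lambda>t. t powr p) has_real_derivative l) (at z)"
    "b powr p - a powr p = (b - a) * l" by blast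
  have z0: "0 < z" using z ab by simp
  have "((\<lambda>t. t powr p) has_real_derivative p * z powr (p - 1)) (at z)"
    using z0 by (intro has_real_derivative_powr)
  then have "l = p * z powr (p - 1)" using z(3) DERIV_unique by blast
  also have "\<dots> = powr_deriv p z" using z0 by (simp add: powr_deriv_def)
  finally show ?thesis using z by (intro that[of z]) auto
qed

text \<open>Uniform continuity of the derivative on [0, 1] controls the linearisation for every pair
  near \<open>t0\<close>, not only pairs containing \<open>t0\<close>, and one
  \<open>\<delta>\<close> serves all base points.\<close>

lemma powr_strictly_differentiable:
  assumes p: "1 \<le> p" and e: "0 < e"
  obtains \<delta> where "0 < \<delta>"
    "\<And>s t t0. \<lbrakk>s \<in> {0..1}; t \<in> {0..1}; t0 \<in> {0..1}; \<bar>s - t0\<bar> < \<delta>; \<bar>t - t0\<bar> < \<delta>\<rbrakk> \<Longrightarrow>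
      \<bar>s powr p - t powr p - powr_deriv p t0 * (s - t)\<bar> \<le> e * \<bar>s - t\<bar>"
proof -
  have "continuous_on {0..1} (powr_deriv p)"
    using continuous_on_powr_deriv[OF p] by (rule continuous_on_subset) auto
  then have "uniformly_continuous_on {0..1} (powr_deriv p)"
    by (rule compact_uniformly_continuous) simp
  then obtain \<delta> where \<delta>: "0 < \<delta>"
    "\<And>s t. s \<in> {0..1} \<Longrightarrow> t \<in> {0..1} \<Longrightarrow> \<bar>s - t\<bar> < \<delta> \<Longrightarrow> \<bar>powr_deriv p s - powr_deriv p t\<bar> < e"
    using e unfolding uniformly_continuous_on_def dist_real_def by meson
  have less: "\<bar>s powr p - t powr p - powr_deriv p t0 * (s - t)\<bar> \<le> e * \<bar>s - t\<bar>"
    if *: "s \<in> {0..1}" "t \<in> {0..1}" "t0 \<in> {0..1}" "\<bar>s - t0\<bar> < \<delta>" "\<bar>t - t0\<bar> < \<delta>" "t < s" for s t t0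
  proof -
    obtain z where z: "t < z" "z < s" "s powr p - t powr p = powr_deriv p z * (s - t)"
      using powr_mean_value[OF p, of t s] * by auto
    have "\<bar>powr_deriv p z - powr_deriv p t0\<bar> < e"
      using z * by (intro \<delta>(2)) auto
    then have "\<bar>(powr_deriv p z - powr_deriv p t0) * (s - t)\<bar> \<le> e * \<bar>s - t\<bar>"
      unfolding abs_mult by (intro mult_right_mono) auto
    then show ?thesis unfolding z(3) by (simp add: left_diff_distrib)
  qed
  have "\<bar>s powr p - t powr p - powr_deriv p t0 * (s - t)\<bar> \<le> e * \<bar>s - t\<bar>"
    if *: "s \<in> {0..1}" "t \<in> {0..1}" "t0 \<in> {0..1}" "\<bar>s - t0\<bar> < \<delta>" "\<bar>t - t0\<bar> < \<delta>" for s t t0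
  proof -
    consider "t < s" | "s < t" | "s = t" by linarith
    then show ?thesis
    proof cases
      case 2
      have "s powr p - t powr p - powr_deriv p t0 * (s - t) = - (t powr p - s powr p - powr_deriv p t0 * (t - s))"
        by (simp add: algebra_simps)
      then show ?thesis using less[OF *(2,1,3,5,4) 2] by (simp add: abs_minus_commute)
    qed (use less * in auto)
  qed
  with \<delta>(1) show ?thesis by (rule that)
qed

lemma lp_sphereD:
  assumes "x \<in> lp_sphere p n" "0 < p"
  shows "x \<in> space (leb n)" "powr_sum p n x = 1" "i < n \<Longrightarrow> \<bar>x i\<bar> \<le> 1"
proof -
  show "x \<in> space (leb n)" using assms by (simp add: lp_sphere_def)
  have "powr_sum p n x powr (1 / p) = 1" using assms by (simp add: lp_sphere_def lp_norm_eq)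
  then have "(powr_sum p n x powr (1 / p)) powr p = 1" by simp
  then show *: "powr_sum p n x = 1" using assms(2) powr_sum_nonneg[of p n x] by (simp add: powr_powr)
  assume i: "i < n"
  have "\<bar>x i\<bar> powr p \<le> powr_sum p n x"
    unfolding powr_sum_def using i by (intro member_le_sum) auto
  then have "\<not> 1 < \<bar>x i\<bar> powr p" using * by linarith
  then show "\<bar>x i\<bar> \<le> 1" using gr_one_powr[of "\<bar>x i\<bar>" p] assms by argo
qed

text \<open>The normal is the gradient of \<open>powr_sum\<close> at a base point. Grid cells do not
  cross coordinate hyperplanes, so on a piece each \<open>\<bar>x i\<bar>\<close> is linear and only
  the variation of \<open>powr_deriv\<close> remains.\<close>

lemma haus_small_piece_bounds:
  fixes p :: real
  assumes n: "n = Suc k" and p: "1 \<le> p"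
  obtains \<delta> where "0 < \<delta>"
    "\<And>A. \<lbrakk>A \<in> sets (leb n); A \<subseteq> lp_sphere p n;
      \<And>x y i. x \<in> A \<Longrightarrow> y \<in> A \<Longrightarrow> i < n \<Longrightarrow> \<lfloor>x i / \<delta>\<rfloor> = \<lfloor>y i / \<delta>\<rfloor>\<rbrakk> \<Longrightarrow>
      haus n k A \<le> ennreal (2 * real n ^ 2) * (cube_haus k * emeasure (leb n) (open_cone n A)) \<and>
      cube_haus k * emeasure (leb n) (open_cone n A) \<le> 2 * haus n k A"
proof -
  have p0: "0 < p" using p by simp
  have n1: "1 \<le> real n" using n by simp
  \<comment> \<open>Summing over n coordinates and dividing by \<open>\<gamma> \<ge> 1 / n\<close>
    costs n^2, which leaves the \<open>1 / (64 * n ^ 3)\<close> demanded by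
    \<open>haus_flat_piece_bounds\<close>.\<close>
  define e where "e = 1 / (64 * real n ^ 5)"
  have e: "0 < e" using n1 by (simp add: e_def)
  obtain \<delta> where \<delta>: "0 < \<delta>"
    "\<And>s t t0. \<lbrakk>s \<in> {0..1}; t \<in> {0..1}; t0 \<in> {0..1}; \<bar>s - t0\<bar> < \<delta>; \<bar>t - t0\<bar> < \<delta>\<rbrakk> \<Longrightarrow>
      \<bar>s powr p - t powr p - powr_deriv p t0 * (s - t)\<bar> \<le> e * \<bar>s - t\<bar>"
    using powr_strictly_differentiable[OF p e] by metis
  have "haus n k A \<le> ennreal (2 * real n ^ 2) * (cube_haus k * emeasure (leb n) (open_cone n A)) \<and>
      cube_haus k * emeasure (leb n) (open_cone n A) \<le> 2 * haus n k A"
    if A: "A \<in> sets (leb n)" "A \<subseteq> lp_sphere p n"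
      and cell: "\<And>x y i. x \<in> A \<Longrightarrow> y \<in> A \<Longrightarrow> i < n \<Longrightarrow> \<lfloor>x i / \<delta>\<rfloor> = \<lfloor>y i / \<delta>\<rfloor>" for A
  proof (cases "A = {}")
    case True
    then show ?thesis by (simp add: open_cone_def)
  next
    case False
    then obtain x0 where x0: "x0 \<in> A" by blast
    define \<sigma> where "\<sigma> = (\<lambda>i. if x0 i < 0 then - 1 else 1 :: real)"
    \<comment> \<open>The gradient of \<open>powr_sum\<close> at \<open>x0\<close>;
      \<open>\<gamma>\<close> is its length and \<open>u\<close> the unit normal.\<close>
    define g where "g = (\<lambda>i. \<sigma> i * powr_deriv p \<bar>x0 i\<bar>)"
    define \<gamma> where "\<gamma> = sqrt (dot n g g)"
    define u where "u = (\<lambda>i. g i / \<gamma>)"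
    have le1: "\<bar>x i\<bar> \<le> 1" if "x \<in> A" "i < n" for x i
      using lp_sphereD(3)[OF _ p0 that(2), of x] A(2) that by auto
    have abs_eq: "\<bar>x i\<bar> = \<sigma> i * x i" if "x \<in> A" "i < n" for x i
    proof -
      \<comment> \<open>0 is a cell boundary, so the index determines the sign, with 0 counted as
        positive.\<close>
      have "t < 0 \<longleftrightarrow> \<lfloor>t / \<delta>\<rfloor> < 0" for t using \<delta>(1) by (simp add: floor_less_iff divide_less_0_iff)
      then have "x i < 0 \<longleftrightarrow> x0 i < 0" using cell[OF that(1) x0 that(2)] by metis
      then show ?thesis by (auto simp: \<sigma>_def)
    qed
    have \<sigma>: "\<sigma> i * \<sigma> i = 1" "\<bar>\<sigma> i\<bar> = 1" for i by (auto simp: \<sigma>_def)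
    have close: "\<bar>x i - y i\<bar> < \<delta>" if "x \<in> A" "y \<in> A" "i < n" for x y i
    proof -
      have "\<lfloor>x i / \<delta>\<rfloor> = \<lfloor>y i / \<delta>\<rfloor>" using cell that by blast
      then have "\<bar>x i / \<delta> - y i / \<delta>\<bar> < 1" by linarith
      then have "\<bar>(x i - y i) / \<delta>\<bar> < 1" by (simp add: diff_divide_distrib)
      then show ?thesis using \<delta>(1) by (simp add: pos_divide_less_eq)
    qed
    \<comment> \<open>Euler's identity for a function homogeneous of degree \<open>p\<close>. With
      bounds on the length of \<open>g\<close> it bounds the height of \<open>x0\<close> from both
      sides.\<close>
    have gx0: "dot n g x0 = p"
    proof -
      have "dot n g x0 = (\<Sum>i<n. p * \<bar>x0 i\<bar> powr p)"
        unfolding dot_def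
      proof (intro sum.cong refl)
        fix i assume "i \<in> {..<n}"
        then have "g i * x0 i = powr_deriv p \<bar>x0 i\<bar> * \<bar>x0 i\<bar>"
          using abs_eq[OF x0, of i] by (simp add: g_def mult_ac)
        then show "g i * x0 i = p * \<bar>x0 i\<bar> powr p" by (simp add: powr_deriv_mult)
      qed
      also have "\<dots> = p * powr_sum p n x0" by (simp add: powr_sum_def sum_distrib_left)
      also have "\<dots> = p" using lp_sphereD(2)[OF _ p0, of x0] A(2) x0 by auto
      finally show ?thesis .
    qed
    have norm_le: "dot n x x \<le> real n" if "x \<in> A" for x
    proof -
      have "dot n x x \<le> (\<Sum>i<n. 1)"
        unfolding dot_def
      proof (rule sum_mono)
        fix i assume "i \<in> {..<n}"
        then have "\<bar>x i\<bar> * \<bar>x i\<bar> \<le> 1" using le1[OF that] by (intro mult_le_one) auto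
        then show "x i * x i \<le> 1" by simp
      qed
      then show ?thesis by simp
    qed
    have gg_le: "dot n g g \<le> real n * p\<^sup>2"
    proof -
      have "dot n g g \<le> (\<Sum>i<n. p\<^sup>2)"
        unfolding dot_def
      proof (rule sum_mono)
        fix i assume "i \<in> {..<n}"
        then have b: "0 \<le> powr_deriv p \<bar>x0 i\<bar>" "powr_deriv p \<bar>x0 i\<bar> \<le> p"
          using powr_deriv_bounds[OF p, of "\<bar>x0 i\<bar>"] le1[OF x0] by auto
        have "g i * g i = (powr_deriv p \<bar>x0 i\<bar>)\<^sup>2"
          using \<sigma>(1)[of i] by (simp add: g_def power2_eq_square algebra_simps)
        also have "\<dots> \<le> p\<^sup>2" using b by (intro power_mono)
        finally show "g i * g i \<le> p\<^sup>2" .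
      qed
      then show ?thesis by simp
    qed
    have \<gamma>2: "\<gamma>\<^sup>2 = dot n g g" by (simp add: \<gamma>_def dot_self_nonneg)
    \<comment> \<open>Cauchy-Schwarz in Euler's identity bounds the gradient from below.\<close>
    have p_le: "p\<^sup>2 \<le> \<gamma>\<^sup>2 * real n"
    proof -
      have "p\<^sup>2 \<le> dot n g g * dot n x0 x0" using dot_Cauchy[of n g x0] by (simp add: gx0)
      also have "\<dots> \<le> \<gamma>\<^sup>2 * real n" unfolding \<gamma>2 by (intro mult_left_mono norm_le x0 dot_self_nonneg)
      finally show ?thesis .
    qed
    have n_sq: "real n \<le> (real n)\<^sup>2" using n1 by (simp add: power2_eq_square)
    have \<gamma>_nonneg: "0 \<le> \<gamma>" by (simp add: \<gamma>_def dot_self_nonneg)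
    have p_le': "p \<le> \<gamma> * real n"
    proof (rule power2_le_imp_le)
      show "p\<^sup>2 \<le> (\<gamma> * real n)\<^sup>2"
        using p_le mult_left_mono[OF n_sq, of "\<gamma>\<^sup>2"] by (simp add: power_mult_distrib)
    qed (use \<gamma>_nonneg in simp)
    have \<gamma>: "0 < \<gamma>"
      using p_le' p0 \<gamma>_nonneg by (cases "\<gamma> = 0") auto
    have \<gamma>_le: "\<gamma> \<le> p * real n"
    proof (rule power2_le_imp_le)
      have "real n * p\<^sup>2 \<le> (real n)\<^sup>2 * p\<^sup>2" by (intro mult_right_mono n_sq) simp
      then show "\<gamma>\<^sup>2 \<le> (p * real n)\<^sup>2"
        using gg_le by (simp add: \<gamma>2 power_mult_distrib mult.commute)
    qed (use p0 in simp)
    have u_dot: "dot n u x = dot n g x / \<gamma>" for x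
      by (simp add: u_def dot_def sum_divide_distrib)
    have "dot n u u = dot n g u / \<gamma>" by (rule u_dot)
    also have "dot n g u = dot n u g" by (rule dot_commute)
    also have "\<dots> = dot n g g / \<gamma>" by (rule u_dot)
    finally have uu: "dot n u u = 1" using \<gamma> by (simp add: \<gamma>2[symmetric] power2_eq_square)
    define \<epsilon> where "\<epsilon> = 1 / (64 * real n ^ 3)"
    have \<epsilon>: "0 \<le> \<epsilon>" "64 * real n ^ 3 * \<epsilon> \<le> 1" using n1 by (auto simp: \<epsilon>_def)
    have tangent: "\<bar>dot n u x - dot n u y\<bar> \<le> \<epsilon> * eucl_dist n x y" if xy: "x \<in> A" "y \<in> A" for x y
    proof -
      \<comment> \<open>Both points lie on the sphere, so the height difference consists of
        linearisation errors only.\<close>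
      have s: "(\<Sum>i<n. \<bar>x i\<bar> powr p - \<bar>y i\<bar> powr p) = 0"
        using lp_sphereD(2)[OF subsetD[OF A(2) xy(1)] p0] lp_sphereD(2)[OF subsetD[OF A(2) xy(2)] p0]
        by (simp add: powr_sum_def sum_subtractf)
      have "dot n g x - dot n g y = (\<Sum>i<n. powr_deriv p \<bar>x0 i\<bar> * (\<bar>x i\<bar> - \<bar>y i\<bar>))"
        unfolding dot_diff_right unfolding dot_def
        by (intro sum.cong) (auto simp: g_def abs_eq xy algebra_simps)
      also have "\<dots> = - (\<Sum>i<n. \<bar>x i\<bar> powr p - \<bar>y i\<bar> powr p - powr_deriv p \<bar>x0 i\<bar> * (\<bar>x i\<bar> - \<bar>y i\<bar>))"
        using s by (simp add: sum_subtractf)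
      finally have "\<bar>dot n g x - dot n g y\<bar> \<le> (\<Sum>i<n. \<bar>\<bar>x i\<bar> powr p - \<bar>y i\<bar> powr p - powr_deriv p \<bar>x0 i\<bar> * (\<bar>x i\<bar> - \<bar>y i\<bar>)\<bar>)"
        by (simp only: abs_minus_cancel sum_abs)
      also have "\<dots> \<le> (\<Sum>i<n. e * eucl_dist n x y)"
      proof (rule sum_mono)
        fix i assume i: "i \<in> {..<n}"
        have d: "\<bar>\<bar>x i\<bar> - \<bar>y i\<bar>\<bar> \<le> \<bar>x i - y i\<bar>" by (rule abs_triangle_ineq3)
        have "\<bar>\<bar>x i\<bar> - \<bar>x0 i\<bar>\<bar> < \<delta>" "\<bar>\<bar>y i\<bar> - \<bar>x0 i\<bar>\<bar> < \<delta>"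
          using close[OF xy(1) x0, of i] close[OF xy(2) x0, of i] i
            abs_triangle_ineq3[of "x i" "x0 i"] abs_triangle_ineq3[of "y i" "x0 i"] by auto
        then have "\<bar>\<bar>x i\<bar> powr p - \<bar>y i\<bar> powr p - powr_deriv p \<bar>x0 i\<bar> * (\<bar>x i\<bar> - \<bar>y i\<bar>)\<bar> \<le> e * \<bar>\<bar>x i\<bar> - \<bar>y i\<bar>\<bar>"
          using le1[OF xy(1)] le1[OF xy(2)] le1[OF x0] i by (intro \<delta>(2)) auto
        also have "\<dots> \<le> e * eucl_dist n x y"
          using d abs_le_eucl_dist[of i n x y] i e by (intro mult_left_mono) auto
        finally show "\<bar>\<bar>x i\<bar> powr p - \<bar>y i\<bar> powr p - powr_deriv p \<bar>x0 i\<bar> * (\<bar>x i\<bar> - \<bar>y i\<bar>)\<bar> \<le> e * eucl_dist n x y" .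
      qed
      finally have "\<bar>dot n g x - dot n g y\<bar> \<le> real n * e * eucl_dist n x y" by simp
      then have "\<bar>dot n g x - dot n g y\<bar> / \<gamma> \<le> real n * e * eucl_dist n x y / \<gamma>"
        using \<gamma> by (intro divide_right_mono) auto
      also have "\<dots> \<le> real n * e * eucl_dist n x y / (1 / real n)"
      proof (rule divide_left_mono)
        have "1 \<le> \<gamma> * real n" using p_le' p by linarith
        then show "1 / real n \<le> \<gamma>" using n1 by (simp add: pos_divide_le_eq)
      qed (use n1 e \<gamma> in auto)
      also have "\<dots> = \<epsilon> * eucl_dist n x y"
        using n1 by (simp add: e_def \<epsilon>_def power_numeral_reduce)
      finally show ?thesis using \<gamma> by (simp add: u_dot diff_divide_distrib[symmetric])
    qed
    have h: "1 / real n \<le> dot n u x0" "dot n u x0 \<le> real n"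
      using p_le' \<gamma>_le \<gamma> n1 by (auto simp: u_dot gx0 divide_simps mult_ac)
    have bound: "eucl_dist n x (\<lambda>_. 0) \<le> real n" if "x \<in> A" for x
    proof (rule power2_le_imp_le)
      show "(eucl_dist n x (\<lambda>_. 0))\<^sup>2 \<le> (real n)\<^sup>2"
        using order_trans[OF norm_le[OF that] n_sq] by (simp add: eucl_dist_sq)
    qed simp
    show ?thesis
      using haus_flat_piece_bounds[OF n p0 A uu \<epsilon> tangent x0 h bound] by blast
  qed
  with \<delta>(1) show ?thesis by (rule that)
qed

section \<open>Transfer to the three distributions\<close>

text \<open>Normalising recovers the base point, so cones over disjoint pieces are disjoint.\<close>

lemma open_cone_sphere_partition:
  assumes "A \<subseteq> lp_sphere p n" "0 < p" "finite I" "disjoint_family_on Q I" "A \<subseteq> (\<Union>i\<in>I. Q i)"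
    and sets: "A \<in> sets (leb n)" "\<And>i. i \<in> I \<Longrightarrow> Q i \<in> sets (leb n)"
  shows "emeasure (leb n) (open_cone n A) = (\<Sum>i\<in>I. emeasure (leb n) (open_cone n (A \<inter> Q i)))"
proof -
  have sub: "A \<inter> Q i \<subseteq> lp_sphere p n" for i using assms(1) by blast
  have "open_cone n A = (\<Union>i\<in>I. open_cone n (A \<inter> Q i))"
  proof (intro set_eqI iffI)
    fix x assume "x \<in> open_cone n A"
    then obtain r y where x: "x = dilate n r y" "y \<in> A" "0 < r" "r \<le> 1" by (auto simp: open_cone_def)
    then obtain i where "i \<in> I" "y \<in> Q i" using assms(5) by auto
    with x show "x \<in> (\<Union>i\<in>I. open_cone n (A \<inter> Q i))" unfolding open_cone_def by blast
  qed (auto simp: open_cone_def)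
  moreover have "disjoint_family_on (\<lambda>i. open_cone n (A \<inter> Q i)) I"
    using assms(4) unfolding disjoint_family_on_def open_cone_eq[OF sub assms(2)] by auto
  ultimately show ?thesis
    using sets assms(3) by (subst sum_emeasure) (auto intro!: sets_open_cone[OF _ sub assms(2)])
qed

lemma normalize_lp_sphere:
  assumes "0 < lp_norm p n x" "0 < p" shows "normalize_lp p n x \<in> lp_sphere p n"
  using assms by (simp add: normalize_lp_def lp_sphere_def lp_norm_dilate)

definition scale_invariant :: "nat \<Rightarrow> (nat \<Rightarrow> real) set \<Rightarrow> bool" where
  "scale_invariant n E \<longleftrightarrow> (\<forall>x\<in>space (leb n). \<forall>t>0. dilate n t x \<in> E \<longleftrightarrow> x \<in> E)"

text \<open>A scale-invariant set meets the ball in the cone over its trace on the sphere, up to the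
  origin. This is why uniform and cone law agree on such sets.\<close>

lemma emeasure_open_cone_scale_invariant:
  assumes E: "E \<in> sets (leb n)" "scale_invariant n E" and n: "0 < n" and p: "0 < p"
  shows "emeasure (leb n) (open_cone n (E \<inter> lp_sphere p n)) = emeasure (leb n) (lp_ball p n \<inter> E)"
proof (rule emeasure_eq_AE)
  show "open_cone n (E \<inter> lp_sphere p n) \<in> sets (leb n)"
    using E p by (intro sets_open_cone[of _ _ p]) auto
  show "lp_ball p n \<inter> E \<in> sets (leb n)" using E by auto
  show "AE x in leb n. x \<in> open_cone n (E \<inter> lp_sphere p n) \<longleftrightarrow> x \<in> lp_ball p n \<inter> E"
    using AE_leb_coordinates_nonzero[of n] AE_space
  proof eventually_elim
    case (elim x)
    have N: "0 < lp_norm p n x" using elim n powr_sum_pos[of 0 n x p] by (simp add: lp_norm_eq)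
    have "normalize_lp p n x \<in> E \<longleftrightarrow> x \<in> E"
      using E(2) elim N by (simp add: scale_invariant_def normalize_lp_def)
    then show ?case
      using N p elim normalize_lp_sphere[OF N p]
      by (subst open_cone_eq[of _ p]) (auto simp: lp_ball_def)
  qed
qed

lemma measure_unif_ball_eq:
  assumes "E \<in> sets (leb n)" "0 < n" "0 < p"
  shows "measure (unif_ball p n) E = measure (leb n) (lp_ball p n \<inter> E) / measure (leb n) (lp_ball p n)"
  unfolding unif_ball_def
  using emeasure_lp_ball_pos[of n p] emeasure_lp_ball_finite[of p n] assms
  by (subst measure_uniform_measure) auto

lemma cone_prob_scale_invariant:
  assumes E: "E \<in> sets (leb n)" "scale_invariant n E" and n: "0 < n" and p: "0 < p"
  shows "cone_prob p n (E \<inter> lp_sphere p n) = emeasure (unif_ball p n) E"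
proof -
  have "cone_prob p n (E \<inter> lp_sphere p n) = emeasure (leb n) (lp_ball p n \<inter> E) / emeasure (leb n) (lp_ball p n)"
    unfolding cone_prob_def
    using emeasure_cone_over[of "E \<inter> lp_sphere p n" n p] emeasure_open_cone_scale_invariant[OF E n p] E n p by simp
  also have "\<dots> = emeasure (unif_ball p n) E"
    unfolding unif_ball_def using E by (subst emeasure_uniform_measure) auto
  finally show ?thesis .
qed

text \<open>The pieces are grid cells of the width from \<open>haus_small_piece_bounds\<close>;
  finitely many suffice since coordinates on the sphere lie in [-1, 1].\<close>

lemma sphere_piece_partition:
  assumes p: "1 \<le> p" and n: "n = Suc k"
  obtains I :: "(nat \<Rightarrow> int) set" and Q where "finite I" "disjoint_family_on Q I" "\<And>i. Q i \<in> sets (leb n)"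
    "lp_sphere p n = (\<Union>i\<in>I. Q i)"
    "\<And>i A. A \<in> sets (leb n) \<Longrightarrow> A \<subseteq> Q i \<Longrightarrow>
      haus n k A \<le> ennreal (2 * real n ^ 2) * (cube_haus k * emeasure (leb n) (open_cone n A)) \<and>
      cube_haus k * emeasure (leb n) (open_cone n A) \<le> 2 * haus n k A"
proof -
  have p0: "0 < p" using p by simp
  obtain \<delta> where \<delta>: "0 < \<delta>" and piece:
    "\<And>A. \<lbrakk>A \<in> sets (leb n); A \<subseteq> lp_sphere p n;
      \<And>x y i. x \<in> A \<Longrightarrow> y \<in> A \<Longrightarrow> i < n \<Longrightarrow> \<lfloor>x i / \<delta>\<rfloor> = \<lfloor>y i / \<delta>\<rfloor>\<rbrakk> \<Longrightarrow>
      haus n k A \<le> ennreal (2 * real n ^ 2) * (cube_haus k * emeasure (leb n) (open_cone n A)) \<and>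
      cube_haus k * emeasure (leb n) (open_cone n A) \<le> 2 * haus n k A"
    using haus_small_piece_bounds[OF n p] by metis
  define I where "I = ({..<n} \<rightarrow>\<^sub>E {\<lfloor>- 1 / \<delta>\<rfloor>..\<lfloor>1 / \<delta>\<rfloor>})"
  define Q where "Q = (\<lambda>j. {x \<in> lp_sphere p n. \<forall>i<n. \<lfloor>x i / \<delta>\<rfloor> = j i})"
  show ?thesis
  proof (rule that[of I Q])
    show "finite I" unfolding I_def by (intro finite_PiE) auto
    show "disjoint_family_on Q I"
      unfolding disjoint_family_on_def
    proof (intro ballI impI)
      fix j j' assume *: "j \<in> I" "j' \<in> I" "j \<noteq> j'"
      then obtain i where "j i \<noteq> j' i" by blast
      moreover from this have "i < n" using * by (cases "i < n") (auto simp: I_def PiE_def extensional_def)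
      ultimately show "Q j \<inter> Q j' = {}" by (auto simp: Q_def)
    qed
    show "Q j \<in> sets (leb n)" for j
    proof -
      have "Q j = lp_sphere p n \<inter> {x \<in> space (leb n). \<forall>i\<in>{..<n}. real_of_int \<lfloor>x i / \<delta>\<rfloor> = real_of_int (j i)}"
        by (auto simp: Q_def lp_sphere_def)
      also have "\<dots> \<in> sets (leb n)" by measurable
      finally show ?thesis .
    qed
    show "lp_sphere p n = (\<Union>j\<in>I. Q j)"
    proof (intro set_eqI iffI)
      fix x assume x: "x \<in> lp_sphere p n"
      let ?j = "\<lambda>i\<in>{..<n}. \<lfloor>x i / \<delta>\<rfloor>"
      have "?j \<in> I"
        unfolding I_def
      proof (rule PiE_I)
        fix i assume i: "i \<in> {..<n}"
        then have "\<bar>x i\<bar> \<le> 1" using lp_sphereD(3)[OF x p0] by simp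
        then have "- 1 \<le> x i" "x i \<le> 1" by linarith+
        then have "- 1 / \<delta> \<le> x i / \<delta>" "x i / \<delta> \<le> 1 / \<delta>" using \<delta> by (simp_all only: divide_right_mono less_imp_le)
        then show "?j i \<in> {\<lfloor>- 1 / \<delta>\<rfloor>..\<lfloor>1 / \<delta>\<rfloor>}" using i by (auto intro!: floor_mono)
      qed auto
      moreover have "x \<in> Q ?j" using x by (simp add: Q_def)
      ultimately show "x \<in> (\<Union>j\<in>I. Q j)" by blast
    qed (auto simp: Q_def)
    show "haus n k A \<le> ennreal (2 * real n ^ 2) * (cube_haus k * emeasure (leb n) (open_cone n A)) \<and>
      cube_haus k * emeasure (leb n) (open_cone n A) \<le> 2 * haus n k A" if A: "A \<in> sets (leb n)" "A \<subseteq> Q j" for j A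
    proof (rule piece[OF A(1)])
      show "A \<subseteq> lp_sphere p n" using A(2) by (auto simp: Q_def)
      fix x y i assume "x \<in> A" "y \<in> A" "i < n"
      then show "\<lfloor>x i / \<delta>\<rfloor> = \<lfloor>y i / \<delta>\<rfloor>" using subsetD[OF A(2), of x] subsetD[OF A(2), of y] by (simp add: Q_def)
    qed
  qed
qed

text \<open>Additivity of Hausdorff measure on the sphere comes for free from the existence of a random vector with
  the surface distribution.\<close>
lemma surface_prob_bounds:
  assumes p: "1 \<le> p" and n: "2 \<le> n" and M: "prob_space M" and X: "surface_distributed M p n X"
    and E: "E \<in> sets (leb n)" "scale_invariant n E"
  defines "P \<equiv> measure (distr M (leb n) X)"
  shows "P E \<le> 4 * real n ^ 2 * measure (unif_ball p n) E"
    and "measure (unif_ball p n) E \<le> 4 * real n ^ 2 * P E"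
proof -
  obtain k where k: "n = Suc k" "0 < k" using n by (cases n) auto
  have p0: "0 < p" and n0: "0 < n" using p n by auto
  let ?S = "lp_sphere p n" and ?D = "distr M (leb n) X"
  have X_meas: "X \<in> measurable M (leb n)" using X by (simp add: surface_distributed_def)
  interpret M: prob_space M by (rule M)
  interpret D: prob_space ?D by (rule M.prob_space_distr[OF X_meas])
  have law: "emeasure ?D A = haus n k (A \<inter> ?S) / haus n k ?S" if "A \<in> sets (leb n)" for A
    using X that k by (simp add: surface_distributed_def surface_prob_def)
  \<comment> \<open>In \<open>ennreal\<close> both 0 / 0 and
    \<open>\<infinity> / \<infinity>\<close> are 0, so total mass 1 forces the Hausdorff measure of
    the sphere to be positive and finite.\<close>
  have "1 = emeasure ?D (space (leb n))" using D.emeasure_space_1 by simp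
  also have "\<dots> = haus n k ?S / haus n k ?S"
    by (subst law) (auto simp: lp_sphere_def Int_absorb1 Collect_conj_eq Int_absorb2 intro!: arg_cong2[where f = "(/)"] arg_cong[where f = "haus n k"])
  finally have HS: "haus n k ?S \<noteq> 0" "haus n k ?S \<noteq> \<infinity>"
    by (auto simp: ennreal_divide_top)
  then obtain h where h: "haus n k ?S = ennreal h" "0 < h"
    by (cases "haus n k ?S") (auto simp: less_le)
  obtain c where c: "cube_haus k = ennreal c" "0 < c"
    using cube_haus_pos[OF k(2)] cube_haus_finite[of k] by (cases "cube_haus k") auto
  have cone_le: "emeasure (leb n) (open_cone n A) \<le> emeasure (leb n) (lp_ball p n)" if "A \<subseteq> ?S" for A
    unfolding open_cone_eq[OF that p0] by (rule emeasure_mono) (auto simp: lp_ball_def)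
  then have cone_fin: "emeasure (leb n) (open_cone n A) < \<infinity>" if "A \<subseteq> ?S" for A
    using that emeasure_lp_ball_finite[OF p0, of n] le_less_trans by blast
  define \<mu> where "\<mu> = (\<lambda>A. measure (leb n) (open_cone n A))"
  have \<mu>: "emeasure (leb n) (open_cone n A) = ennreal (\<mu> A)" if "A \<subseteq> ?S" for A
    unfolding \<mu>_def using cone_fin[OF that] by (intro emeasure_eq_ennreal_measure) auto
  obtain I :: "(nat \<Rightarrow> int) set" and Q where I: "finite I" "disjoint_family_on Q I" and Q: "\<And>i. Q i \<in> sets (leb n)"
    and SQ: "?S = (\<Union>i\<in>I. Q i)" and piece: "\<And>i A. A \<in> sets (leb n) \<Longrightarrow> A \<subseteq> Q i \<Longrightarrow>
      haus n k A \<le> ennreal (2 * real n ^ 2) * (cube_haus k * emeasure (leb n) (open_cone n A)) \<and>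
      cube_haus k * emeasure (leb n) (open_cone n A) \<le> 2 * haus n k A"
    using sphere_piece_partition[OF p k(1)] by metis
  \<comment> \<open>Through this identity Hausdorff measure inherits additivity from the
    law.\<close>
  have H_eq: "haus n k A = ennreal (P A * h)" if "A \<in> sets (leb n)" "A \<subseteq> ?S" for A
  proof -
    have "ennreal (P A) = haus n k A / ennreal h"
      using law[OF that(1)] that(2) by (simp add: P_def D.emeasure_eq_measure h Int_absorb2)
    then have "ennreal (P A) * ennreal h = haus n k A"
      using h by (simp add: ennreal_divide_times mult_divide_eq_ennreal)
    then show ?thesis by (simp add: ennreal_mult'' h(2) less_imp_le)
  qed
  \<comment> \<open>The constants are the same for all pieces, so the bounds can be summed over the
    partition.\<close>
  have total: "P A * h \<le> 2 * real n ^ 2 * (c * \<mu> A)" "c * \<mu> A \<le> 2 * (P A * h)"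
    if A: "A \<in> sets (leb n)" "A \<subseteq> ?S" for A
  proof -
    have sub: "A \<inter> Q i \<subseteq> ?S" for i using A by blast
    have part: "P (A \<inter> Q i) * h \<le> 2 * real n ^ 2 * (c * \<mu> (A \<inter> Q i))"
      "c * \<mu> (A \<inter> Q i) \<le> 2 * (P (A \<inter> Q i) * h)" for i
    proof -
      have nn: "0 \<le> P (A \<inter> Q i) * h" "0 \<le> c * \<mu> (A \<inter> Q i)" using h c by (auto simp: P_def \<mu>_def)
      have pc: "haus n k (A \<inter> Q i) \<le> ennreal (2 * real n ^ 2) * (cube_haus k * emeasure (leb n) (open_cone n (A \<inter> Q i)))"
        "cube_haus k * emeasure (leb n) (open_cone n (A \<inter> Q i)) \<le> 2 * haus n k (A \<inter> Q i)"
        using piece[of "A \<inter> Q i" i] A Q by auto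
      have AQ: "A \<inter> Q i \<in> sets (leb n)" using A Q by auto
      have e1: "cube_haus k * emeasure (leb n) (open_cone n (A \<inter> Q i)) = ennreal (c * \<mu> (A \<inter> Q i))"
        using c by (simp add: \<mu>[OF sub] ennreal_mult')
      have e2: "ennreal (2 * real n ^ 2) * ennreal (c * \<mu> (A \<inter> Q i)) = ennreal (2 * real n ^ 2 * (c * \<mu> (A \<inter> Q i)))"
        by (rule ennreal_mult'[symmetric]) simp
      have e3: "2 * ennreal (P (A \<inter> Q i) * h) = ennreal (2 * (P (A \<inter> Q i) * h))"
        by (simp add: ennreal_mult')
      show "P (A \<inter> Q i) * h \<le> 2 * real n ^ 2 * (c * \<mu> (A \<inter> Q i))"
        using pc(1) nn unfolding e1 e2 H_eq[OF AQ sub] by (subst (asm) ennreal_le_iff) auto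
      show "c * \<mu> (A \<inter> Q i) \<le> 2 * (P (A \<inter> Q i) * h)"
        using pc(2) nn unfolding e1 H_eq[OF AQ sub] e3 by (subst (asm) ennreal_le_iff) auto
    qed
    have "P A = (\<Sum>i\<in>I. P (A \<inter> Q i))"
    proof -
      have "A = (\<Union>i\<in>I. A \<inter> Q i)" using A SQ by blast
      then have "P A = P (\<Union>i\<in>I. A \<inter> Q i)" by simp
      also have "\<dots> = (\<Sum>i\<in>I. P (A \<inter> Q i))"
        unfolding P_def using I A Q
        by (intro D.finite_measure_finite_Union) (auto simp: disjoint_family_on_def)
      finally show ?thesis .
    qed
    moreover have "\<mu> A = (\<Sum>i\<in>I. \<mu> (A \<inter> Q i))"
    proof -
      have "ennreal (\<mu> A) = (\<Sum>i\<in>I. ennreal (\<mu> (A \<inter> Q i)))"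
        unfolding \<mu>[OF A(2), symmetric] \<mu>[OF sub, symmetric]
        by (rule open_cone_sphere_partition[OF A(2) p0 I]) (use A Q SQ in auto)
      then show ?thesis by (simp add: \<mu>_def sum_nonneg)
    qed
    ultimately show "P A * h \<le> 2 * real n ^ 2 * (c * \<mu> A)" "c * \<mu> A \<le> 2 * (P A * h)"
      using sum_mono[of I, OF part(1)] sum_mono[of I, OF part(2)]
      by (simp_all add: sum_distrib_left sum_distrib_right)
  qed
  let ?B = "E \<inter> ?S"
  have B: "?B \<in> sets (leb n)" "?B \<subseteq> ?S" using E by auto
  have PB: "P ?B = P E"
  proof -
    have "emeasure ?D ?B = emeasure ?D E" using law[OF B(1)] law[OF E(1)] by (simp add: Int_assoc)
    then show ?thesis by (simp add: P_def measure_def)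
  qed
  have PS: "P ?S = 1"
  proof -
    have "emeasure ?D ?S = 1" using law[of ?S] h by (simp add: divide_ennreal)
    then show ?thesis by (simp add: P_def measure_def)
  qed
  have \<mu>S: "\<mu> ?S = measure (leb n) (lp_ball p n)"
  proof -
    have "scale_invariant n (space (leb n))" by (simp add: scale_invariant_def)
    from emeasure_open_cone_scale_invariant[OF sets.top this n0 p0]
    have "emeasure (leb n) (open_cone n ?S) = emeasure (leb n) (lp_ball p n)"
      by (simp add: lp_sphere_def lp_ball_def Int_absorb1 Int_absorb2 Int_def cong: conj_cong)
    then show ?thesis by (simp add: \<mu>_def measure_def)
  qed
  have \<mu>pos: "0 < \<mu> ?S"
    unfolding \<mu>S using emeasure_lp_ball_pos[OF n0 p0] emeasure_lp_ball_finite[OF p0, of n]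
    by (simp add: measure_def enn2real_positive_iff)
  have q: "measure (unif_ball p n) E = \<mu> ?B / \<mu> ?S"
    unfolding measure_unif_ball_eq[OF E(1) n0 p0] \<mu>S
    using emeasure_open_cone_scale_invariant[OF E n0 p0] by (simp add: \<mu>_def measure_def)
  have S: "?S \<in> sets (leb n)" "?S \<subseteq> ?S" by auto
  note tB = total[OF B, unfolded PB] and tS = total[OF S, unfolded PS mult_1]
  have \<mu>B: "0 \<le> \<mu> ?B" by (simp add: \<mu>_def)
  have PE: "0 \<le> P E" by (simp add: P_def)
  \<comment> \<open>The normalising constants are unknown; the bound for the trace of
    \<open>E\<close> is combined with the opposite bound for the whole sphere, which eliminates
    \<open>h\<close> and \<open>c\<close> and multiplies 2 and 2 n^2.\<close>
  have "P E * \<mu> ?S * c \<le> 2 * (P E * h)"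
    using mult_left_mono[OF tS(2) PE] by (simp add: mult_ac)
  also have "\<dots> \<le> 2 * (2 * real n ^ 2 * (c * \<mu> ?B))" by (rule mult_left_mono[OF tB(1)]) simp
  finally have "P E * \<mu> ?S \<le> 4 * real n ^ 2 * \<mu> ?B" using c(2) by (simp add: mult_ac)
  then show "P E \<le> 4 * real n ^ 2 * measure (unif_ball p n) E"
    unfolding q using \<mu>pos by (simp add: pos_le_divide_eq)
  have "c * \<mu> ?B \<le> 2 * (P E * h)" by (rule tB(2))
  also have "\<dots> \<le> 2 * (P E * (2 * real n ^ 2 * (c * \<mu> ?S)))" using tS(1) PE by (intro mult_left_mono) auto
  finally have "\<mu> ?B \<le> 4 * real n ^ 2 * P E * \<mu> ?S" using c(2) by (simp add: mult_ac)
  then show "measure (unif_ball p n) E \<le> 4 * real n ^ 2 * P E"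
    unfolding q using \<mu>pos by (simp add: pos_divide_le_eq)
qed

text \<open>Uniform and cone law even give equality; since \<open>4 * n ^ 2\<close> is at least 1,
  all three laws fit the form dictated by the surface law.\<close>

lemma prob_event_bounds:
  assumes p: "1 \<le> p" and n: "2 \<le> n" and M: "prob_space M"
    and X: "uniform_on_ball M p n X \<or> cone_distributed M p n X \<or> surface_distributed M p n X"
    and E: "E \<in> sets (leb n)" "scale_invariant n E"
  shows "measure M {\<omega> \<in> space M. X \<omega> \<in> E} \<le> 4 * real n ^ 2 * measure (unif_ball p n) E \<and>
    measure (unif_ball p n) E \<le> 4 * real n ^ 2 * measure M {\<omega> \<in> space M. X \<omega> \<in> E}"
proof -
  have p0: "0 < p" and n0: "0 < n" using p n by auto
  have X_meas: "X \<in> measurable M (leb n)"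
    using X by (auto simp: uniform_on_ball_def cone_distributed_def surface_distributed_def)
  have P: "measure M {\<omega> \<in> space M. X \<omega> \<in> E} = measure (distr M (leb n) X) E"
    using X_meas E by (subst measure_distr) (auto intro!: arg_cong[where f = "measure M"])
  have n4: "1 \<le> 4 * real n ^ 2"
  proof -
    have "1 \<le> real n ^ 2" using n by (intro one_le_power) auto
    then show ?thesis by simp
  qed
  from X consider "measure (distr M (leb n) X) E = measure (unif_ball p n) E" | "surface_distributed M p n X"
  proof (elim disjE)
    assume "uniform_on_ball M p n X"
    then show ?thesis using that(1) by (simp add: uniform_on_ball_def unif_ball_def)
  next
    assume "cone_distributed M p n X"
    then have "emeasure (distr M (leb n) X) E = emeasure (unif_ball p n) E"
      using E cone_prob_scale_invariant[OF E n0 p0] by (simp add: cone_distributed_def)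
    then show ?thesis using that(1) by (simp add: measure_def)
  qed (use that in blast)
  then show ?thesis
  proof cases
    case 1
    then show ?thesis
      unfolding P using mult_right_mono[OF n4, of "measure (unif_ball p n) E"] by simp
  next
    case 2
    then show ?thesis unfolding P using surface_prob_bounds[OF p n M 2 E] by simp
  qed
qed

text \<open>A polynomial factor is eventually below \<open>exp (n * e)\<close>, so it cannot change
  the exponential rate.\<close>

lemma eln_tendsto:
  fixes P q :: "nat \<Rightarrow> real"
  assumes q: "\<And>\<epsilon>. 0 < \<epsilon> \<Longrightarrow> \<forall>\<^sub>F n in sequentially. q n \<le> exp (real n * (- J + \<epsilon>))"
    "\<And>\<epsilon>. 0 < \<epsilon> \<Longrightarrow> \<forall>\<^sub>F n in sequentially. exp (real n * (- J - \<epsilon>)) \<le> q n"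
    and Pq: "\<forall>\<^sub>F n in sequentially. P n \<le> 4 * real n ^ 2 * q n \<and> q n \<le> 4 * real n ^ 2 * P n"
  shows "(\<lambda>n. eln (P n) / ereal (real n)) \<longlonglongrightarrow> ereal (- J)"
proof -
  have main: "\<forall>\<^sub>F n in sequentially. 0 < n \<and> 0 < P n \<and> \<bar>ln (P n) / real n - (- J)\<bar> < \<epsilon>" if \<epsilon>: "0 < \<epsilon>" for \<epsilon>
  proof -
    define e where "e = \<epsilon> / 3"
    have e: "0 < e" using \<epsilon> by (simp add: e_def)
    have "\<forall>\<^sub>F n in sequentially. 4 * real n ^ 2 \<le> exp (real n * e)" using e by real_asymp
    then show ?thesis
      using q(1)[OF e] q(2)[OF e] Pq eventually_gt_at_top[of 0]
    proof eventually_elim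
      case (elim n)
      have "0 < q n" using elim(3) exp_gt_zero less_le_trans by blast
      then have "0 < 4 * real n ^ 2 * P n" using elim(4) by linarith
      then have P0: "0 < P n" using elim(5) by (simp add: zero_less_mult_iff)
      have "P n \<le> 4 * real n ^ 2 * q n" using elim by simp
      also have "\<dots> \<le> exp (real n * e) * exp (real n * (- J + e))"
        using elim \<open>0 < q n\<close> by (intro mult_mono) auto
      also have "\<dots> = exp (real n * (- J + 2 * e))" by (simp add: exp_add[symmetric] algebra_simps)
      finally have "ln (P n) \<le> real n * (- J + 2 * e)"
        using ln_le_cancel_iff[OF P0 exp_gt_zero, of "real n * (- J + 2 * e)"] by simp
      then have up: "ln (P n) / real n \<le> - J + 2 * e" using elim(5) by (simp add: pos_divide_le_eq mult.commute)
      have "exp (real n * (- J - e)) \<le> q n" using elim by simp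
      also have "\<dots> \<le> exp (real n * e) * P n"
        using elim P0 order_trans[OF conjunct2[OF elim(4)] mult_right_mono[OF elim(1), of "P n"]] by simp
      finally have "exp (real n * (- J - e)) * exp (- (real n * e)) \<le> exp (real n * e) * P n * exp (- (real n * e))"
        by (rule mult_right_mono) simp
      also have "\<dots> = P n" by (simp add: exp_minus)
      also have "exp (real n * (- J - e)) * exp (- (real n * e)) = exp (real n * (- J - 2 * e))"
        by (simp add: exp_add[symmetric] algebra_simps)
      finally have "real n * (- J - 2 * e) \<le> ln (P n)" using P0 by (simp add: ln_ge_iff)
      then have "- J - 2 * e \<le> ln (P n) / real n" using elim(5) by (simp add: pos_le_divide_eq mult.commute)
      with up have "\<bar>ln (P n) / real n - (- J)\<bar> \<le> 2 * e" by (simp add: abs_le_iff)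
      also have "2 * e < \<epsilon>" using \<epsilon> by (simp add: e_def)
      finally show ?case using elim(5) P0 by simp
    qed
  qed
  have "(\<lambda>n. ln (P n) / real n) \<longlonglongrightarrow> - J"
    unfolding tendsto_iff dist_real_def
  proof (intro allI impI)
    fix \<epsilon> :: real assume "0 < \<epsilon>"
    from main[OF this] show "\<forall>\<^sub>F n in sequentially. \<bar>ln (P n) / real n - (- J)\<bar> < \<epsilon>"
      by (rule eventually_mono) simp
  qed
  then have lim: "(\<lambda>n. ereal (ln (P n) / real n)) \<longlonglongrightarrow> ereal (- J)" by (rule tendsto_ereal)
  \<comment> \<open>\<open>P n\<close> is positive for large \<open>n\<close>, so \<open>eln\<close>
    is on its finite branch.\<close>
  moreover have "\<forall>\<^sub>F n in sequentially. ereal (ln (P n) / real n) = eln (P n) / ereal (real n)"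
    using main[OF zero_less_one] by (rule eventually_mono) (simp add: eln_def)
  ultimately show ?thesis by (rule Lim_transform_eventually)
qed

lemma scale_invariant_events:
  assumes "0 < n" "0 < p"
  shows "scale_invariant n (ge_event p \<theta> n)" "scale_invariant n (le_event p \<theta> n)"
  using assms
  by (auto simp: scale_invariant_def ge_event_def le_event_def geom_mean_dilate power_mean_dilate mult.left_commute[of \<theta>])

theorem theorem1p4:
  fixes p :: real
    and M :: "nat \<Rightarrow> 'a measure"
    and X :: "nat \<Rightarrow> 'a \<Rightarrow> nat \<Rightarrow> real"
  assumes "1 \<le> p"
    and "\<And>n. 1 \<le> n \<Longrightarrow> prob_space (M n)"
    and "\<And>n. 1 \<le> n \<Longrightarrow>
           uniform_on_ball (M n) p n (X n) \<or>
           cone_distributed (M n) p n (X n) \<or>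
           surface_distributed (M n) p n (X n)"
  shows "strict_mono_on {0<..} H_fun \<and> bij_betw H_fun {0<..} {..<0} \<and>
    (\<forall>\<theta>\<in>{exp (m_exp p)..<1}.
       (\<lambda>n. eln \<P>(\<omega> in M n. geom_mean n (X n \<omega>) \<ge> \<theta> * power_mean p n (X n \<omega>)) / ereal (real n))
         \<longlonglongrightarrow> ereal (- J_rate p \<theta>)) \<and>
    (\<forall>\<theta>\<in>{0<..exp (m_exp p)}.
       (\<lambda>n. eln \<P>(\<omega> in M n. geom_mean n (X n \<omega>) \<le> \<theta> * power_mean p n (X n \<omega>)) / ereal (real n))
         \<longlonglongrightarrow> ereal (- J_rate p \<theta>)) \<and>
    (\<forall>\<theta>\<in>{0<..<1}. 0 \<le> J_rate p \<theta>) \<and>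
    J_rate p (exp (m_exp p)) = 0 \<and>
    filterlim (J_rate p) at_top (at_right 0) \<and>
    filterlim (J_rate p) at_top (at_left 1)"
proof (intro conjI ballI)
  note p = assms(1)
  have X_space: "X n \<omega> \<in> space (leb n)" if "1 \<le> n" "\<omega> \<in> space (M n)" for n \<omega>
    using assms(3)[OF that(1)] that(2)
    by (auto simp: uniform_on_ball_def cone_distributed_def surface_distributed_def intro: measurable_space)
  show "strict_mono_on {0<..} H_fun" by (rule strict_mono_on_H_fun)
  show "bij_betw H_fun {0<..} {..<0}" by (rule bij_betw_H_fun)
  show "0 \<le> J_rate p \<theta>" if "\<theta> \<in> {0<..<1}" for \<theta> using that p by (intro J_rate_nonneg) auto
  show "J_rate p (exp (m_exp p)) = 0" by (rule J_rate_exp_m_exp[OF p])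
  show "filterlim (J_rate p) at_top (at_right 0)" by (rule J_rate_at_0[OF p])
  show "filterlim (J_rate p) at_top (at_left 1)" by (rule J_rate_at_1[OF p])
  show "(\<lambda>n. eln \<P>(\<omega> in M n. geom_mean n (X n \<omega>) \<ge> \<theta> * power_mean p n (X n \<omega>)) / ereal (real n))
         \<longlonglongrightarrow> ereal (- J_rate p \<theta>)" if \<theta>: "\<theta> \<in> {exp (m_exp p)..<1}" for \<theta>
  proof (rule eln_tendsto[OF unif_ball_ge_event[OF p \<theta>]])
    show "\<forall>\<^sub>F n in sequentially.
        \<P>(\<omega> in M n. geom_mean n (X n \<omega>) \<ge> \<theta> * power_mean p n (X n \<omega>)) \<le> 4 * real n ^ 2 * measure (unif_ball p n) (ge_event p \<theta> n) \<and>
        measure (unif_ball p n) (ge_event p \<theta> n) \<le> 4 * real n ^ 2 * \<P>(\<omega> in M n. geom_mean n (X n \<omega>) \<ge> \<theta> * power_mean p n (X n \<omega>))"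
      \<comment> \<open>The comparison is available from \<open>n = 2\<close> on, where the sphere
        has positive dimension; it is uniform over the three laws, which may alternate with
        \<open>n\<close>.\<close>
      using eventually_ge_at_top[of 2]
    proof eventually_elim
      case (elim n)
      then have n1: "1 \<le> n" by simp
      have "{\<omega> \<in> space (M n). X n \<omega> \<in> ge_event p \<theta> n} = {\<omega> \<in> space (M n). geom_mean n (X n \<omega>) \<ge> \<theta> * power_mean p n (X n \<omega>)}"
        using X_space[of n] elim by (auto simp: ge_event_def)
      then show ?case
        using prob_event_bounds[OF p elim assms(2)[OF n1] assms(3)[OF n1], of "ge_event p \<theta> n"] elim p
        by (simp add: scale_invariant_events)
    qed
  qed
  show "(\<lambda>n. eln \<P>(\<omega> in M n. geom_mean n (X n \<omega>) \<le> \<theta> * power_mean p n (X n \<omega>)) / ereal (real n))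
         \<longlonglongrightarrow> ereal (- J_rate p \<theta>)" if \<theta>: "\<theta> \<in> {0<..exp (m_exp p)}" for \<theta>
  proof (rule eln_tendsto[OF unif_ball_le_event[OF p \<theta>]])
    show "\<forall>\<^sub>F n in sequentially.
        \<P>(\<omega> in M n. geom_mean n (X n \<omega>) \<le> \<theta> * power_mean p n (X n \<omega>)) \<le> 4 * real n ^ 2 * measure (unif_ball p n) (le_event p \<theta> n) \<and>
        measure (unif_ball p n) (le_event p \<theta> n) \<le> 4 * real n ^ 2 * \<P>(\<omega> in M n. geom_mean n (X n \<omega>) \<le> \<theta> * power_mean p n (X n \<omega>))"
      using eventually_ge_at_top[of 2]
    proof eventually_elim
      case (elim n)
      then have n1: "1 \<le> n" by simp
      have "{\<omega> \<in> space (M n). X n \<omega> \<in> le_event p \<theta> n} = {\<omega> \<in> space (M n). geom_mean n (X n \<omega>) \<le> \<theta> * power_mean p n (X n \<omega>)}"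
        using X_space[of n] elim by (auto simp: le_event_def)
      then show ?case
        using prob_event_bounds[OF p elim assms(2)[OF n1] assms(3)[OF n1], of "le_event p \<theta> n"] elim p
        by (simp add: scale_invariant_events)
    qed
  qed
qed

end
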